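(* Let $\mathcal{M}=(S,Act,\bar s,\mathbf{P})$ be an MDP, $\varphi_1,\dots,\varphi_k$ Rabin properties with pair sets $P_1,\dots,P_k$, $\lambda_i\in[0,1]$, $\triangleright\in\{\geq,>\}$, and $\Phi=\forall\mathfrak{S}.\bigvee_{i=1}^k\mathbb{P}_{\triangleright\lambda_i}(\bar\varphi_i)$. Let $\widehat{\mathcal{M}}=\mathcal{M}_{/\mathcal{D}_{\mathsf{MEC}}}^{\mathcal{I}^*}$ and $\widehat\Phi=\forall\mathfrak{S}.\bigvee_{i=1}^k\mathbb{P}_{\triangleright\lambda_i}(\lozenge\bar G_i)$ with $\bar G_i=\{\bot_I\mid I\subseteq[k],\ i\notin I\}$. Let $\Lambda:S\to2^L$ be a labeling and $\widehat\Lambda$ its lifting. If $\widehat{\mathcal{M}}'$ is a witnessing subsystem of $\widehat{\mathcal{M}}$ for $\widehat\Phi$ that is minimal with respect to $\widehat\Lambda$, and $X\subseteq\mathcal{D}_{\mathsf{MEC}}$ is the set of states of $\widehat{\mathcal{M}}'$ lying in $\mathcal{D}_{\mathsf{MEC}}$, then the subsystem $\mathcal{M}_{S'}$ of $\mathcal{M}$ with $S'=\bigcup_{D\in X}D$ is a witnessing subsystem for $\Phi$ and is minimal with respect to $\Lambda$.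
   Context: MDPs, schedulers, ECs/MECs, $\mathcal{D}_{\mathsf{MEC}}$, Rabin properties, $\models_{\mathsf{Rabin}}$, query semantics and quotients are as follows. An MDP $(S,Act,\bar s,\mathbf{P})$ has finite $S,Act$, initial $\bar s$, partial $\mathbf{P}:S\times Act\to\mathrm{Dist}(S)$, enabled pairs $\mathsf{En}$; actions of distinct states are pairwise disjoint. An EC is a nonempty $\mathcal{E}\subseteq\mathsf{En}$ closed under successors (all successors of pairs in $\mathcal{E}$ lie in $S(\mathcal{E})$, the states occurring in $\mathcal{E}$) whose graph is strongly connected; MECs are inclusion-maximal ECs; $\mathcal{D}_{\mathsf{MEC}}$ partitions $S$ into MEC state sets and singletons of states in no MEC. A Rabin property with pairs $P\subseteq2^S\times2^S$ is the path set $\bigvee_{(F,E)\in P}(\square\lozenge F\wedge\lozenge\square E)$; $\bar\varphi$ denotes complement; $\mathcal{E}\models_{\mathsf{Rabin}}P$ iff some $(F,E)\in P$ has $S(\mathcal{E})\cap F\ne\emptyset$, $S(\mathcal{E})\subseteq E$. $\mathcal{I}^*=\{(S(\mathcal{E}),I)\mid\mathcal{E}\text{ MEC},I\subseteq[k],\exists\text{ EC }\mathcal{E}'\subseteq\mathcal{E}\ \forall i\in I:\mathcal{E}'\models_{\mathsf{Rabin}}P_i\}$. For a partition $\mathcal{D}$ and $\mathcal{I}\subseteq\mathcal{D}\times2^{[k]}$, $\mathcal{M}_{/\mathcal{D}}^{\mathcal{I}}$ has states $\mathcal{D}\cup\{\bot_I\}_{I\subseteq[k]}$, initial state $[\bar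 s]_{\mathcal{D}}$, transitions $\mathbf{P}'([s],a,[s'])=\mathbf{P}(s,a,[s'])$ for $(s,a)$ with $\mathbf{P}(s,a,[s])<1$, $\mathbf{P}'(D,\tau_I,\bot_I)=1$ for $(D,I)\in\mathcal{I}$, and absorbing $\bot_I$. $\mathcal{M}\models\forall\mathfrak{S}.\bigvee_i\mathbb{P}_{\triangleright\lambda_i}(\psi_i)$ iff for every scheduler some $i$ has $\Pr^{\mathfrak{S}}_{\mathcal{M},\bar s}(\psi_i)\triangleright\lambda_i$ ($\exists\wedge$ analogously). Subsystems: for $\bar s\in S'\subseteq S$, the subsystem $\mathcal{M}_{S'}$ is the sub-stochastic MDP $(S',Act,\bar s,\mathbf{P}')$ keeping all enabled pairs of states in $S'$ with $\mathbf{P}'(s,a,s')=\mathbf{P}(s,a,s')$ for $s,s'\in S'$ (probability mass to $S\setminus S'$ is lost; equivalently it goes to a sink on which every property fails). A witnessing subsystem for a query is a subsystem satisfying it. A labeling is $\Lambda:S\to2^L$ for a finite label set $L$, with $\Lambda(S')=\bigcup_{s\in S'}\Lambda(s)$; a witnessing subsystem with states $S'$ is minimal w.r.t. $\Lambda$ if $|\Lambda(S')|\le|\Lambda(S'')|$ for every witnessing subsystem with states $S''$. The lifting is $\widehat\Lambda(D)=\bigcup_{s\in D}\Lambda(s)$ for $D\in\mathcal{D}_{\mathsf{MEC}}$ and $\widehat\Lambda(\bot_I)=\emptyset$.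
   Formalization: Added assumption: if ▷ is ≥ and some λ_i = 0 (the query is trivially true), the class of the initial state carries no labels beyond those of the initial state; otherwise the claimed minimality fails, since {s̄} alone is then a witness with fewer labels. *)

theory Defs
  imports "HOL-Probability.Probability"
begin

section \<open>(Sub-stochastic) Markov decision processes\<close>

text \<open>
  The partial function \<open>tran\<close> maps an enabled pair to an \<open>spmf\<close>; the mass of \<open>None\<close> is the
  probability that is lost. An MDP in the strict sense has no lost mass (see \<open>is_mdp\<close>).
  Only the values of \<open>tran\<close> on \<open>states \<times> acts\<close> matter.
\<close>

record ('s, 'a) mdp =
  states :: "'s set"
  acts :: "'a set"
  init :: 's
  tran :: "'s \<Rightarrow> 'a \<Rightarrow> 's spmf option"

definition En :: "('s, 'a) mdp \<Rightarrow> ('s \<times> 'a) set" where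
  "En M = {(s, a). s \<in> states M \<and> a \<in> acts M \<and> tran M s a \<noteq> None}"

definition enabled :: "('s, 'a) mdp \<Rightarrow> 's \<Rightarrow> 'a set" where
  "enabled M s = {a. (s, a) \<in> En M}"

definition Pdist :: "('s, 'a) mdp \<Rightarrow> 's \<Rightarrow> 'a \<Rightarrow> 's spmf" where
  "Pdist M s a = (if (s, a) \<in> En M then the (tran M s a) else return_pmf None)"

definition is_sub_mdp :: "('s, 'a) mdp \<Rightarrow> bool" where
  "is_sub_mdp M \<longleftrightarrow>
     finite (states M) \<and> finite (acts M) \<and> init M \<in> states M \<and>
     (\<forall>(s, a)\<in>En M. set_spmf (Pdist M s a) \<subseteq> states M)"

definition is_mdp :: "('s, 'a) mdp \<Rightarrow> bool" where
  "is_mdp M \<longleftrightarrow>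
     is_sub_mdp M \<and>
     (\<forall>(s, a)\<in>En M. lossless_spmf (Pdist M s a)) \<and>
     (\<forall>s\<in>states M. \<forall>t\<in>states M. s \<noteq> t \<longrightarrow> enabled M s \<inter> enabled M t = {})"


section \<open>Schedulers and the path measure\<close>

text \<open>
  A scheduler is history dependent and randomized: it is given the list of the state-action pairs
  taken so far and the current state.
\<close>

type_synonym ('s, 'a) scheduler = "('s \<times> 'a) list \<Rightarrow> 's \<Rightarrow> 'a pmf"

definition is_scheduler :: "('s, 'a) mdp \<Rightarrow> ('s, 'a) scheduler \<Rightarrow> bool" where
  "is_scheduler M \<sigma> \<longleftrightarrow>
     (\<forall>h. \<forall>s\<in>states M. enabled M s \<noteq> {} \<longrightarrow> set_pmf (\<sigma> h s) \<subseteq> enabled M s)"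

text \<open>
  Runs are sequences over \<open>Some (s, a)\<close> (state \<open>s\<close> is visited and \<open>a\<close> is chosen there) and \<open>None\<close>.
  The element \<open>None\<close> is an absorbing sink which is entered when mass is lost or when the current
  state has no enabled action, so that the runs without \<open>None\<close> are exactly the infinite paths.
\<close>

definition pick :: "('s, 'a) mdp \<Rightarrow> ('s, 'a) scheduler \<Rightarrow> ('s \<times> 'a) list \<Rightarrow> 's \<Rightarrow> ('s \<times> 'a) spmf" where
  "pick M \<sigma> h s =
     (if enabled M s = {} then return_pmf None else map_spmf (Pair s) (spmf_of_pmf (\<sigma> h s)))"

definition next_step ::
  "('s, 'a) mdp \<Rightarrow> ('s, 'a) scheduler \<Rightarrow> nat \<Rightarrow> (nat \<Rightarrow> ('s \<times> 'a) option) \<Rightarrow> ('s \<times> 'a) spmf" where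
  "next_step M \<sigma> n \<omega> =
     (case n of
        0 \<Rightarrow> pick M \<sigma> [] (init M)
      | Suc m \<Rightarrow>
          (case \<omega> m of
             None \<Rightarrow> return_pmf None
           | Some (s, a) \<Rightarrow> bind_spmf (Pdist M s a) (pick M \<sigma> (map (\<lambda>j. the (\<omega> j)) [0..<n]))))"

definition outcomes :: "('s, 'a) mdp \<Rightarrow> ('s \<times> 'a) option set" where
  "outcomes M = insert None (Some ` (states M \<times> acts M))"

definition step_kernel ::
  "('s, 'a) mdp \<Rightarrow> ('s, 'a) scheduler \<Rightarrow> nat \<Rightarrow> (nat \<Rightarrow> ('s \<times> 'a) option) \<Rightarrow> ('s \<times> 'a) option measure" where
  "step_kernel M \<sigma> n \<omega> = restrict_space (measure_pmf (next_step M \<sigma> n \<omega>)) (outcomes M)"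

text \<open>The measure on runs given by the Ionescu-Tulcea theorem; see \<open>Ionescu_Tulcea_kernel\<close> below.\<close>

definition path_measure ::
  "('s, 'a) mdp \<Rightarrow> ('s, 'a) scheduler \<Rightarrow> (nat \<Rightarrow> ('s \<times> 'a) option) measure" where
  "path_measure M \<sigma> =
     projective_family.lim UNIV
       (Ionescu_Tulcea.CI (step_kernel M \<sigma>) (\<lambda>_. count_space (outcomes M)))
       (\<lambda>_. count_space (outcomes M))"

text \<open>
  Path properties are sets of state sequences. A run that is lost satisfies no property, not even
  the complement of a property.
\<close>

definition Pr :: "('s, 'a) mdp \<Rightarrow> ('s, 'a) scheduler \<Rightarrow> (nat \<Rightarrow> 's) set \<Rightarrow> real" where
  "Pr M \<sigma> \<psi> =
     measure (path_measure M \<sigma>)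
       {\<omega> \<in> space (path_measure M \<sigma>). (\<forall>n. \<omega> n \<noteq> None) \<and> (\<lambda>n. fst (the (\<omega> n))) \<in> \<psi>}"


section \<open>Properties and queries\<close>

type_synonym 's rabin = "('s set \<times> 's set) set"

definition rabin_property :: "'s rabin \<Rightarrow> (nat \<Rightarrow> 's) set" where
  "rabin_property P = {\<pi>. \<exists>(F, E)\<in>P. (\<exists>\<^sub>\<infinity>n. \<pi> n \<in> F) \<and> (\<forall>\<^sub>\<infinity>n. \<pi> n \<in> E)}"

definition reach :: "'s set \<Rightarrow> (nat \<Rightarrow> 's) set" where
  "reach G = {\<pi>. \<exists>n. \<pi> n \<in> G}"

definition forall_or_query ::
  "nat \<Rightarrow> (real \<Rightarrow> real \<Rightarrow> bool) \<Rightarrow> (nat \<Rightarrow> real) \<Rightarrow> (nat \<Rightarrow> (nat \<Rightarrow> 's) set) \<Rightarrow> ('s, 'a) mdp \<Rightarrow> bool" where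
  "forall_or_query k cmp lam \<psi> M \<longleftrightarrow>
     (\<forall>\<sigma>. is_scheduler M \<sigma> \<longrightarrow> (\<exists>i\<in>{1..k}. cmp (Pr M \<sigma> (\<psi> i)) (lam i)))"


section \<open>Subsystems\<close>

definition subsystem :: "('s, 'a) mdp \<Rightarrow> 's set \<Rightarrow> ('s, 'a) mdp" where
  "subsystem M T =
     M\<lparr>states := T, tran := (\<lambda>s a. map_option (\<lambda>p. restrict_spmf p T) (tran M s a))\<rparr>"

definition witnessing :: "('s, 'a) mdp \<Rightarrow> (('s, 'a) mdp \<Rightarrow> bool) \<Rightarrow> 's set \<Rightarrow> bool" where
  "witnessing M \<Phi> T \<longleftrightarrow> init M \<in> T \<and> T \<subseteq> states M \<and> \<Phi> (subsystem M T)"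

definition labels :: "('s \<Rightarrow> 'l set) \<Rightarrow> 's set \<Rightarrow> 'l set" where
  "labels \<Lambda> T = (\<Union>s\<in>T. \<Lambda> s)"

definition minimal_witnessing ::
  "('s, 'a) mdp \<Rightarrow> (('s, 'a) mdp \<Rightarrow> bool) \<Rightarrow> ('s \<Rightarrow> 'l set) \<Rightarrow> 's set \<Rightarrow> bool" where
  "minimal_witnessing M \<Phi> \<Lambda> T \<longleftrightarrow>
     witnessing M \<Phi> T \<and>
     (\<forall>T'. witnessing M \<Phi> T' \<longrightarrow> card (labels \<Lambda> T) \<le> card (labels \<Lambda> T'))"


section \<open>End components\<close>

definition ec_states :: "('s \<times> 'a) set \<Rightarrow> 's set" where
  "ec_states E = fst ` E"

definition ec_edges :: "('s, 'a) mdp \<Rightarrow> ('s \<times> 'a) set \<Rightarrow> ('s \<times> 's) set" where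
  "ec_edges M E = {(s, t). \<exists>a. (s, a) \<in> E \<and> t \<in> set_spmf (Pdist M s a)}"

definition is_ec :: "('s, 'a) mdp \<Rightarrow> ('s \<times> 'a) set \<Rightarrow> bool" where
  "is_ec M E \<longleftrightarrow>
     E \<noteq> {} \<and> E \<subseteq> En M \<and>
     (\<forall>(s, a)\<in>E. set_spmf (Pdist M s a) \<subseteq> ec_states E) \<and>
     (\<forall>s\<in>ec_states E. \<forall>t\<in>ec_states E. (s, t) \<in> (ec_edges M E)\<^sup>*)"

definition is_mec :: "('s, 'a) mdp \<Rightarrow> ('s \<times> 'a) set \<Rightarrow> bool" where
  "is_mec M E \<longleftrightarrow> is_ec M E \<and> (\<forall>E'. is_ec M E' \<and> E \<subseteq> E' \<longrightarrow> E' = E)"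

definition D_MEC :: "('s, 'a) mdp \<Rightarrow> 's set set" where
  "D_MEC M =
     {ec_states E | E. is_mec M E} \<union>
     {{s} | s. s \<in> states M \<and> (\<forall>E. is_mec M E \<longrightarrow> s \<notin> ec_states E)}"

definition sat_rabin :: "('s \<times> 'a) set \<Rightarrow> 's rabin \<Rightarrow> bool" where
  "sat_rabin E P \<longleftrightarrow> (\<exists>(F, B)\<in>P. ec_states E \<inter> F \<noteq> {} \<and> ec_states E \<subseteq> B)"

definition I_star :: "('s, 'a) mdp \<Rightarrow> nat \<Rightarrow> (nat \<Rightarrow> 's rabin) \<Rightarrow> ('s set \<times> nat set) set" where
  "I_star M k P =
     {(ec_states E, I) | E I. is_mec M E \<and> I \<subseteq> {1..k} \<and>
        (\<exists>E'. is_ec M E' \<and> E' \<subseteq> E \<and> (\<forall>i\<in>I. sat_rabin E' (P i)))}"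


section \<open>Quotients\<close>

datatype 's qstate = Cls "'s set" | Bot "nat set"

datatype 'a qact = Orig 'a | Tau "nat set"

definition class_of :: "'s set set \<Rightarrow> 's \<Rightarrow> 's set" where
  "class_of D s = (THE C. C \<in> D \<and> s \<in> C)"

text \<open>
  An action has at most one source state, so a class and an action determine the enabled pair.
  The absorbing states \<open>Bot I\<close> loop with the action \<open>Tau I\<close>.
\<close>

definition quotient_trans ::
  "('s, 'a) mdp \<Rightarrow> 's set set \<Rightarrow> ('s set \<times> nat set) set \<Rightarrow> 's qstate \<Rightarrow> 'a qact \<Rightarrow> 's qstate spmf option" where
  "quotient_trans M D Is q b =
     (case (q, b) of
        (Cls C, Orig a) \<Rightarrow>
          (if \<exists>s\<in>C. (s, a) \<in> En M \<and> measure (measure_spmf (Pdist M s a)) C < 1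
           then Some (map_spmf (\<lambda>t. Cls (class_of D t))
                  (Pdist M (THE s. s \<in> C \<and> (s, a) \<in> En M) a))
           else None)
      | (Cls C, Tau I) \<Rightarrow> (if (C, I) \<in> Is then Some (return_spmf (Bot I)) else None)
      | (Bot I, Orig a) \<Rightarrow> None
      | (Bot I, Tau J) \<Rightarrow> (if J = I then Some (return_spmf (Bot I)) else None))"

definition quotient ::
  "('s, 'a) mdp \<Rightarrow> nat \<Rightarrow> 's set set \<Rightarrow> ('s set \<times> nat set) set \<Rightarrow> ('s qstate, 'a qact) mdp" where
  "quotient M k D Is =
     \<lparr>states = Cls ` D \<union> Bot ` Pow {1..k},
      acts = Orig ` acts M \<union> Tau ` Pow {1..k},
      init = Cls (class_of D (init M)),
      tran = quotient_trans M D Is\<rparr>"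

definition mec_quotient ::
  "('s, 'a) mdp \<Rightarrow> nat \<Rightarrow> (nat \<Rightarrow> 's rabin) \<Rightarrow> ('s qstate, 'a qact) mdp" where
  "mec_quotient M k P = quotient M k (D_MEC M) (I_star M k P)"

definition G_bar :: "nat \<Rightarrow> nat \<Rightarrow> 's qstate set" where
  "G_bar k i = {Bot I | I. I \<subseteq> {1..k} \<and> i \<notin> I}"

primrec lift_labeling :: "('s \<Rightarrow> 'l set) \<Rightarrow> 's qstate \<Rightarrow> 'l set" where
  "lift_labeling \<Lambda> (Cls C) = (\<Union>s\<in>C. \<Lambda> s)"
| "lift_labeling \<Lambda> (Bot I) = {}"


section \<open>Well-definedness\<close>

lemma is_sub_mdp_subsystem:
  assumes "is_sub_mdp M" "init M \<in> T" "T \<subseteq> states M"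
  shows "is_sub_mdp (subsystem M T)"
  using assms
  by (auto simp: is_sub_mdp_def subsystem_def En_def Pdist_def intro: finite_subset)

lemma set_pick:
  assumes "is_scheduler M \<sigma>" "s \<in> states M"
  shows "set_spmf (pick M \<sigma> h s) \<subseteq> states M \<times> acts M"
  using assms by (auto simp: pick_def is_scheduler_def enabled_def En_def)

lemma set_next_step:
  assumes "is_sub_mdp M" "is_scheduler M \<sigma>"
  shows "set_pmf (next_step M \<sigma> n \<omega>) \<subseteq> outcomes M"
proof -
  have bind: "set_spmf (bind_spmf (Pdist M s a) (pick M \<sigma> h)) \<subseteq> states M \<times> acts M" for s a h
  proof -
    have P: "set_spmf (Pdist M s a) \<subseteq> states M"
    proof (cases "(s, a) \<in> En M")
      case True
      then show ?thesis using assms(1) by (auto simp only: is_sub_mdp_def)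
    qed (simp add: Pdist_def)
    show ?thesis
      unfolding set_bind_spmf bind_UNION
    proof (rule UN_least)
      fix t assume "t \<in> set_spmf (Pdist M s a)"
      then show "(set_spmf \<circ> pick M \<sigma> h) t \<subseteq> states M \<times> acts M"
        using P set_pick[OF assms(2), of t h] by (simp add: subset_iff)
    qed
  qed
  have "init M \<in> states M"
    using assms(1) by (simp add: is_sub_mdp_def)
  then have "set_spmf (next_step M \<sigma> n \<omega>) \<subseteq> states M \<times> acts M"
    unfolding next_step_def
    by (auto simp del: set_bind_spmf split: nat.splits option.splits
        dest!: subsetD[OF bind] subsetD[OF set_pick[OF assms(2)], rotated])
  then show ?thesis
    by (auto simp: outcomes_def subset_iff in_set_spmf image_iff) (metis not_None_eq surj_pair)
qed

lemma Ionescu_Tulcea_kernel: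
  assumes "is_sub_mdp M" "is_scheduler M \<sigma>"
  shows "Ionescu_Tulcea (step_kernel M \<sigma>) (\<lambda>_. count_space (outcomes M))"
proof (rule Ionescu_Tulcea.intro)
  have fin: "finite (outcomes M)"
    using assms(1) by (auto simp: outcomes_def is_sub_mdp_def)
  have prob: "prob_space (step_kernel M \<sigma> n \<omega>)" for n \<omega>
  proof
    have "emeasure (measure_pmf (next_step M \<sigma> n \<omega>)) (outcomes M) = 1"
      using set_next_step[OF assms] measure_pmf.emeasure_eq_1_AE AE_measure_pmf_iff
      by (metis (no_types, lifting) UNIV_I sets_measure_pmf subsetD)
    then show "emeasure (step_kernel M \<sigma> n \<omega>) (space (step_kernel M \<sigma> n \<omega>)) = 1"
      by (simp add: step_kernel_def space_restrict_space emeasure_restrict_space)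
  qed
  then show "prob_space (step_kernel M \<sigma> i x)"
    if "x \<in> space (PiM {0..<i} (\<lambda>_. count_space (outcomes M)))" for i x
    by simp
  have sets: "sets (step_kernel M \<sigma> n \<omega>) = sets (count_space (outcomes M))" for n \<omega>
    by (auto simp: step_kernel_def sets_restrict_space)
  have "PiM {0..<i} (\<lambda>_. count_space (outcomes M)) = count_space ({0..<i} \<rightarrow>\<^sub>E outcomes M)" for i :: nat
    using fin by (intro count_space_PiM_finite) (auto intro: countable_finite)
  then show "step_kernel M \<sigma> i \<in> PiM {0..<i} (\<lambda>_. count_space (outcomes M)) \<rightarrow>\<^sub>M
      subprob_algebra (count_space (outcomes M))" for i
    using prob sets
    by (auto simp: space_subprob_algebra intro: prob_space_imp_subprob_space)
qed

lemma emeasure_path_measure_prefix: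
  assumes "is_sub_mdp M" "is_scheduler M \<sigma>" "\<And>j. x j \<in> outcomes M"
  shows "emeasure (path_measure M \<sigma>) {\<omega> \<in> space (path_measure M \<sigma>). \<forall>j<n. \<omega> j = x j} =
         (\<Prod>j<n. ennreal (pmf (next_step M \<sigma> j x) (x j)))"
proof -
  let ?N = "\<lambda>_::nat. count_space (outcomes M)"
  have fin: "finite (outcomes M)"
    using assms(1) by (auto simp: outcomes_def is_sub_mdp_def)
  interpret IT: Ionescu_Tulcea "step_kernel M \<sigma>" ?N
    by (rule Ionescu_Tulcea_kernel[OF assms(1,2)])
  let ?r = "\<lambda>n. restrict x {0..<n}"
  have PiM: "PiM {0..<i} ?N = count_space ({0..<i} \<rightarrow>\<^sub>E outcomes M)" for i :: nat
    using fin by (intro count_space_PiM_finite) (auto intro: countable_finite)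
  have r: "?r i \<in> space (PiM {0..<i} ?N)" for i
    using assms(3) by (auto simp: space_PiM)
  have sing: "{?r i} \<in> sets (PiM {0..<i} ?N)" for i
    using r[of i] unfolding PiM by auto
  have next_restrict: "next_step M \<sigma> i (?r i) = next_step M \<sigma> i x" for i
  proof -
    have hist: "map (\<lambda>j. the (?r i j)) [0..<i] = map (\<lambda>j. the (x j)) [0..<i]"
      by (rule map_cong) auto
    show ?thesis
      unfolding next_step_def hist by (simp split: nat.split)
  qed
  have C: "emeasure (IT.C 0 n (\<lambda>x. undefined)) {?r n} =
      (\<Prod>j<n. ennreal (pmf (next_step M \<sigma> j x) (x j)))" for n
  proof (induction n)
    case 0
    show ?case by (simp add: PiM_empty)
  next
    case (Suc n)
    let ?\<mu> = "IT.C 0 n (\<lambda>x. undefined)"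
    have sp: "space ?\<mu> = space (PiM {0..<n} ?N)" and st: "sets ?\<mu> = sets (PiM {0..<n} ?N)"
      using IT.space_C[of "\<lambda>_. undefined" 0 n] IT.sets_C[of "\<lambda>_. undefined" 0 n] by auto
    have step: "emeasure (IT.eP n y) {?r (Suc n)} =
        ennreal (pmf (next_step M \<sigma> n x) (x n)) * indicator {?r n} y"
      if y: "y \<in> space (PiM {0..<n} ?N)" for y
    proof -
      have pre: "(\<lambda>z. y(n := z)) -` {?r (Suc n)} \<inter> outcomes M = (if y = ?r n then {x n} else {})"
        (is "?A = ?B")
      proof -
        have "y(n := z) = ?r (Suc n) \<longleftrightarrow> y = ?r n \<and> z = x n" for z
        proof
          assume eq: "y(n := z) = ?r (Suc n)"
          have "z = x n" using fun_cong[OF eq, of n] by simp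
          moreover have "y j = ?r n j" for j
            using fun_cong[OF eq, of j] y by (cases "j = n") (auto simp: space_PiM PiE_def extensional_def restrict_def split: if_splits)
          ultimately show "y = ?r n \<and> z = x n" by blast
        qed (auto simp: restrict_def fun_eq_iff)
        then have "?A = {z \<in> outcomes M. y = ?r n \<and> z = x n}"
          by (simp only: vimage_def) blast
        then show ?thesis using assms(3) by auto
      qed
      have "emeasure (IT.eP n y) {?r (Suc n)} = emeasure (step_kernel M \<sigma> n y) ?B"
        unfolding IT.emeasure_eP[OF y sing] by (simp add: pre)
      also have "\<dots> = ennreal (pmf (next_step M \<sigma> n x) (x n)) * indicator {?r n} y"
        using assms(3) next_restrict[of n]
        by (auto simp: step_kernel_def emeasure_restrict_space emeasure_pmf_single)
      finally show ?thesis .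
    qed
    have "emeasure (IT.C 0 (Suc n) (\<lambda>x. undefined)) {?r (Suc n)} =
        (\<integral>\<^sup>+y. emeasure (IT.eP n y) {?r (Suc n)} \<partial>?\<mu>)"
      using IT.measurable_eP[of n] r[of n] sing[of "Suc n"] st sp
      by (auto intro!: emeasure_bind[where N = "PiM {0..<Suc n} ?N"] simp: measurable_cong_sets[OF st refl])
    also have "\<dots> = (\<integral>\<^sup>+y. ennreal (pmf (next_step M \<sigma> n x) (x n)) * indicator {?r n} y \<partial>?\<mu>)"
      by (intro nn_integral_cong) (simp add: sp step)
    also have "\<dots> = ennreal (pmf (next_step M \<sigma> n x) (x n)) * emeasure ?\<mu> {?r n}"
      using sing st by (intro nn_integral_cmult_indicator) simp
    finally show ?case
      by (simp only: Suc prod.lessThan_Suc mult.commute)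
  qed
  have sp: "space (path_measure M \<sigma>) = space (PiM UNIV ?N)"
    unfolding path_measure_def by (simp add: IT.PF.space_lim)
  have emb: "{\<omega> \<in> space (path_measure M \<sigma>). \<forall>j<n. \<omega> j = x j} = IT.PF.emb UNIV {0..<n} {?r n}"
    unfolding sp by (auto simp: prod_emb_def space_PiM restrict_def fun_eq_iff) metis
  have "emeasure (path_measure M \<sigma>) {\<omega> \<in> space (path_measure M \<sigma>). \<forall>j<n. \<omega> j = x j} =
      emeasure (IT.CI {0..<n}) {?r n}"
    unfolding emb unfolding path_measure_def by (rule IT.lim) (use sing in auto)
  also have "\<dots> = emeasure (IT.C 0 n (\<lambda>x. undefined)) {?r n}"
    using sing[of n] sets.sets_into_space[OF sing[of n]]
    by (subst IT.emeasure_CI[of _ n]) (simp_all add: prod_emb_id space_PiM)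
  finally show ?thesis by (simp add: C)
qed

lemma is_ec_union:
  assumes "is_ec M A" "is_ec M B" "s \<in> ec_states A" "s \<in> ec_states B"
  shows "is_ec M (A \<union> B)"
proof -
  have sub: "(ec_edges M A)\<^sup>* \<subseteq> (ec_edges M (A\<union>B))\<^sup>*" "(ec_edges M B)\<^sup>* \<subseteq> (ec_edges M (A\<union>B))\<^sup>*"
    by (auto intro!: rtrancl_mono simp: ec_edges_def)
  have un: "ec_states (A\<union>B) = ec_states A \<union> ec_states B" by (auto simp: ec_states_def)
  have "(x,s) \<in> (ec_edges M (A\<union>B))\<^sup>* \<and> (s,x) \<in> (ec_edges M (A\<union>B))\<^sup>*" if "x \<in> ec_states (A\<union>B)" for x
    using that assms sub unfolding un is_ec_def by blast
  then have "\<forall>x\<in>ec_states (A\<union>B). \<forall>t\<in>ec_states (A\<union>B). (x, t) \<in> (ec_edges M (A\<union>B))\<^sup>*"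
    by (meson rtrancl_trans)
  then show ?thesis using assms unfolding is_ec_def un by (auto; blast)
qed

lemma is_mec_unique:
  assumes "is_mec M A" "is_mec M B" "s \<in> ec_states A" "s \<in> ec_states B"
  shows "A = B"
  by (metis assms is_mec_def is_ec_union sup_ge1 sup_ge2)

lemma D_MEC_ex1:
  assumes "s \<in> states M" shows "\<exists>!C. C \<in> D_MEC M \<and> s \<in> C"
proof (cases "\<exists>E. is_mec M E \<and> s \<in> ec_states E")
  case True
  then show ?thesis unfolding D_MEC_def by (auto dest: is_mec_unique)
next
  case False
  then show ?thesis using assms unfolding D_MEC_def by auto
qed

lemma class_of_D_MEC: "s \<in> states M \<Longrightarrow> class_of (D_MEC M) s \<in> D_MEC M \<and> s \<in> class_of (D_MEC M) s"
  unfolding class_of_def by (rule theI') (rule D_MEC_ex1)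

lemma D_MEC_subset: "D \<in> D_MEC M \<Longrightarrow> D \<subseteq> states M"
  by (auto simp: D_MEC_def is_mec_def is_ec_def En_def ec_states_def)

lemma is_sub_mdp_mec_quotient:
  assumes "is_mdp M" shows "is_sub_mdp (mec_quotient M k P)"
proof -
  let ?Q = "mec_quotient M k P"
  have fin: "finite (states M)" "finite (acts M)" "init M \<in> states M"
    using assms by (auto simp: is_mdp_def is_sub_mdp_def)
  have "finite (D_MEC M)" using D_MEC_subset fin(1) by (meson PowI finite_Pow_iff finite_subset subsetI)
  moreover have "set_spmf (Pdist ?Q q b) \<subseteq> states ?Q" if "(q,b) \<in> En ?Q" for q b
  proof (cases q)
    case (Cls C)
    show ?thesis
    proof (cases b)
      case (Orig a)
      from that Cls Orig obtain s where s: "s \<in> C" "(s,a) \<in> En M"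
        by (auto simp: En_def mec_quotient_def quotient_def quotient_trans_def split: if_splits)
      have th: "(THE s. s \<in> C \<and> (s, a) \<in> En M) = s"
        using s assms unfolding is_mdp_def by (intro the_equality) (auto simp: enabled_def En_def, blast)
      have "set_spmf (Pdist M s a) \<subseteq> states M" using assms s by (auto simp only: is_mdp_def is_sub_mdp_def)
      moreover have "Pdist ?Q q b = map_spmf (\<lambda>t. Cls (class_of (D_MEC M) t)) (Pdist M s a)"
        using that unfolding Pdist_def[of ?Q] En_def[of ?Q] Cls Orig
        by (auto simp: th mec_quotient_def quotient_def quotient_trans_def split: if_splits)
      ultimately show ?thesis using class_of_D_MEC[of _ M]
        by (auto simp: mec_quotient_def quotient_def)
    next
      case (Tau I)
      then show ?thesis using that Cls
        by (auto simp: Pdist_def En_def mec_quotient_def quotient_def quotient_trans_def split: if_splits)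
    qed
  next
    case (Bot I)
    then show ?thesis using that
      by (cases b) (auto simp: Pdist_def En_def mec_quotient_def quotient_def quotient_trans_def split: if_splits)
  qed
  ultimately show ?thesis using fin class_of_D_MEC[of "init M" M]
    unfolding is_sub_mdp_def by (auto simp: mec_quotient_def quotient_def)
qed


section \<open>Trivially satisfied queries\<close>

lemma trivial_query:
  assumes "\<exists>i\<in>{1..k}. cmp 0 (lam i)" "cmp = (\<ge>) \<or> cmp = ((>)::real\<Rightarrow>real\<Rightarrow>bool)"
  shows "forall_or_query k cmp lam \<psi> M"
proof -
  obtain i where i: "i \<in> {1..k}" "cmp 0 (lam i)" using assms by blast
  have "cmp (Pr M \<sigma> (\<psi> i)) (lam i)" for \<sigma>
    using i assms(2) measure_nonneg[of "path_measure M \<sigma>"] unfolding Pr_def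
    by (auto intro: order_trans less_le_trans)
  then show ?thesis using i unfolding forall_or_query_def by blast
qed

text \<open>
  If some bound is satisfied by the probability \<open>0\<close>, every subsystem is witnessing, and the minimal
  subsystems of the MDP need not contain the whole class of the initial state, which those of the
  quotient do contain. Hence lifting a minimal witness back fails when that class carries
  more labels than the initial state.
\<close>

lemma not_minimal_if_trivial_query:
  assumes "is_mdp M" "cmp = (\<ge>) \<or> cmp = (>)" "finite L" "\<forall>s\<in>states M. \<Lambda> s \<subseteq> L"
    and triv: "\<exists>i\<in>{1..k}. cmp 0 (lam i)"
    and bad: "labels \<Lambda> (class_of (D_MEC M) (init M)) \<noteq> \<Lambda> (init M)"
    and T: "witnessing (mec_quotient M k P) Q T"
    and X: "X = {D \<in> D_MEC M. Cls D \<in> T}"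
  shows "\<not> minimal_witnessing M (forall_or_query k cmp lam \<psi>) \<Lambda> (\<Union>X)"
proof
  have i: "init M \<in> states M" using assms by (simp add: is_mdp_def is_sub_mdp_def)
  let ?C = "class_of (D_MEC M) (init M)"
  assume a: "minimal_witnessing M (forall_or_query k cmp lam \<psi>) \<Lambda> (\<Union>X)"
  have "witnessing M (forall_or_query k cmp lam \<psi>) {init M}"
    using i trivial_query[OF triv assms(2)] by (simp add: witnessing_def)
  then have le: "card (labels \<Lambda> (\<Union>X)) \<le> card (\<Lambda> (init M))"
    using a by (auto simp: minimal_witnessing_def labels_def)
  have "?C \<in> X" using T class_of_D_MEC[OF i] by (auto simp: X witnessing_def mec_quotient_def quotient_def)
  then have sub: "labels \<Lambda> ?C \<subseteq> labels \<Lambda> (\<Union>X)" by (auto simp: labels_def)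
  have fin: "finite (labels \<Lambda> (\<Union>X))"
    by (rule finite_subset[OF _ assms(3)]) (use X D_MEC_subset assms(4) in \<open>force simp: labels_def\<close>)
  have "\<Lambda> (init M) \<subset> labels \<Lambda> ?C" using bad class_of_D_MEC[OF i] by (auto simp: labels_def)
  then have "\<Lambda> (init M) \<subset> labels \<Lambda> (\<Union>X)" using sub by blast
  then show False using le fin by (meson leD psubset_card_mono)
qed

end

theory Submission
  imports Defs
begin

text \<open>
  Both MDPs are compared through \<^emph>\<open>flows\<close>: the expected number of times each exit of a class
  is taken, together with the probability of staying in a class forever while satisfying exactly
  the properties in \<open>I\<close>. Every nonempty set of classes contains a class all of whose exits leave
  the set, which yields a bounded function that decreases in expectation along exits; hence the
  expectations are finite, and they satisfy a balance equation at each class. Conversely, the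
  memoryless randomized scheduler of the quotient that chooses proportionally to a flow, and the
  scheduler of the MDP that picks a goal by the same proportions on entering a class and walks to
  it inside the class, visit no class more often than the flow does, and so violate each property
  at most as often. In a class that a subsystem contains only partially, the walk is lost almost
  surely, so such classes can be dropped from a witness unless the query is trivial.
\<close>

section \<open>Events of finite horizon\<close>

text \<open>The query promises some \<open>i\<close> for every scheduler. A scheduler on one side
  must therefore be matched by a single scheduler on the other side whose \<open>k\<close>
  probabilities are all at most as large; monotonicity of \<open>cmp\<close> does the rest. This is
  why a flow records the whole set \<open>I\<close> of properties satisfied together, and why every
  comparison is an inequality in one direction: lost mass satisfies nothing, not even a complement,
  so a constructed scheduler may lose mass freely. For the same reason a class that is cut, that is,
  only partly contained in a subsystem, helps the adversary: the run can be made to vanish there. If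
  this happens already in the class of the initial state, all complements get probability 0, and the
  query must be trivial. The obstacle on the side of the MDP is memory. The realizing scheduler
  draws a goal at random and remembers it, whereas a scheduler is given only the pairs taken so far.
  It is therefore run on a product with the goals, and the conditional law of the next action given
  the visible history replaces it by a scheduler of the subsystem under which runs have the same
  law.\<close>

definition determined :: "nat \<Rightarrow> ((nat \<Rightarrow> 'x) \<Rightarrow> bool) \<Rightarrow> bool" where
  "determined n B \<longleftrightarrow> (\<forall>\<omega> \<omega>'. (\<forall>j<n. \<omega> j = \<omega>' j) \<longrightarrow> B \<omega> = B \<omega>')"

text \<open>Padding with \<open>None\<close> keeps the sequence inside the outcome set at every
  index, as the prefix formula demands; an extensional function on \<open>{0..<n}\<close> need not
  do so.\<close>

definition trunc :: "nat \<Rightarrow> (nat \<Rightarrow> 'x option) \<Rightarrow> nat \<Rightarrow> 'x option" where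
  "trunc n x j = (if j < n then x j else None)"

lemma determinedD: "determined n B \<Longrightarrow> (\<And>j. j < n \<Longrightarrow> \<omega> j = \<omega>' j) \<Longrightarrow> B \<omega> = B \<omega>'"
  unfolding determined_def by blast

context
  fixes \<Omega> :: "'x option set" and \<nu> :: "(nat \<Rightarrow> 'x option) measure"
  assumes fin: "finite \<Omega>" and None: "None \<in> \<Omega>"
    and sets: "sets \<nu> = sets (PiM UNIV (\<lambda>_::nat. count_space \<Omega>))"
    and finm: "finite_measure \<nu>"
begin

lemma space_seq: "space \<nu> = {\<omega>. \<forall>n. \<omega> n \<in> \<Omega>}"
  using sets_eq_imp_space_eq[OF sets] by (auto simp: space_PiM)

lemma measurable_coordinate: "(\<lambda>\<omega>. \<omega> n) \<in> \<nu> \<rightarrow>\<^sub>M count_space \<Omega>"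
  using sets by (simp add: measurable_cong_sets[OF sets refl])

lemma pred_coordinate: "Measurable.pred \<nu> (\<lambda>\<omega>. Q (\<omega> n))"
  using measurable_compose[OF measurable_coordinate[of n], of Q "count_space UNIV"] by simp

text \<open>As \<open>\<Omega>\<close> is finite, there are finitely many prefixes of length
  \<open>n\<close>, and the event is the disjoint union of the cylinders over the prefixes that it
  accepts.\<close>

lemma prefix_measure:
  assumes B: "determined n B"
  shows "{\<omega> \<in> space \<nu>. B \<omega>} \<in> sets \<nu>"
    and "measure \<nu> {\<omega> \<in> space \<nu>. B \<omega>} =
      (\<Sum>x | x \<in> {0..<n} \<rightarrow>\<^sub>E \<Omega> \<and> B (trunc n x). measure \<nu> {\<omega> \<in> space \<nu>. \<forall>j<n. \<omega> j = x j})"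
proof -
  let ?X = "{x \<in> {0..<n} \<rightarrow>\<^sub>E \<Omega>. B (trunc n x)}"
  let ?c = "\<lambda>x. {\<omega> \<in> space \<nu>. \<forall>j<n. \<omega> j = x j}"
  have finX: "finite ?X"
    using finite_PiE[of "{0..<n}" "\<lambda>_. \<Omega>"] fin by simp
  have c: "?c x \<in> sets \<nu>" for x
    using pred_coordinate[of "\<lambda>u. u = x _"] by measurable
  have "restrict \<omega> {0..<n} \<in> ?X \<and> \<omega> \<in> ?c (restrict \<omega> {0..<n})" if "\<omega> \<in> space \<nu>" "B \<omega>" for \<omega>
    using that determinedD[OF B, of \<omega> "trunc n (restrict \<omega> {0..<n})"]
    by (simp add: space_seq trunc_def PiE_iff)
  moreover have "B \<omega>" if "x \<in> ?X" "\<omega> \<in> ?c x" for \<omega> x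
    using that determinedD[OF B, of \<omega> "trunc n x"] by (simp add: trunc_def)
  ultimately have eq: "{\<omega> \<in> space \<nu>. B \<omega>} = (\<Union>x\<in>?X. ?c x)"
    by blast
  show "{\<omega> \<in> space \<nu>. B \<omega>} \<in> sets \<nu>"
    unfolding eq by (rule sets.finite_UN[OF finX c])
  have disj: "disjoint_family_on ?c ?X"
    unfolding disjoint_family_on_def
  proof (intro ballI impI)
    fix x y assume "x \<in> ?X" "y \<in> ?X" "x \<noteq> y"
    then have "\<exists>j<n. x j \<noteq> y j"
      by (metis (mono_tags, lifting) PiE_ext atLeastLessThan_iff le0 mem_Collect_eq)
    then show "?c x \<inter> ?c y = {}" by auto
  qed
  interpret finite_measure \<nu> by (rule finm)
  show "measure \<nu> {\<omega> \<in> space \<nu>. B \<omega>} = sum (\<lambda>x. measure \<nu> (?c x)) ?X"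
    unfolding eq using c by (intro finite_measure_finite_Union finX disj) blast
qed

end

text \<open>A finite-dimensional rectangle has a bounded horizon and is thus a finite sum of
  cylinders. This criterion later identifies a projected run with the path measure of a constructed
  scheduler.\<close>

lemma seq_measure_eqI:
  fixes \<mu> \<nu> :: "(nat \<Rightarrow> 'x option) measure"
  assumes fin: "finite \<Omega>" and None: "None \<in> \<Omega>"
    and \<mu>: "sets \<mu> = sets (PiM UNIV (\<lambda>_::nat. count_space \<Omega>))" "finite_measure \<mu>"
    and \<nu>: "sets \<nu> = sets (PiM UNIV (\<lambda>_::nat. count_space \<Omega>))" "finite_measure \<nu>"
    and eq: "\<And>n x. (\<And>j. x j \<in> \<Omega>) \<Longrightarrow>
      measure \<mu> {\<omega> \<in> space \<mu>. \<forall>j<n. \<omega> j = x j} = measure \<nu> {\<omega> \<in> space \<nu>. \<forall>j<n. \<omega> j = x j}"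
  shows "\<mu> = \<nu>"
proof (rule measure_eqI_PiM_infinite[OF \<mu>(1) \<nu>(1)])
  fix A and J :: "nat set"
  assume J: "finite J" and A: "\<And>i. i \<in> J \<Longrightarrow> A i \<in> sets (count_space \<Omega>)"
  obtain n where n: "J \<subseteq> {0..<n}"
    using J finite_nat_iff_bounded by (metis atLeast0LessThan)
  let ?B = "\<lambda>\<omega>. \<forall>j\<in>J. \<omega> j \<in> A j"
  have B: "determined n ?B"
    using n by (auto simp: determined_def subset_iff)
  have emb: "prod_emb UNIV (\<lambda>_. count_space \<Omega>) J (Pi\<^sub>E J A) = {\<omega> \<in> space \<kappa>. ?B \<omega>}"
    if "sets \<kappa> = sets (PiM UNIV (\<lambda>_::nat. count_space \<Omega>))" "finite_measure \<kappa>" for \<kappa>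
    unfolding space_seq[OF fin None that] by (auto simp: prod_emb_def space_PiM PiE_iff)
  have "measure \<mu> {\<omega> \<in> space \<mu>. ?B \<omega>} = measure \<nu> {\<omega> \<in> space \<nu>. ?B \<omega>}"
    unfolding prefix_measure(2)[OF fin None \<mu> B] prefix_measure(2)[OF fin None \<nu> B]
  proof (rule sum.cong[OF refl])
    fix x assume x: "x \<in> {x \<in> {0..<n} \<rightarrow>\<^sub>E \<Omega>. ?B (trunc n x)}"
    have "trunc n x j \<in> \<Omega>" for j
      using x None by (auto simp: trunc_def PiE_iff)
    from eq[of "trunc n x" n, OF this]
    show "measure \<mu> {\<omega> \<in> space \<mu>. \<forall>j<n. \<omega> j = x j} = measure \<nu> {\<omega> \<in> space \<nu>. \<forall>j<n. \<omega> j = x j}"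
      by (simp add: trunc_def)
  qed
  then show "emeasure \<mu> (prod_emb UNIV (\<lambda>_. count_space \<Omega>) J (Pi\<^sub>E J A)) =
      emeasure \<nu> (prod_emb UNIV (\<lambda>_. count_space \<Omega>) J (Pi\<^sub>E J A))"
    using \<mu>(2) \<nu>(2) by (simp only: emb[OF \<mu>] emb[OF \<nu>] flip: emb[OF \<mu>])
      (simp add: finite_measure.emeasure_eq_measure emb[OF \<mu>] flip: emb[OF \<nu>])
qed (fact \<mu>(2))


section \<open>The path measure\<close>

locale mdp_run =
  fixes M :: "('s, 'a) mdp" and \<sigma> :: "('s, 'a) scheduler"
  assumes sub_mdp: "is_sub_mdp M" and scheduler: "is_scheduler M \<sigma>"
begin

abbreviation "\<mu> \<equiv> path_measure M \<sigma>"
abbreviation "\<Omega> \<equiv> outcomes M"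
abbreviation "prb B \<equiv> measure \<mu> {\<omega> \<in> space \<mu>. B \<omega>}"

lemma finite_outcomes: "finite \<Omega>" and None_outcomes: "None \<in> \<Omega>"
  using sub_mdp by (auto simp: outcomes_def is_sub_mdp_def)

lemma finite_En: "finite (En M)" and finite_states: "finite (states M)"
  and finite_acts: "finite (acts M)"
  using sub_mdp by (auto simp: En_def is_sub_mdp_def intro: finite_subset[of _ "states M \<times> acts M"])

lemma init_states: "init M \<in> states M"
  using sub_mdp by (simp add: is_sub_mdp_def)

lemma sets_path: "sets \<mu> = sets (PiM UNIV (\<lambda>_::nat. count_space \<Omega>))"
proof -
  interpret IT: Ionescu_Tulcea "step_kernel M \<sigma>" "\<lambda>_. count_space \<Omega>"
    by (rule Ionescu_Tulcea_kernel[OF sub_mdp scheduler])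
  show ?thesis unfolding path_measure_def by (rule IT.PF.sets_lim)
qed

lemma prob_space_path: "prob_space \<mu>"
proof
  show "emeasure \<mu> (space \<mu>) = 1"
    using emeasure_path_measure_prefix[OF sub_mdp scheduler, of "\<lambda>_. None" 0] None_outcomes by simp
qed

sublocale path: prob_space \<mu> by (rule prob_space_path)

lemmas finite_path = path.finite_measure_axioms
lemmas space_path = space_seq[OF finite_outcomes None_outcomes sets_path finite_path]
lemmas determined_sets = prefix_measure(1)[OF finite_outcomes None_outcomes sets_path finite_path]
lemmas determined_measure = prefix_measure(2)[OF finite_outcomes None_outcomes sets_path finite_path]

lemma pred_prob [measurable]: "(\<lambda>\<omega>. \<omega> n) \<in> \<mu> \<rightarrow>\<^sub>M count_space UNIV"
  using measurable_coordinate[OF finite_outcomes None_outcomes sets_path finite_path, of n]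
  by (rule measurable_compose) simp

lemma cylinder_Suc:
  assumes "\<And>j. x j \<in> \<Omega>"
  shows "prb (\<lambda>\<omega>. \<forall>j<Suc n. \<omega> j = x j) =
    prb (\<lambda>\<omega>. \<forall>j<n. \<omega> j = x j) * pmf (next_step M \<sigma> n x) (x n)"
proof -
  have *: "prb (\<lambda>\<omega>. \<forall>j<n. \<omega> j = x j) = (\<Prod>j<n. pmf (next_step M \<sigma> j x) (x j))" for n
    using emeasure_path_measure_prefix[OF sub_mdp scheduler, of x n] assms
    by (simp add: path.emeasure_eq_measure prod_ennreal prod_nonneg)
  show ?thesis by (simp only: *) simp
qed

lemma next_step_cong: "(\<And>j. j < n \<Longrightarrow> x j = y j) \<Longrightarrow> next_step M \<sigma> n x = next_step M \<sigma> n y"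
  by (cases n) (auto simp: next_step_def split: option.splits intro!: arg_cong[where f="\<lambda>h. bind_spmf _ (pick M \<sigma> h)"] )

text \<open>\<open>next_step\<close> is the conditional law of outcome \<open>n\<close> and reads
  nothing but the prefix before it, so conditioning on an event of the past is a finite sum over the
  accepted prefixes.\<close>

lemma prob_step:
  assumes B: "determined n B"
  shows "prb (\<lambda>\<omega>. B \<omega> \<and> \<omega> n \<in> A) =
    (\<Sum>x | x \<in> {0..<n} \<rightarrow>\<^sub>E \<Omega> \<and> B (trunc n x).
       prb (\<lambda>\<omega>. \<forall>j<n. \<omega> j = x j) * measure_pmf.prob (next_step M \<sigma> n (trunc n x)) A)"
proof -
  have one: "prb (\<lambda>\<omega>. (\<forall>j<n. \<omega> j = x j) \<and> \<omega> n \<in> A) =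
      prb (\<lambda>\<omega>. \<forall>j<n. \<omega> j = x j) * measure_pmf.prob (next_step M \<sigma> n (trunc n x)) A"
    if x: "x \<in> {0..<n} \<rightarrow>\<^sub>E \<Omega>" for x
  proof -
    let ?N = "next_step M \<sigma> n (trunc n x)"
    have cyl: "prb (\<lambda>\<omega>. (\<forall>j<n. \<omega> j = x j) \<and> \<omega> n = u) = prb (\<lambda>\<omega>. \<forall>j<n. \<omega> j = x j) * pmf ?N u"
      if u: "u \<in> \<Omega>" for u
    proof -
      let ?x = "(trunc n x)(n := u)"
      have "?x j \<in> \<Omega>" for j
        using x u None_outcomes by (auto simp: trunc_def PiE_iff)
      then have "prb (\<lambda>\<omega>. \<forall>j<Suc n. \<omega> j = ?x j) =
          prb (\<lambda>\<omega>. \<forall>j<n. \<omega> j = ?x j) * pmf (next_step M \<sigma> n ?x) (?x n)"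
        by (rule cylinder_Suc)
      moreover have "next_step M \<sigma> n ?x = ?N"
        by (rule next_step_cong) simp
      moreover have "(\<forall>j<Suc n. \<omega> j = ?x j) \<longleftrightarrow> (\<forall>j<n. \<omega> j = x j) \<and> \<omega> n = u" for \<omega>
        by (auto simp: less_Suc_eq trunc_def)
      moreover have "(\<forall>j<n. \<omega> j = ?x j) \<longleftrightarrow> (\<forall>j<n. \<omega> j = x j)" for \<omega>
        by (auto simp: trunc_def)
      ultimately show ?thesis
        by simp
    qed
    have "prb (\<lambda>\<omega>. (\<forall>j<n. \<omega> j = x j) \<and> \<omega> n \<in> A) =
        (\<Sum>u\<in>A \<inter> \<Omega>. prb (\<lambda>\<omega>. (\<forall>j<n. \<omega> j = x j) \<and> \<omega> n = u))"
    proof -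
      have "{\<omega> \<in> space \<mu>. (\<forall>j<n. \<omega> j = x j) \<and> \<omega> n \<in> A} =
          (\<Union>u\<in>A \<inter> \<Omega>. {\<omega> \<in> space \<mu>. (\<forall>j<n. \<omega> j = x j) \<and> \<omega> n = u})"
        by (auto simp: space_path)
      then show ?thesis
        using finite_outcomes
        by (simp only:) (intro path.finite_measure_finite_Union; auto simp: disjoint_family_on_def)
    qed
    also have "\<dots> = prb (\<lambda>\<omega>. \<forall>j<n. \<omega> j = x j) * (\<Sum>u\<in>A \<inter> \<Omega>. pmf ?N u)"
      by (simp add: cyl sum_distrib_left)
    also have "(\<Sum>u\<in>A \<inter> \<Omega>. pmf ?N u) = measure_pmf.prob ?N (A \<inter> \<Omega>)"
      using finite_outcomes by (subst measure_measure_pmf_finite) auto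
    also have "\<dots> = measure_pmf.prob ?N A"
      using set_next_step[OF sub_mdp scheduler, of n "trunc n x"]
      by (intro measure_pmf.finite_measure_eq_AE) (auto simp: AE_measure_pmf_iff)
    finally show ?thesis .
  qed
  have det: "determined (Suc n) (\<lambda>\<omega>. B \<omega> \<and> \<omega> n \<in> A)"
    unfolding determined_def using determinedD[OF B] by (metis lessI less_SucI)
  let ?X = "{x \<in> {0..<n} \<rightarrow>\<^sub>E \<Omega>. B (trunc n x)}"
  let ?c = "\<lambda>x. {\<omega> \<in> space \<mu>. (\<forall>j<n. \<omega> j = x j) \<and> \<omega> n \<in> A}"
  have finX: "finite ?X"
    using finite_PiE[of "{0..<n}" "\<lambda>_. \<Omega>"] finite_outcomes by simp
  have "restrict \<omega> {0..<n} \<in> ?X \<and> (\<omega> n \<in> A \<longrightarrow> \<omega> \<in> ?c (restrict \<omega> {0..<n}))" if "\<omega> \<in> space \<mu>" "B \<omega>" for \<omega>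
    using that determinedD[OF B, of \<omega> "trunc n (restrict \<omega> {0..<n})"]
    by (simp add: space_path trunc_def PiE_iff)
  moreover have "B \<omega>" if "x \<in> ?X" "\<omega> \<in> ?c x" for \<omega> x
    using that determinedD[OF B, of \<omega> "trunc n x"] by (simp add: trunc_def)
  ultimately have eq: "{\<omega> \<in> space \<mu>. B \<omega> \<and> \<omega> n \<in> A} = (\<Union>x\<in>?X. ?c x)"
    by blast
  have disj: "disjoint_family_on ?c ?X"
    unfolding disjoint_family_on_def
  proof (intro ballI impI)
    fix x y assume "x \<in> ?X" "y \<in> ?X" "x \<noteq> y"
    then have "\<exists>j<n. x j \<noteq> y j"
      by (metis (mono_tags, lifting) PiE_ext atLeastLessThan_iff le0 mem_Collect_eq)
    then show "?c x \<inter> ?c y = {}" by auto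
  qed
  have "prb (\<lambda>\<omega>. B \<omega> \<and> \<omega> n \<in> A) = (\<Sum>x\<in>?X. measure \<mu> (?c x))"
    unfolding eq by (intro path.finite_measure_finite_Union finX disj image_subsetI determined_sets[of "Suc n"])
      (auto simp: determined_def)
  then show ?thesis
    using one by simp
qed

lemma prob_step_const:
  assumes B: "determined n B"
    and p: "\<And>\<omega>. (\<And>j. \<omega> j \<in> \<Omega>) \<Longrightarrow> B \<omega> \<Longrightarrow> measure_pmf.prob (next_step M \<sigma> n \<omega>) A = p"
  shows "prb (\<lambda>\<omega>. B \<omega> \<and> \<omega> n \<in> A) = prb B * p"
proof -
  have "trunc n x j \<in> \<Omega>" if "x \<in> {0..<n} \<rightarrow>\<^sub>E \<Omega>" for x j
    using that None_outcomes by (auto simp: trunc_def PiE_iff)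
  then show ?thesis
    unfolding prob_step[OF B] determined_measure[OF B] sum_distrib_right
    by (intro sum.cong) (auto simp: p)
qed

lemma prob_step_ge:
  assumes B: "determined n B"
    and p: "\<And>\<omega>. (\<And>j. \<omega> j \<in> \<Omega>) \<Longrightarrow> B \<omega> \<Longrightarrow> measure_pmf.prob (next_step M \<sigma> n \<omega>) A \<ge> p"
  shows "prb (\<lambda>\<omega>. B \<omega> \<and> \<omega> n \<in> A) \<ge> prb B * p"
proof -
  have "trunc n x j \<in> \<Omega>" if "x \<in> {0..<n} \<rightarrow>\<^sub>E \<Omega>" for x j
    using that None_outcomes by (auto simp: trunc_def PiE_iff)
  then show ?thesis
    unfolding prob_step[OF B] determined_measure[OF B] sum_distrib_right
    by (intro sum_mono mult_left_mono) (auto simp: p)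
qed

text \<open>At each time the exceptional runs fall into finitely many null events, one per prefix.
  This allows later arguments to follow a single run all of whose steps are possible instead of
  computing probabilities.\<close>

lemma AE_next_step: "AE \<omega> in \<mu>. \<forall>n. \<omega> n \<in> set_pmf (next_step M \<sigma> n \<omega>)"
  unfolding AE_all_countable
proof
  fix n
  let ?B = "\<lambda>x \<omega>. (\<forall>j<n. \<omega> j = x j) \<and> \<omega> n \<in> - set_pmf (next_step M \<sigma> n x)"
  let ?X = "trunc n ` ({0..<n} \<rightarrow>\<^sub>E \<Omega>)"
  have null: "prb (?B x) = 0" for x
  proof -
    have "prb (?B x) = prb (\<lambda>\<omega>. \<forall>j<n. \<omega> j = x j) * 0"
    proof (rule prob_step_const)
      fix \<omega> :: "nat \<Rightarrow> ('s \<times> 'a) option" assume "\<forall>j<n. \<omega> j = x j"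
      then have "next_step M \<sigma> n \<omega> = next_step M \<sigma> n x" by (intro next_step_cong) simp
      then show "measure_pmf.prob (next_step M \<sigma> n \<omega>) (- set_pmf (next_step M \<sigma> n x)) = 0"
        by (simp add: measure_pmf_zero_iff)
    qed (auto simp: determined_def)
    then show ?thesis by simp
  qed
  have finX: "finite ?X"
    using finite_PiE[of "{0..<n}" "\<lambda>_. \<Omega>"] finite_outcomes by simp
  have "AE \<omega> in \<mu>. \<not> ?B x \<omega>" for x
  proof (rule AE_I[where N="{\<omega> \<in> space \<mu>. ?B x \<omega>}"])
    show "emeasure \<mu> {\<omega> \<in> space \<mu>. ?B x \<omega>} = 0"
      using null[of x] by (simp add: path.emeasure_eq_measure)
  qed auto
  then have "AE \<omega> in \<mu>. \<forall>x\<in>?X. \<not> ?B x \<omega>"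
    unfolding AE_finite_all[OF finX] by blast
  then show "AE \<omega> in \<mu>. \<omega> n \<in> set_pmf (next_step M \<sigma> n \<omega>)"
  proof (rule AE_mp, intro AE_I2 impI)
    fix \<omega> assume \<omega>: "\<omega> \<in> space \<mu>" "\<forall>x\<in>?X. \<not> ?B x \<omega>"
    let ?x = "trunc n (restrict \<omega> {0..<n})"
    have "?x \<in> ?X" using \<omega>(1) by (intro imageI) (auto simp: space_path PiE_iff extensional_def)
    then have "\<not> ?B ?x \<omega>" using \<omega>(2) by blast
    then have "\<omega> n \<in> set_pmf (next_step M \<sigma> n ?x)"
      by (simp add: trunc_def)
    moreover have "next_step M \<sigma> n ?x = next_step M \<sigma> n \<omega>"
      by (rule next_step_cong) (simp add: trunc_def)
    ultimately show "\<omega> n \<in> set_pmf (next_step M \<sigma> n \<omega>)" by simp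
  qed
qed

end

lemma spmf_bind_filter:
  "spmf (bind_spmf p (\<lambda>s. if Q s then return_pmf None else return_spmf s)) t = of_bool (\<not> Q t) * spmf p t"
proof -
  have "spmf (bind_spmf p (\<lambda>s. if Q s then return_pmf None else return_spmf s)) t =
      (\<integral>s. indicator {t} s * of_bool (\<not> Q t) \<partial>measure_spmf p)"
    unfolding spmf_bind by (intro Bochner_Integration.integral_cong) (auto simp: indicator_def)
  then show ?thesis
    by (simp add: spmf_conv_measure_spmf)
qed

section \<open>Expected visits and the one-step recursion\<close>

context mdp_run
begin

lemma measurable_outcome [measurable]: "(\<lambda>\<omega>. f (\<omega> n)) \<in> \<mu> \<rightarrow>\<^sub>M count_space UNIV"
  by (rule measurable_compose[OF pred_prob]) simp

lemma set_Pdist: "set_spmf (Pdist M s a) \<subseteq> states M"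
proof (cases "(s, a) \<in> En M")
  case True
  then show ?thesis using sub_mdp by (auto simp only: is_sub_mdp_def)
qed (simp add: Pdist_def)

lemma spmf_pick:
  "spmf (pick M \<sigma> h s) (t, b) = of_bool (s = t \<and> enabled M t \<noteq> {}) * pmf (\<sigma> h t) b"
proof (cases "enabled M s = {}")
  case False
  have "spmf (map_spmf (Pair s) (spmf_of_pmf (\<sigma> h s))) (t, b) = of_bool (s = t) * pmf (\<sigma> h t) b"
  proof (cases "s = t")
    case True
    then show ?thesis by (simp add: pmf_map_inj' inj_on_def)
  next
    case False
    then have "(t, b) \<notin> set_spmf (map_spmf (Pair s) (spmf_of_pmf (\<sigma> h s)))" by auto
    then have "spmf (map_spmf (Pair s) (spmf_of_pmf (\<sigma> h s))) (t, b) = 0"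
      by (simp only: spmf_eq_0_set_spmf not_False_eq_True)
    then show ?thesis using False by simp
  qed
  then show ?thesis using False by (auto simp: pick_def)
qed (auto simp: pick_def)

lemma spmf_bind_pick:
  "spmf (bind_spmf p (pick M \<sigma> h)) (t, b) = of_bool (enabled M t \<noteq> {}) * spmf p t * pmf (\<sigma> h t) b"
proof -
  have "spmf (bind_spmf p (pick M \<sigma> h)) (t, b) =
      (\<integral>s. indicator {t} s * (of_bool (enabled M t \<noteq> {}) * pmf (\<sigma> h t) b) \<partial>measure_spmf p)"
    unfolding spmf_bind by (intro Bochner_Integration.integral_cong) (auto simp: spmf_pick)
  then show ?thesis by (simp add: spmf_conv_measure_spmf)
qed

lemma spmf_next_step_0:
  "spmf (next_step M \<sigma> 0 \<omega>) (t, b) = of_bool (t = init M \<and> enabled M t \<noteq> {}) * pmf (\<sigma> [] t) b"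
  by (auto simp: next_step_def spmf_pick)

lemma spmf_next_step_Suc:
  assumes "\<omega> n = Some (s, a)"
  shows "spmf (next_step M \<sigma> (Suc n) \<omega>) (t, b) =
    of_bool (enabled M t \<noteq> {}) * spmf (Pdist M s a) t *
      pmf (\<sigma> (map (\<lambda>j. the (\<omega> j)) [0..<Suc n]) t) b"
  using assms by (simp add: next_step_def spmf_bind_pick del: upt_Suc)

lemma next_step_Suc_None: "\<omega> n = None \<Longrightarrow> next_step M \<sigma> (Suc n) \<omega> = return_pmf None"
  by (simp add: next_step_def)

lemma map_fst_pick:
  "map_spmf fst (pick M \<sigma> h s) = (if enabled M s = {} then return_pmf None else return_spmf s)"
  by (simp add: pick_def pmf.map_comp o_def)

lemma prob_state_eq_spmf: "measure_pmf.prob p {u. map_option fst u = Some t} = spmf (map_spmf fst p) t"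
  by (simp add: pmf_map vimage_def)

lemma map_fst_next_step_Suc:
  assumes "\<omega> n = Some (s, a)"
  shows "map_spmf fst (next_step M \<sigma> (Suc n) \<omega>) =
    bind_spmf (Pdist M s a) (\<lambda>t. if enabled M t = {} then return_pmf None else return_spmf t)"
  using assms by (simp add: next_step_def map_spmf_bind_spmf o_def map_fst_pick del: upt_Suc)

lemma prob_next_state_Suc:
  assumes "\<omega> n = Some (s, a)"
  shows "measure_pmf.prob (next_step M \<sigma> (Suc n) \<omega>) {u. map_option fst u = Some t} =
    of_bool (enabled M t \<noteq> {}) * spmf (Pdist M s a) t"
  unfolding prob_state_eq_spmf map_fst_next_step_Suc[of \<omega> n, OF assms] spmf_bind_filter ..

definition occ :: "nat \<Rightarrow> 's \<times> 'a \<Rightarrow> real" where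
  "occ n c = prb (\<lambda>\<omega>. \<omega> n = Some c)"

text \<open>A state without enabled actions shows up as \<open>None\<close> in the run and is never
  counted as visited. This is the origin of the factors
  \<open>of_bool (enabled M t \<noteq> {})\<close> below.\<close>

definition vis :: "nat \<Rightarrow> 's \<Rightarrow> real" where
  "vis n s = prb (\<lambda>\<omega>. map_option fst (\<omega> n) = Some s)"

lemma occ_nonneg [simp]: "0 \<le> occ n c" and vis_nonneg [simp]: "0 \<le> vis n s"
  by (simp_all add: occ_def vis_def)

lemma step_Some_En:
  assumes "\<omega> n \<in> set_pmf (next_step M \<sigma> n \<omega>)" "\<omega> n = Some (s, a)"
  shows "(s, a) \<in> En M"
proof -
  have init: "init M \<in> states M" by (rule init_states)
  have pos: "spmf (next_step M \<sigma> n \<omega>) (s, a) > 0"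
    using assms by (simp add: pmf_positive)
  show ?thesis
  proof (cases n)
    case 0
    then have "s = init M" "enabled M s \<noteq> {}" "pmf (\<sigma> [] s) a > 0"
      using pos by (auto simp: spmf_next_step_0 zero_less_mult_iff split: if_splits)
    then show ?thesis using scheduler init
      by (auto simp: is_scheduler_def enabled_def pmf_positive_iff)
  next
    case (Suc m)
    then obtain s' a' where c: "\<omega> m = Some (s', a')"
      using pos next_step_Suc_None[of \<omega> m] by (cases "\<omega> m") auto
    let ?h = "map (\<lambda>j. the (\<omega> j)) [0..<Suc m]"
    have "enabled M s \<noteq> {}" "spmf (Pdist M s' a') s > 0" "pmf (\<sigma> ?h s) a > 0"
      using pos unfolding Suc spmf_next_step_Suc[of \<omega> m, OF c]
      by (auto simp: zero_less_mult_iff split: if_splits simp del: upt_Suc)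
    moreover from this have "s \<in> set_spmf (Pdist M s' a')"
      by (simp add: in_set_spmf pmf_positive_iff)
    then have "s \<in> states M"
      using set_Pdist by blast
    ultimately show ?thesis using scheduler
      by (auto simp: is_scheduler_def enabled_def pmf_positive_iff simp del: upt_Suc)
  qed
qed

lemma step_Suc_Some:
  assumes "\<omega> (Suc n) \<in> set_pmf (next_step M \<sigma> (Suc n) \<omega>)" "\<omega> (Suc n) = Some (t, b)"
  obtains s a where "\<omega> n = Some (s, a)" "t \<in> set_spmf (Pdist M s a)"
    "b \<in> set_pmf (\<sigma> (map (\<lambda>j. the (\<omega> j)) [0..<Suc n]) t)"
proof -
  have pos: "spmf (next_step M \<sigma> (Suc n) \<omega>) (t, b) > 0"
    using assms by (simp add: pmf_positive)
  then obtain s a where c: "\<omega> n = Some (s, a)"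
    using next_step_Suc_None[of \<omega> n] by (cases "\<omega> n") auto
  have "spmf (Pdist M s a) t > 0 \<and> pmf (\<sigma> (map (\<lambda>j. the (\<omega> j)) [0..<Suc n]) t) b > 0"
    using pos unfolding spmf_next_step_Suc[of \<omega> n, OF c]
    by (auto simp: zero_less_mult_iff split: if_splits simp del: upt_Suc)
  then show thesis using that[OF c] by (simp add: in_set_spmf pmf_positive_iff del: upt_Suc)
qed

lemma step_0_Some:
  assumes "\<omega> 0 \<in> set_pmf (next_step M \<sigma> 0 \<omega>)" "\<omega> 0 = Some (t, b)"
  shows "t = init M" "b \<in> set_pmf (\<sigma> [] t)"
proof -
  have pos: "spmf (next_step M \<sigma> 0 \<omega>) (t, b) > 0"
    using assms by (simp add: pmf_positive)
  then show "t = init M" "b \<in> set_pmf (\<sigma> [] t)"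
    by (auto simp: spmf_next_step_0 zero_less_mult_iff pmf_positive_iff split: if_splits)
qed

lemma step_not_None:
  assumes "\<omega> (Suc n) \<in> set_pmf (next_step M \<sigma> (Suc n) \<omega>)" "\<omega> n = Some (s, a)"
    and "lossless_spmf (Pdist M s a)" "\<And>t. t \<in> set_spmf (Pdist M s a) \<Longrightarrow> enabled M t \<noteq> {}"
  shows "\<omega> (Suc n) \<noteq> None"
proof -
  have "lossless_spmf (next_step M \<sigma> (Suc n) \<omega>)"
    using assms(2-) by (auto simp: next_step_def pick_def simp del: upt_Suc)
  then show ?thesis
    using assms(1) by (metis lossless_iff_set_pmf_None)
qed

lemma AE_step: "AE \<omega> in \<mu>. \<omega> n \<in> set_pmf (next_step M \<sigma> n \<omega>)"
  using AE_next_step by eventually_elim simp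

lemma prb_cong_AE: 
  assumes "AE \<omega> in \<mu>. B \<omega> = B' \<omega>"
    and "{\<omega> \<in> space \<mu>. B \<omega>} \<in> sets \<mu>" "{\<omega> \<in> space \<mu>. B' \<omega>} \<in> sets \<mu>"
  shows "prb B = prb B'"
  using assms by (intro path.finite_measure_eq_AE) auto

lemma occ_outside: "c \<notin> En M \<Longrightarrow> occ n c = 0"
proof -
  assume c: "c \<notin> En M"
  have "prb (\<lambda>\<omega>. \<omega> n = Some c) = prb (\<lambda>_. False)"
    by (rule prb_cong_AE) (use AE_step[of n] c in \<open>auto elim!: eventually_mono dest: step_Some_En[of _ n "fst c" "snd c"]\<close>)
  then show ?thesis by (simp add: occ_def)
qed

lemma vis_eq_sum: "vis n s = (\<Sum>a\<in>acts M. occ n (s, a))"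
proof -
  have "{\<omega> \<in> space \<mu>. map_option fst (\<omega> n) = Some s} = (\<Union>a\<in>acts M. {\<omega> \<in> space \<mu>. \<omega> n = Some (s, a)})"
    by (auto simp: space_path outcomes_def) (metis (no_types, lifting) fst_conv imageE insertE mem_Sigma_iff option.distinct(1) option.inject surj_pair)
  then show ?thesis
    unfolding vis_def occ_def
    by (simp only:) (intro path.finite_measure_finite_Union finite_acts image_subsetI; auto simp: disjoint_family_on_def)
qed

lemma sum_occ_fst: "(\<Sum>c\<in>En M. occ n c * f (fst c)) = (\<Sum>s\<in>states M. vis n s * f s)"
proof -
  have "(\<Sum>c\<in>En M. occ n c * f (fst c)) = (\<Sum>c\<in>states M \<times> acts M. occ n c * f (fst c))"
    using finite_states finite_acts
    by (intro sum.mono_neutral_left) (auto simp: occ_outside En_def)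
  also have "\<dots> = (\<Sum>s\<in>states M. \<Sum>a\<in>acts M. occ n (s, a) * f s)"
    by (simp add: sum.cartesian_product split_beta)
  finally show ?thesis by (simp add: vis_eq_sum sum_distrib_right)
qed

lemma vis_0: "vis 0 s = of_bool (s = init M \<and> enabled M s \<noteq> {})"
proof -
  have "prb (\<lambda>\<omega>. True \<and> \<omega> 0 \<in> {u. map_option fst u = Some s}) =
      prb (\<lambda>_. True) * of_bool (s = init M \<and> enabled M s \<noteq> {})"
    by (rule prob_step_const, simp add: determined_def, unfold prob_state_eq_spmf)
      (auto simp: next_step_def map_fst_pick)
  then show ?thesis by (simp add: vis_def path.prob_space)
qed

lemma prob_step_state:
  assumes "determined (Suc n) B" "\<And>\<omega>. B \<omega> \<Longrightarrow> \<omega> n = Some (s, a)"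
  shows "prb (\<lambda>\<omega>. B \<omega> \<and> map_option fst (\<omega> (Suc n)) = Some t) =
    prb B * (of_bool (enabled M t \<noteq> {}) * spmf (Pdist M s a) t)"
proof -
  have "prb (\<lambda>\<omega>. B \<omega> \<and> \<omega> (Suc n) \<in> {u. map_option fst u = Some t}) =
    prb B * (of_bool (enabled M t \<noteq> {}) * spmf (Pdist M s a) t)"
    by (rule prob_step_const[OF assms(1)], rule prob_next_state_Suc, rule assms(2))
  then show ?thesis by simp
qed

lemma prb_split_outcome:
  assumes B: "\<And>n. Measurable.pred \<mu> B"
  shows "prb B = prb (\<lambda>\<omega>. B \<omega> \<and> \<omega> n = None) + (\<Sum>c\<in>En M. prb (\<lambda>\<omega>. B \<omega> \<and> \<omega> n = Some c))"
proof -
  note [measurable] = B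
  have "prb B = (\<Sum>u\<in>\<Omega>. prb (\<lambda>\<omega>. B \<omega> \<and> \<omega> n = u))"
  proof -
    have "{\<omega> \<in> space \<mu>. B \<omega>} = (\<Union>u\<in>\<Omega>. {\<omega> \<in> space \<mu>. B \<omega> \<and> \<omega> n = u})"
      by (auto simp: space_path)
    then show ?thesis
      by (simp only:) (intro path.finite_measure_finite_Union finite_outcomes image_subsetI; auto simp: disjoint_family_on_def)
  qed
  also have "\<dots> = prb (\<lambda>\<omega>. B \<omega> \<and> \<omega> n = None) + (\<Sum>c\<in>states M \<times> acts M. prb (\<lambda>\<omega>. B \<omega> \<and> \<omega> n = Some c))"
    unfolding outcomes_def using finite_states finite_acts
    by (subst sum.insert) (auto simp: sum.reindex)
  also have "(\<Sum>c\<in>states M \<times> acts M. prb (\<lambda>\<omega>. B \<omega> \<and> \<omega> n = Some c)) = (\<Sum>c\<in>En M. prb (\<lambda>\<omega>. B \<omega> \<and> \<omega> n = Some c))"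
  proof (rule sum.mono_neutral_right)
    show "\<forall>c\<in>states M \<times> acts M - En M. prb (\<lambda>\<omega>. B \<omega> \<and> \<omega> n = Some c) = 0"
    proof
      fix c assume c: "c \<in> states M \<times> acts M - En M"
      have "prb (\<lambda>\<omega>. B \<omega> \<and> \<omega> n = Some c) \<le> occ n c"
        unfolding occ_def by (intro path.finite_measure_mono) auto
      then show "prb (\<lambda>\<omega>. B \<omega> \<and> \<omega> n = Some c) = 0"
        using c occ_outside[of c n] by (simp add: antisym)
    qed
  qed (use finite_states finite_acts in \<open>auto simp: En_def\<close>)
  finally show ?thesis .
qed

text \<open>Forward equation of the occupation measure, by conditioning on the pair at time
  \<open>n\<close>; a lost run stays lost, so the case \<open>None\<close> contributes
  nothing.\<close>

lemma vis_Suc: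
  "vis (Suc n) t = of_bool (enabled M t \<noteq> {}) * (\<Sum>c\<in>En M. occ n c * spmf (Pdist M (fst c) (snd c)) t)"
proof -
  let ?B = "\<lambda>\<omega>::nat \<Rightarrow> ('s \<times> 'a) option. map_option fst (\<omega> (Suc n)) = Some t"
  have "vis (Suc n) t = prb (\<lambda>\<omega>. ?B \<omega> \<and> \<omega> n = None) + (\<Sum>c\<in>En M. prb (\<lambda>\<omega>. ?B \<omega> \<and> \<omega> n = Some c))"
    unfolding vis_def by (rule prb_split_outcome) measurable
  also have "prb (\<lambda>\<omega>. ?B \<omega> \<and> \<omega> n = None) = 0"
  proof -
    have "prb (\<lambda>\<omega>. \<omega> n = None \<and> \<omega> (Suc n) \<in> {u. map_option fst u = Some t}) = prb (\<lambda>\<omega>. \<omega> n = None) * 0"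
      by (rule prob_step_const) (auto simp: determined_def next_step_Suc_None)
    then show ?thesis by (simp add: conj_commute)
  qed
  also have "(\<Sum>c\<in>En M. prb (\<lambda>\<omega>. ?B \<omega> \<and> \<omega> n = Some c)) =
      (\<Sum>c\<in>En M. occ n c * (of_bool (enabled M t \<noteq> {}) * spmf (Pdist M (fst c) (snd c)) t))"
  proof (rule sum.cong[OF refl])
    fix c
    have "prb (\<lambda>\<omega>. \<omega> n = Some c \<and> ?B \<omega>) =
        prb (\<lambda>\<omega>. \<omega> n = Some c) * (of_bool (enabled M t \<noteq> {}) * spmf (Pdist M (fst c) (snd c)) t)"
      by (rule prob_step_state) (auto simp: determined_def)
    then show "prb (\<lambda>\<omega>. ?B \<omega> \<and> \<omega> n = Some c) =
        occ n c * (of_bool (enabled M t \<noteq> {}) * spmf (Pdist M (fst c) (snd c)) t)"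
      by (simp add: occ_def conj_commute)
  qed
  finally show ?thesis by (simp add: sum_distrib_left mult_ac)
qed

text \<open>Only the choice at \<open>s\<close> has to ignore the history. Counts of pairs then
  factor through visits, which is what allows a randomized choice to be made proportional to a
  flow.\<close>

lemma occ_memoryless:
  assumes \<rho>: "\<And>h. \<sigma> h s = \<rho>"
  shows "occ n (s, a) = vis n s * pmf \<rho> a"
proof (cases n)
  case 0
  have "prb (\<lambda>\<omega>. True \<and> \<omega> 0 \<in> {Some (s, a)}) =
      prb (\<lambda>_. True) * (of_bool (s = init M \<and> enabled M s \<noteq> {}) * pmf \<rho> a)"
    by (rule prob_step_const) (auto simp: determined_def measure_pmf_single spmf_next_step_0 \<rho>)
  then show ?thesis by (simp add: 0 occ_def vis_0 path.prob_space)
next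
  case (Suc m)
  let ?B = "\<lambda>\<omega>::nat \<Rightarrow> ('s \<times> 'a) option. \<omega> (Suc m) = Some (s, a)"
  have "occ (Suc m) (s, a) = prb (\<lambda>\<omega>. ?B \<omega> \<and> \<omega> m = None) + (\<Sum>c\<in>En M. prb (\<lambda>\<omega>. ?B \<omega> \<and> \<omega> m = Some c))"
    unfolding occ_def by (rule prb_split_outcome) measurable
  also have "prb (\<lambda>\<omega>. ?B \<omega> \<and> \<omega> m = None) = 0"
  proof -
    have "prb (\<lambda>\<omega>. \<omega> m = None \<and> \<omega> (Suc m) \<in> {Some (s, a)}) = prb (\<lambda>\<omega>. \<omega> m = None) * 0"
      by (rule prob_step_const) (auto simp: determined_def next_step_Suc_None)
    then show ?thesis by (simp add: conj_commute)
  qed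
  also have "(\<Sum>c\<in>En M. prb (\<lambda>\<omega>. ?B \<omega> \<and> \<omega> m = Some c)) =
      (\<Sum>c\<in>En M. occ m c * (of_bool (enabled M s \<noteq> {}) * spmf (Pdist M (fst c) (snd c)) s * pmf \<rho> a))"
  proof (rule sum.cong[OF refl])
    fix c
    have "prb (\<lambda>\<omega>. \<omega> m = Some c \<and> \<omega> (Suc m) \<in> {Some (s, a)}) =
        prb (\<lambda>\<omega>. \<omega> m = Some c) * (of_bool (enabled M s \<noteq> {}) * spmf (Pdist M (fst c) (snd c)) s * pmf \<rho> a)"
      by (rule prob_step_const)
        (auto simp: determined_def measure_pmf_single spmf_next_step_Suc[of _ _ "fst c" "snd c"] \<rho> simp del: upt_Suc)
    then show "prb (\<lambda>\<omega>. ?B \<omega> \<and> \<omega> m = Some c) =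
        occ m c * (of_bool (enabled M s \<noteq> {}) * spmf (Pdist M (fst c) (snd c)) s * pmf \<rho> a)"
      by (simp add: occ_def conj_commute)
  qed
  finally show ?thesis by (simp add: Suc vis_Suc sum_distrib_left sum_distrib_right mult_ac)
qed

text \<open>Foster-Lyapunov argument: the expected number of \<open>Y\<close>-pairs so far plus the
  expected value of \<open>f\<close> at the current state never grows. Lost mass takes a nonnegative
  value of \<open>f\<close> with it, which only helps.\<close>

lemma ranking_bound:
  assumes f: "\<And>s. s \<in> states M \<Longrightarrow> 0 \<le> f s"
    and drift: "\<And>s a. (s, a) \<in> En M \<Longrightarrow>
      (\<Sum>t\<in>states M. spmf (Pdist M s a) t * f t) + of_bool ((s, a) \<in> Y) \<le> f s"
  shows "(\<Sum>n<m. \<Sum>c\<in>En M \<inter> Y. occ n c) \<le> (f (init M) :: real)"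
proof -
  have "(\<Sum>n<m. \<Sum>c\<in>En M \<inter> Y. occ n c) + (\<Sum>s\<in>states M. vis m s * f s) \<le> f (init M)"
  proof (induction m)
    case 0
    have "(\<Sum>s\<in>states M. vis 0 s * f s) = (\<Sum>s\<in>states M. if s = init M then vis 0 s * f s else 0)"
      by (intro sum.cong) (auto simp: vis_0)
    also have "\<dots> = vis 0 (init M) * f (init M)"
      using finite_states init_states by simp
    also have "\<dots> \<le> f (init M)"
      using f[OF init_states] by (simp add: vis_0)
    finally show ?case by simp
  next
    case (Suc m)
    have "(\<Sum>t\<in>states M. vis (Suc m) t * f t) \<le>
        (\<Sum>t\<in>states M. (\<Sum>c\<in>En M. occ m c * spmf (Pdist M (fst c) (snd c)) t) * f t)"
      using f by (intro sum_mono mult_right_mono) (auto simp: vis_Suc intro!: sum_nonneg)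
    also have "\<dots> = (\<Sum>c\<in>En M. occ m c * (\<Sum>t\<in>states M. spmf (Pdist M (fst c) (snd c)) t * f t))"
      unfolding sum_distrib_left sum_distrib_right
      by (subst sum.swap) (simp add: mult_ac)
    also have "\<dots> \<le> (\<Sum>c\<in>En M. occ m c * (f (fst c) - of_bool (c \<in> Y)))"
      using drift by (intro sum_mono mult_left_mono) (force simp: le_diff_eq)+
    also have "\<dots> = (\<Sum>s\<in>states M. vis m s * f s) - (\<Sum>c\<in>En M \<inter> Y. occ m c)"
    proof -
      have "occ m c * (f (fst c) - of_bool (c \<in> Y)) = occ m c * f (fst c) - (if c \<in> Y then occ m c else 0)" for c
        by (simp add: right_diff_distrib)
      then show ?thesis
        by (simp only: sum_subtractf sum_occ_fst sum.inter_restrict finite_En)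
    qed
    finally show ?case using Suc by simp
  qed
  moreover have "0 \<le> (\<Sum>s\<in>states M. vis m s * f s)"
    using f by (intro sum_nonneg) auto
  ultimately show ?thesis by simp
qed

section \<open>First moment bounds and Borel-Cantelli arguments\<close>

lemma prob_outcome_le_sum:
  assumes "finite A"
  shows "prb (\<lambda>\<omega>. \<omega> n \<in> Some ` A) \<le> (\<Sum>c\<in>A. occ n c)"
proof -
  have "{\<omega> \<in> space \<mu>. \<omega> n \<in> Some ` A} = (\<Union>c\<in>A. {\<omega> \<in> space \<mu>. \<omega> n = Some c})" by auto
  then show ?thesis unfolding occ_def
    by (simp only:) (intro path.finite_measure_subadditive_finite assms image_subsetI; measurable)
qed

lemma summable_outcome:
  assumes "finite A" and bound: "\<And>m. (\<Sum>n<m. \<Sum>c\<in>A. occ n c) \<le> r"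
  shows "summable (\<lambda>n. prb (\<lambda>\<omega>. \<omega> n \<in> Some ` A))" "(\<Sum>n. prb (\<lambda>\<omega>. \<omega> n \<in> Some ` A)) \<le> r"
proof -
  have *: "(\<Sum>n<m. prb (\<lambda>\<omega>. \<omega> n \<in> Some ` A)) \<le> r" for m
    using sum_mono[of "{..<m}", OF prob_outcome_le_sum[OF assms(1)]] bound[of m] by (meson order_trans)
  then show s: "summable (\<lambda>n. prb (\<lambda>\<omega>. \<omega> n \<in> Some ` A))"
    by (intro summableI_nonneg_bounded) auto
  show "(\<Sum>n. prb (\<lambda>\<omega>. \<omega> n \<in> Some ` A)) \<le> r"
    by (rule suminf_le_const[OF s *])
qed

lemma prob_Ex_outcome_le:
  assumes "finite A" and bound: "\<And>m. (\<Sum>n<m. \<Sum>c\<in>A. occ n c) \<le> r"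
  shows "prb (\<lambda>\<omega>. \<exists>n. \<omega> n \<in> Some ` A) \<le> r"
proof -
  have "{\<omega> \<in> space \<mu>. \<exists>n. \<omega> n \<in> Some ` A} = (\<Union>n. {\<omega> \<in> space \<mu>. \<omega> n \<in> Some ` A})" by auto
  then have "prb (\<lambda>\<omega>. \<exists>n. \<omega> n \<in> Some ` A) \<le> (\<Sum>n. prb (\<lambda>\<omega>. \<omega> n \<in> Some ` A))"
    by (simp only:) (intro path.finite_measure_subadditive_countably image_subsetI summable_outcome[OF assms];
      measurable)
  then show ?thesis using summable_outcome(2)[OF assms] by linarith
qed

lemma AE_finitely_often:
  assumes "\<And>n. Measurable.pred \<mu> (B n)" "summable (\<lambda>n. prb (B n))"
  shows "AE \<omega> in \<mu>. \<not> (\<exists>\<^sub>\<infinity>n. B n \<omega>)"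
proof -
  have "AE \<omega> in \<mu>. eventually (\<lambda>n. \<omega> \<in> space \<mu> - {\<omega> \<in> space \<mu>. B n \<omega>}) sequentially"
  proof (rule borel_cantelli_AE1)
    show "{\<omega> \<in> space \<mu>. B n \<omega>} \<in> sets \<mu>" for n
      using assms(1)[of n] by measurable
  qed (use assms(2) in \<open>auto simp: path.emeasure_eq_measure\<close>)
  then show ?thesis
    by (rule AE_mp) (intro AE_I2 impI; simp add: INFM_iff_infinite eventually_sequentially; 
      metis (no_types, lifting) infinite_nat_iff_unbounded_le mem_Collect_eq)
qed

lemma AE_finitely_often_outcome:
  assumes "finite A" "\<And>m. (\<Sum>n<m. \<Sum>c\<in>A. occ n c) \<le> r"
  shows "AE \<omega> in \<mu>. \<not> (\<exists>\<^sub>\<infinity>n. \<omega> n \<in> Some ` A)"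
  by (rule AE_finitely_often[OF _ summable_outcome(1)[OF assms]]) measurable

text \<open>
  Conditional Borel--Cantelli: the events ``\<open>c\<close> at time \<open>n\<close> and no \<open>A\<close> in between \<open>N\<close> and \<open>n\<close>'' have
  summable probabilities, since each of them loses a fraction \<open>p\<close> of the mass that avoids \<open>A\<close>.
\<close>

lemma AE_infinitely_often_step:
  assumes p: "0 < p"
    and ge: "\<And>n \<omega>. (\<And>j. \<omega> j \<in> \<Omega>) \<Longrightarrow> \<omega> n = Some c \<Longrightarrow> p \<le> measure_pmf.prob (next_step M \<sigma> (Suc n) \<omega>) A"
  shows "AE \<omega> in \<mu>. (\<exists>\<^sub>\<infinity>n. \<omega> n = Some c) \<longrightarrow> (\<exists>\<^sub>\<infinity>n. \<omega> n \<in> A)"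
proof -
  let ?B = "\<lambda>N n \<omega>. \<forall>j\<in>{N<..n}. \<omega> j \<notin> A"
  let ?E = "\<lambda>N n \<omega>. N \<le> n \<and> ?B N n \<omega> \<and> \<omega> n = Some c"
  have step: "prb (?E N n) \<le> (if N \<le> n then (prb (?B N n) - prb (?B N (Suc n))) / p else 0)" for N n
  proof (cases "N \<le> n")
    case True
    have det: "determined (Suc n) (\<lambda>\<omega>. ?B N n \<omega> \<and> \<omega> n = Some c)"
      by (auto simp: determined_def)
    have "prb (\<lambda>\<omega>. ?B N n \<omega> \<and> \<omega> n = Some c) * p \<le> prb (\<lambda>\<omega>. (?B N n \<omega> \<and> \<omega> n = Some c) \<and> \<omega> (Suc n) \<in> A)"
      by (rule prob_step_ge[OF det]) (simp add: ge)
    also have "\<dots> \<le> measure \<mu> ({\<omega> \<in> space \<mu>. ?B N n \<omega>} - {\<omega> \<in> space \<mu>. ?B N (Suc n) \<omega>})"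
      using True by (intro path.finite_measure_mono sets.Diff) (auto, measurable)
    also have "\<dots> = prb (?B N n) - prb (?B N (Suc n))"
      by (intro path.finite_measure_Diff) auto
    finally show ?thesis using True p by (simp add: le_divide_eq)
  next
    case False
    then show ?thesis by simp
  qed
  \<comment> \<open>The terms before \<open>N\<close> vanish, so the telescoping starts at
    \<open>N\<close>; \<open>max N m\<close> covers horizons that do not reach
    \<open>N\<close>.\<close>
  have tele: "(\<Sum>n<m. if N \<le> n then (prb (?B N n) - prb (?B N (Suc n))) / p else 0) \<le>
      (prb (?B N N) - prb (?B N (max N m))) / p" for N m
  proof (induction m)
    case (Suc m)
    show ?case
    proof (cases "N \<le> m")
      case True
      then have "max N m = m" "max N (Suc m) = Suc m" by auto
      then show ?thesis using Suc True by (simp add: diff_divide_distrib)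
    next
      case False
      then have "max N m = N" "max N (Suc m) = N" by auto
      then show ?thesis using Suc False by simp
    qed
  qed simp
  have "AE \<omega> in \<mu>. \<not> (\<exists>\<^sub>\<infinity>n. ?E N n \<omega>)" for N
  proof (rule AE_finitely_often)
    have "(\<Sum>n<m. prb (?E N n)) \<le> 1 / p" for m
    proof -
      have "(\<Sum>n<m. prb (?E N n)) \<le> (prb (?B N N) - prb (?B N (max N m))) / p"
        using sum_mono[of "{..<m}", OF step] tele by (rule order_trans)
      also have "\<dots> \<le> 1 / p"
        using p path.prob_le_1[of "{\<omega> \<in> space \<mu>. ?B N N \<omega>}"] measure_nonneg[of \<mu> "{\<omega> \<in> space \<mu>. ?B N (max N m) \<omega>}"]
        by (intro divide_right_mono) linarith+
      finally show ?thesis .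
    qed
    then show "summable (\<lambda>n. prb (?E N n))"
      by (intro summableI_nonneg_bounded) auto
  qed measurable
  then have "AE \<omega> in \<mu>. \<forall>N. \<not> (\<exists>\<^sub>\<infinity>n. ?E N n \<omega>)"
    by (simp only: AE_all_countable) simp
  then show ?thesis
  proof (rule AE_mp, intro AE_I2 impI)
    fix \<omega> :: "nat \<Rightarrow> ('s \<times> 'a) option"
    assume fin: "\<forall>N. \<not> (\<exists>\<^sub>\<infinity>n. ?E N n \<omega>)" and inf: "\<exists>\<^sub>\<infinity>n. \<omega> n = Some c"
    show "\<exists>\<^sub>\<infinity>n. \<omega> n \<in> A"
    proof (rule ccontr)
      assume "\<not> (\<exists>\<^sub>\<infinity>n. \<omega> n \<in> A)"
      then have "\<not> (\<forall>N. \<exists>n>N. \<omega> n \<in> A)" unfolding INFM_nat .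
      then obtain N where N: "\<omega> n \<notin> A" if "n > N" for n by blast
      have "\<exists>n\<ge>m. ?E N n \<omega>" for m
      proof -
        obtain n where "n \<ge> max N m" "\<omega> n = Some c"
          using inf unfolding INFM_nat_le by blast
        then show ?thesis using N by (intro exI[of _ n]) auto
      qed
      then have "\<exists>\<^sub>\<infinity>n. ?E N n \<omega>"
        unfolding INFM_nat_le by blast
      then show False using fin by blast
    qed
  qed
qed

end

section \<open>Projecting runs along a map of MDPs\<close>

lemma pmf_of_weights:
  assumes fin: "finite A" and nonneg: "\<And>a. a \<in> A \<Longrightarrow> 0 \<le> w a" and pos: "0 < (\<Sum>a\<in>A. w a)"
  obtains p where "set_pmf p = {a \<in> A. 0 < w a}" "\<And>a. a \<in> A \<Longrightarrow> pmf p a = w a / (\<Sum>a\<in>A. w a)"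
proof -
  let ?f = "\<lambda>a. if a \<in> A then w a / (\<Sum>a\<in>A. w a) else 0"
  have nn: "0 \<le> ?f a" for a
    using nonneg pos by simp
  have "(\<integral>\<^sup>+a. ennreal (?f a) \<partial>count_space UNIV) = (\<Sum>a\<in>A. ennreal (?f a))"
    using fin by (intro nn_integral_count_space') auto
  also have "\<dots> = ennreal (\<Sum>a\<in>A. ?f a)"
    using nn by (intro sum_ennreal) blast
  also have "(\<Sum>a\<in>A. ?f a) = 1"
    using pos by (simp add: sum_divide_distrib[symmetric])
  finally have pmf: "pmf (embed_pmf ?f) a = ?f a" for a
    using nn by (intro pmf_embed_pmf) simp_all
  show thesis
  proof
    show "set_pmf (embed_pmf ?f) = {a \<in> A. 0 < w a}"
      using pos nonneg by (auto simp: set_pmf_eq pmf less_eq_real_def)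
  qed (simp add: pmf)
qed

section \<open>Measurable properties of runs and absorption of lost runs\<close>

context mdp_run
begin

lemma pred_rabin:
  assumes "finite P"
  shows "Measurable.pred \<mu> (\<lambda>\<omega>. (\<lambda>n. f (\<omega> n)) \<in> rabin_property P)"
proof -
  have "Measurable.pred \<mu> (\<lambda>\<omega>. \<exists>c\<in>P. (\<forall>m. \<exists>n>m. f (\<omega> n) \<in> fst c) \<and> (\<exists>m. \<forall>n>m. f (\<omega> n) \<in> snd c))"
    using assms by measurable
  then show ?thesis by (simp add: rabin_property_def split_beta INFM_nat MOST_nat)
qed

lemma sets_not_rabin:
  assumes "finite P"
  shows "{\<omega> \<in> space \<mu>. (\<forall>n. \<omega> n \<noteq> None) \<and> (\<lambda>n. f (\<omega> n)) \<in> - rabin_property P} \<in> sets \<mu>"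
  using pred_rabin[OF assms, of f] by measurable

lemma sets_reach:
  "{\<omega> \<in> space \<mu>. (\<forall>n. \<omega> n \<noteq> None) \<and> (\<lambda>n. f (\<omega> n)) \<in> reach G} \<in> sets \<mu>"
  unfolding reach_def by measurable

lemma AE_En: "AE \<omega> in \<mu>. \<forall>n. \<omega> n \<in> insert None (Some ` En M)"
  using AE_next_step
proof eventually_elim
  case (elim \<omega>)
  show ?case
  proof
    fix n show "\<omega> n \<in> insert None (Some ` En M)"
      using step_Some_En[of \<omega> n] elim by (cases "\<omega> n") (metis insertI1, metis image_eqI insertI2 surj_pair)
  qed
qed

lemma AE_None_absorbing: "AE \<omega> in \<mu>. \<forall>n m. \<omega> n = None \<longrightarrow> n \<le> m \<longrightarrow> \<omega> m = None"
  using AE_next_step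
proof eventually_elim
  case (elim \<omega>)
  have "\<omega> (n + k) = None" if "\<omega> n = None" for n k
  proof (induction k)
    case (Suc k)
    then show ?case
      using elim[rule_format, of "Suc (n + k)"] next_step_Suc_None[of \<omega> "n + k"] by simp
  qed (simp add: that)
  then show ?case by (metis le_add_diff_inverse)
qed

lemma prb_finite_Union:
  assumes "finite I" "\<And>i. Measurable.pred \<mu> (B i)" "\<And>i j \<omega>. i \<in> I \<Longrightarrow> j \<in> I \<Longrightarrow> B i \<omega> \<Longrightarrow> B j \<omega> \<Longrightarrow> i = j"
  shows "prb (\<lambda>\<omega>. \<exists>i\<in>I. B i \<omega>) = (\<Sum>i\<in>I. prb (B i))"
proof -
  have "{\<omega> \<in> space \<mu>. \<exists>i\<in>I. B i \<omega>} = (\<Union>i\<in>I. {\<omega> \<in> space \<mu>. B i \<omega>})" by blast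
  moreover have "measure \<mu> (\<Union>i\<in>I. {\<omega> \<in> space \<mu>. B i \<omega>}) = (\<Sum>i\<in>I. prb (B i))"
    by (intro path.finite_measure_finite_Union assms(1) image_subsetI predE assms(2))
      (use assms(3) in \<open>unfold disjoint_family_on_def; blast\<close>)
  ultimately show ?thesis by simp
qed

text \<open>A measurable \<open>B\<close> is a null event, and any other \<open>B\<close> has
  \<open>measure\<close> 0 by convention. Almost sure facts thus apply to events without a separate
  measurability proof.\<close>

lemma prb_eq_0: "AE \<omega> in \<mu>. \<not> B \<omega> \<Longrightarrow> prb B = 0"
  by (metis (mono_tags, lifting) AE_cong measure_eq_0_null_sets path.prob_Collect_eq_0 path.prob_neg
      measure_notin_sets)

end

section \<open>Projected schedulers as conditional distributions\<close>

lemma En_subset: "En M \<subseteq> states M \<times> acts M"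
  by (auto simp: En_def)

text \<open>\<open>p\<close> and \<open>r\<close> carry each step of \<open>N'\<close> to a step of
  \<open>N\<close> with the projected successor law. By \<open>dead\<close>, a run of
  \<open>N'\<close> stops for lack of actions only where its image stops as well, so the images can
  have the law of runs of \<open>N\<close>.\<close>

locale mdp_projection = run': mdp_run N' \<sigma>'
  for N' :: "('t, 'b) mdp" and \<sigma>' +
  fixes N :: "('s, 'a) mdp" and p :: "'t \<Rightarrow> 's" and r :: "'b \<Rightarrow> 'a"
  assumes sub: "is_sub_mdp N"
    and init: "p (init N') = init N"
    and En: "\<And>s a. (s, a) \<in> En N' \<Longrightarrow> (p s, r a) \<in> En N"
    and Pdist: "\<And>s a. (s, a) \<in> En N' \<Longrightarrow> map_spmf p (Pdist N' s a) = Pdist N (p s) (r a)"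
    and dead: "\<And>s. s \<in> states N' \<Longrightarrow> enabled N' s = {} \<Longrightarrow> enabled N (p s) = {}"
begin

lemma enabled_proj: "s \<in> states N' \<Longrightarrow> enabled N' s = {} \<longleftrightarrow> enabled N (p s) = {}"
  using dead[of s] En[of s] by (auto simp: enabled_def)

text \<open>Pairs that are not enabled go to \<open>None\<close>, which makes the map total into the
  outcomes of \<open>N\<close>; almost all runs contain only enabled pairs and
  \<open>None\<close>.\<close>

definition proj :: "('t \<times> 'b) option \<Rightarrow> ('s \<times> 'a) option" where
  "proj u = (case u of Some c \<Rightarrow> if c \<in> En N' then Some (map_prod p r c) else None | None \<Rightarrow> None)"

lemma proj_None [simp]: "proj None = None"
  by (simp add: proj_def)

lemma proj_eq_Some: "proj u = Some c \<longleftrightarrow> (\<exists>s a. u = Some (s, a) \<and> (s, a) \<in> En N' \<and> c = (p s, r a))"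
  by (auto simp: proj_def split: option.splits)

lemma proj_outcomes: "proj u \<in> outcomes N"
  using En En_subset[of N] by (cases u) (fastforce simp: proj_def outcomes_def)+

definition image :: "(nat \<Rightarrow> ('s \<times> 'a) option) measure" where
  "image = distr run'.\<mu> (PiM UNIV (\<lambda>_. count_space (outcomes N))) (\<lambda>\<omega> n. proj (\<omega> n))"

lemma measurable_proj: "(\<lambda>\<omega> n. proj (\<omega> n)) \<in> run'.\<mu> \<rightarrow>\<^sub>M PiM UNIV (\<lambda>_. count_space (outcomes N))"
proof (rule measurable_PiM_single')
  show "(\<lambda>\<omega>. proj (\<omega> n)) \<in> run'.\<mu> \<rightarrow>\<^sub>M count_space (outcomes N)" for n
    by (rule measurable_count_space_extend[of _ UNIV]) (auto simp: proj_outcomes)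
qed (auto simp: proj_outcomes)

lemma space_image: "space image = {\<omega>. \<forall>n. \<omega> n \<in> outcomes N}"
  by (auto simp: image_def space_PiM)

lemma finite_N: "finite (outcomes N)" "None \<in> outcomes N"
  using sub by (auto simp: outcomes_def is_sub_mdp_def)

lemma sets_image: "sets image = sets (PiM UNIV (\<lambda>_::nat. count_space (outcomes N)))"
  by (simp add: image_def)

lemma finite_image: "finite_measure image"
  unfolding image_def by (intro prob_space_imp_sigma_finite prob_space.finite_measure run'.path.prob_space_distr measurable_proj)

lemma measure_image:
  assumes "{\<omega> \<in> space image. B \<omega>} \<in> sets image"
  shows "measure image {\<omega> \<in> space image. B \<omega>} = run'.prb (\<lambda>\<omega>. B (\<lambda>n. proj (\<omega> n)))"
proof -
  have "measure image {\<omega> \<in> space image. B \<omega>} =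
      measure run'.\<mu> ((\<lambda>\<omega> n. proj (\<omega> n)) -` {\<omega> \<in> space image. B \<omega>} \<inter> space run'.\<mu>)"
    using assms unfolding image_def by (intro measure_distr measurable_proj) auto
  also have "(\<lambda>\<omega> n. proj (\<omega> n)) -` {\<omega> \<in> space image. B \<omega>} \<inter> space run'.\<mu> =
      {\<omega> \<in> space run'.\<mu>. B (\<lambda>n. proj (\<omega> n))}"
    by (auto simp: space_image proj_outcomes)
  finally show ?thesis .
qed

definition num :: "('s \<times> 'a) list \<Rightarrow> 's \<Rightarrow> 'a \<Rightarrow> real" where
  "num h s a = run'.prb (\<lambda>\<omega>. (\<forall>j<length h. proj (\<omega> j) = Some (h ! j)) \<and> proj (\<omega> (length h)) = Some (s, a))"

definition den :: "('s \<times> 'a) list \<Rightarrow> 's \<Rightarrow> real" where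
  "den h s = (\<Sum>a\<in>acts N. num h s a)"

text \<open>The conditional distribution of the next action given the projected history.\<close>

definition proj_sched :: "('s, 'a) scheduler" where
  "proj_sched h s = (SOME q.
     if 0 < den h s
     then set_pmf q = {a \<in> acts N. 0 < num h s a} \<and> (\<forall>a\<in>acts N. pmf q a = num h s a / den h s)
     else enabled N s \<noteq> {} \<longrightarrow> set_pmf q \<subseteq> enabled N s)"

lemma num_nonneg: "0 \<le> num h s a"
  by (simp add: num_def)

lemma proj_sched:
  "if 0 < den h s
   then set_pmf (proj_sched h s) = {a \<in> acts N. 0 < num h s a} \<and>
     (\<forall>a\<in>acts N. pmf (proj_sched h s) a = num h s a / den h s)
   else enabled N s \<noteq> {} \<longrightarrow> set_pmf (proj_sched h s) \<subseteq> enabled N s"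
  unfolding proj_sched_def
proof (rule someI_ex)
  have fin: "finite (acts N)" using sub by (simp add: is_sub_mdp_def)
  show "\<exists>q. if 0 < den h s
     then set_pmf q = {a \<in> acts N. 0 < num h s a} \<and> (\<forall>a\<in>acts N. pmf q a = num h s a / den h s)
     else enabled N s \<noteq> {} \<longrightarrow> set_pmf q \<subseteq> enabled N s"
  proof (cases "0 < den h s")
    case True
    obtain q where "set_pmf q = {a \<in> acts N. 0 < num h s a}" "\<And>a. a \<in> acts N \<Longrightarrow> pmf q a = num h s a / den h s"
      by (rule pmf_of_weights[OF fin, of "num h s", folded den_def]) (use num_nonneg True in auto)
    then show ?thesis using True by (intro exI[of _ q]) simp
  next
    case False
    \<comment> \<open>A history of probability 0 prescribes nothing; any enabled action keeps the
      scheduler legal.\<close>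
    have "\<exists>q. enabled N s \<noteq> {} \<longrightarrow> set_pmf q \<subseteq> enabled N s"
      by (rule exI[of _ "return_pmf (SOME a. a \<in> enabled N s)"]) (auto intro: someI)
    then show ?thesis using False by simp
  qed
qed

lemma num_pos_enabled: "0 < num h s a \<Longrightarrow> a \<in> enabled N s"
proof -
  assume "0 < num h s a"
  then have "\<exists>\<omega>. proj (\<omega> (length h)) = Some (s, a)"
    unfolding num_def by (metis (mono_tags, lifting) Collect_empty_eq less_irrefl measure_empty)
  then show ?thesis using En by (auto simp: proj_eq_Some enabled_def)
qed

lemma is_scheduler_proj: "is_scheduler N proj_sched"
  unfolding is_scheduler_def
proof (intro allI ballI impI)
  fix h s assume "enabled N s \<noteq> {}"
  then show "set_pmf (proj_sched h s) \<subseteq> enabled N s"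
    using proj_sched[of h s] num_pos_enabled[of h s] by (auto split: if_splits)
qed

sublocale run: mdp_run N proj_sched
  by unfold_locales (fact sub, fact is_scheduler_proj)

text \<open>Summing over the action leaves only the next projected state, an event governed by the
  transition law, whereas the single terms depend on the choices of
  \<open>\<sigma>'\<close>.\<close>

lemma den_eq: "den h t = run'.prb (\<lambda>\<omega>. (\<forall>j<length h. proj (\<omega> j) = Some (h ! j)) \<and>
    (\<exists>s. map_option fst (\<omega> (length h)) = Some s \<and> p s = t))"
proof -
  let ?B = "\<lambda>\<omega>. \<forall>j<length h. proj (\<omega> j) = Some (h ! j)"
  let ?n = "length h"
  have "den h t = run'.prb (\<lambda>\<omega>. ?B \<omega> \<and> (\<exists>a\<in>acts N. proj (\<omega> ?n) = Some (t, a)))"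
  proof -
    have "run'.prb (\<lambda>\<omega>. \<exists>a\<in>acts N. ?B \<omega> \<and> proj (\<omega> ?n) = Some (t, a)) = den h t"
      unfolding den_def num_def by (intro run'.prb_finite_Union run.finite_acts) auto
    then show ?thesis by simp
  qed
  also have "\<dots> = run'.prb (\<lambda>\<omega>. ?B \<omega> \<and> (\<exists>s. map_option fst (\<omega> ?n) = Some s \<and> p s = t))"
  proof (rule run'.prb_cong_AE)
    show "AE \<omega> in run'.\<mu>. (?B \<omega> \<and> (\<exists>a\<in>acts N. proj (\<omega> ?n) = Some (t, a))) =
        (?B \<omega> \<and> (\<exists>s. map_option fst (\<omega> ?n) = Some s \<and> p s = t))"
      using run'.AE_En
    proof eventually_elim
      case (elim \<omega>)
      have "(\<exists>a\<in>acts N. proj (\<omega> ?n) = Some (t, a)) \<longleftrightarrow> (\<exists>s. map_option fst (\<omega> ?n) = Some s \<and> p s = t)"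
        using elim[rule_format, of ?n] En En_subset[of N] by (fastforce simp: proj_eq_Some)
      then show ?case by simp
    qed
  qed measurable
  finally show ?thesis .
qed

lemma prob_proj_state:
  "measure_pmf.prob q {u. \<exists>s'. map_option fst u = Some s' \<and> p s' = t} = spmf (map_spmf p (map_spmf fst q)) t"
proof -
  have eq: "{u. \<exists>s'. map_option fst u = Some s' \<and> p s' = t} = (\<lambda>u. map_option p (map_option fst u)) -` {Some t}"
    by auto
  show ?thesis unfolding eq by (simp only: map_pmf_comp pmf_map)
qed

lemma prob_next_proj_state:
  assumes "\<omega> n = Some (s, a)" "(s, a) \<in> En N'"
  shows "measure_pmf.prob (next_step N' \<sigma>' (Suc n) \<omega>) {u. \<exists>s'. map_option fst u = Some s' \<and> p s' = t} =
    of_bool (enabled N t \<noteq> {}) * spmf (Pdist N (p s) (r a)) t"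
proof -
  let ?P = "next_step N' \<sigma>' (Suc n) \<omega>"
  have "measure_pmf.prob ?P {u. \<exists>s'. map_option fst u = Some s' \<and> p s' = t} = spmf (map_spmf p (map_spmf fst ?P)) t"
    by (rule prob_proj_state)
  also have "map_spmf p (map_spmf fst ?P) =
      bind_spmf (Pdist N' s a) (\<lambda>t. if enabled N' t = {} then return_pmf None else return_spmf (p t))"
    unfolding run'.map_fst_next_step_Suc[of \<omega> n, OF assms(1)]
    by (auto simp: map_spmf_bind_spmf o_def intro!: bind_spmf_cong)
  also have "\<dots> = bind_spmf (Pdist N' s a) (\<lambda>t. if enabled N (p t) = {} then return_pmf None else return_spmf (p t))"
    using run'.set_Pdist[of s a] by (intro bind_spmf_cong refl) (metis enabled_proj subsetD)
  also have "\<dots> = bind_spmf (map_spmf p (Pdist N' s a)) (\<lambda>t. if enabled N t = {} then return_pmf None else return_spmf t)"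
    by (simp add: bind_map_spmf o_def)
  finally show ?thesis
    by (simp add: Pdist[OF assms(2)] spmf_bind_filter)
qed

lemma prob_init_proj_state:
  "measure_pmf.prob (next_step N' \<sigma>' 0 \<omega>) {u. \<exists>s'. map_option fst u = Some s' \<and> p s' = t} =
    of_bool (t = init N \<and> enabled N t \<noteq> {})"
proof -
  let ?P = "next_step N' \<sigma>' 0 \<omega>"
  have "measure_pmf.prob ?P {u. \<exists>s'. map_option fst u = Some s' \<and> p s' = t} = spmf (map_spmf p (map_spmf fst ?P)) t"
    by (rule prob_proj_state)
  also have "\<dots> = of_bool (t = init N \<and> enabled N t \<noteq> {})"
    unfolding next_step_def nat.case run'.map_fst_pick
    using enabled_proj[OF run'.init_states] by (auto simp: init)
  finally show ?thesis .
qed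

definition mass :: "nat \<Rightarrow> (nat \<Rightarrow> ('s \<times> 'a) option) \<Rightarrow> real" where
  "mass n x = run'.prb (\<lambda>\<omega>. \<forall>j<n. proj (\<omega> j) = x j)"

lemma determined_proj: "determined n (\<lambda>\<omega>. \<forall>j<n. proj (\<omega> j) = x j)"
  by (auto simp: determined_def)

text \<open>Loss is absorbing, so a prefix of positive mass that ends in a pair contains no
  \<open>None\<close>. The history list built with \<open>the\<close> is then faithful to the
  prefix.\<close>

lemma mass_pos_history:
  assumes "mass (Suc n) x \<noteq> 0" "x n \<noteq> None" "j \<le> n"
  shows "x j \<noteq> None"
proof
  assume j: "x j = None"
  have "mass (Suc n) x = 0"
    unfolding mass_def
  proof (rule run'.prb_eq_0)
    show "AE \<omega> in run'.\<mu>. \<not> (\<forall>j<Suc n. proj (\<omega> j) = x j)"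
      using run'.AE_En run'.AE_None_absorbing
    proof eventually_elim
      case (elim \<omega>)
      show ?case
      proof
        assume *: "\<forall>j<Suc n. proj (\<omega> j) = x j"
        then have none: "proj (\<omega> j) = None" and some: "proj (\<omega> n) \<noteq> None"
          using j assms by (metis le_imp_less_Suc, metis lessI)
        have "\<omega> n \<noteq> None" using some by (metis proj_None)
        moreover have "\<omega> j = None"
          using none elim(1)[rule_format, of j] unfolding proj_def by (cases "\<omega> j") (auto simp: image_iff)
        ultimately show False using elim(2)[rule_format, OF _ assms(3)] by metis
      qed
    qed
  qed
  then show False using assms(1) by simp
qed

text \<open>Given a projected history, the next projected state has a probability \<open>q\<close>
  that depends only on the last projected pair; hence \<open>den\<close> is the mass of the history
  times \<open>q\<close>. The action is chosen with probability \<open>num / den\<close>, and the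
  product is \<open>num\<close>, the mass of the extended history.\<close>

lemma mass_Suc_Some:
  assumes x: "\<And>j. x j \<in> outcomes N" and pos: "mass n x \<noteq> 0" and xn: "x n = Some (t, b)"
  shows "mass (Suc n) x = mass n x * spmf (next_step N proj_sched n x) (t, b)"
proof -
  have all: "mass (Suc n) x = run'.prb (\<lambda>\<omega>. (\<forall>j<n. proj (\<omega> j) = x j) \<and> proj (\<omega> n) = Some (t, b))"
    unfolding mass_def by (intro arg_cong[where f="measure _"]) (auto simp: less_Suc_eq xn)
  have b: "b \<in> acts N" using x[of n] xn by (auto simp: outcomes_def)
  define h where "h = map (\<lambda>j. the (x j)) [0..<n]"
  show ?thesis
  proof (cases "n = 0 \<or> x (n - 1) \<noteq> None")
    case True
    have len: "length h = n" by (simp add: h_def)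
    have x_h: "x j = Some (h ! j)" if "j < n" for j
    proof -
      have "x j \<noteq> None"
        using mass_pos_history[of "n - 1" x j] pos True that by (cases n) auto
      then show ?thesis using that by (simp add: h_def)
    qed
    have mass_Suc: "mass (Suc n) x = num h t b"
      unfolding all num_def by (intro arg_cong[where f="measure _"] Collect_cong conj_cong refl) (auto simp: x_h len)
    have den: "\<exists>q. den h t = mass n x * q \<and> spmf (next_step N proj_sched n x) (t, b) = q * pmf (proj_sched h t) b"
    proof (cases n)
      case 0
      let ?q = "of_bool (t = init N \<and> enabled N t \<noteq> {}) :: real"
      have "run'.prb (\<lambda>\<omega>. (\<forall>j<n. proj (\<omega> j) = x j) \<and> \<omega> n \<in> {u. \<exists>s'. map_option fst u = Some s' \<and> p s' = t}) =
          run'.prb (\<lambda>\<omega>. \<forall>j<n. proj (\<omega> j) = x j) * ?q"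
        by (rule run'.prob_step_const[OF determined_proj]) (simp only: 0 prob_init_proj_state)
      then have "den h t = mass n x * ?q"
        unfolding den_eq mass_def by (simp add: 0 h_def)
      moreover have "spmf (next_step N proj_sched n x) (t, b) = ?q * pmf (proj_sched h t) b"
        by (simp only: 0 run.spmf_next_step_0) (simp add: h_def 0)
      ultimately show ?thesis by blast
    next
      case (Suc m)
      obtain s a where sa: "x m = Some (s, a)" using True Suc by auto
      let ?q = "of_bool (enabled N t \<noteq> {}) * spmf (Pdist N s a) t"
      have "run'.prb (\<lambda>\<omega>. (\<forall>j<n. proj (\<omega> j) = x j) \<and> \<omega> n \<in> {u. \<exists>s'. map_option fst u = Some s' \<and> p s' = t}) =
          run'.prb (\<lambda>\<omega>. \<forall>j<n. proj (\<omega> j) = x j) * ?q"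
      proof (rule run'.prob_step_const[OF determined_proj])
        fix \<omega> assume "\<forall>j<n. proj (\<omega> j) = x j"
        then have "proj (\<omega> m) = Some (s, a)" using sa Suc by simp
        then obtain s' a' where "\<omega> m = Some (s', a')" "(s', a') \<in> En N'" "s = p s'" "a = r a'"
          by (auto simp: proj_eq_Some)
        then show "measure_pmf.prob (next_step N' \<sigma>' n \<omega>) {u. \<exists>s'. map_option fst u = Some s' \<and> p s' = t} = ?q"
          using prob_next_proj_state[of \<omega> m s' a' t] by (simp only: Suc)
      qed
      moreover have "run'.prb (\<lambda>\<omega>. (\<forall>j<n. proj (\<omega> j) = x j) \<and> \<omega> n \<in> {u. \<exists>s'. map_option fst u = Some s' \<and> p s' = t}) = den h t"
        unfolding den_eq by (intro arg_cong[where f="measure _"] Collect_cong conj_cong refl) (auto simp: x_h len)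
      ultimately have "den h t = mass n x * ?q"
        unfolding mass_def by simp
      moreover have "spmf (next_step N proj_sched n x) (t, b) = ?q * pmf (proj_sched h t) b"
        using run.spmf_next_step_Suc[of x m, OF sa] by (simp only: Suc h_def)
      ultimately show ?thesis by blast
    qed
    then obtain q where q: "den h t = mass n x * q"
      "spmf (next_step N proj_sched n x) (t, b) = q * pmf (proj_sched h t) b" by blast
    show ?thesis
    proof (cases "0 < den h t")
      case True
      then have "pmf (proj_sched h t) b = num h t b / den h t"
        using proj_sched[of h t] b by simp
      then show ?thesis
        unfolding mass_Suc q(2) mult.assoc[symmetric] q(1)[symmetric] using True by simp
    next
      case False
      have "0 \<le> den h t"
        unfolding den_def by (intro sum_nonneg num_nonneg)
      then have den0: "den h t = 0" using False by simp
      then have "num h t b = 0"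
        using b num_nonneg run.finite_acts unfolding den_def by (simp add: sum_nonneg_eq_0_iff)
      then show ?thesis
        unfolding mass_Suc q(2) mult.assoc[symmetric] q(1)[symmetric] using den0 by simp
    qed
  next
    case False
    \<comment> \<open>After a lost outcome, a pair has probability 0 on both sides.\<close>
    then obtain m where m: "n = Suc m" "x m = None" by (metis Suc_pred' gr0I)
    have "mass (Suc n) x = 0"
      using mass_pos_history[of n x m] m xn by auto
    moreover have "spmf (next_step N proj_sched n x) (t, b) = 0"
      using m run.next_step_Suc_None[of x m] by simp
    ultimately show ?thesis by simp
  qed
qed

text \<open>The outcome \<open>None\<close> has no formula of its own. Masses and products have the
  same total over all outcomes and agree on every pair, so they agree on \<open>None\<close>
  too.\<close>

lemma mass_Suc:
  assumes x: "\<And>j. x j \<in> outcomes N"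
  shows "mass (Suc n) x = mass n x * pmf (next_step N proj_sched n x) (x n)"
proof (cases "mass n x = 0")
  case True
  have "mass (Suc n) x \<le> mass n x"
    unfolding mass_def by (intro run'.path.finite_measure_mono) (auto, measurable)
  then show ?thesis using True by (simp add: mass_def antisym)
next
  case False
  let ?N = "next_step N proj_sched n x"
  let ?y = "\<lambda>u. x(n := u)"
  have y: "mass n (?y u) = mass n x" "next_step N proj_sched n (?y u) = ?N" for u
    by (auto simp: mass_def intro!: run.next_step_cong arg_cong[where f="measure _"])
  have split: "(\<Sum>u\<in>outcomes N. mass (Suc n) (?y u)) = mass n x"
  proof -
    have eq: "(\<forall>j<Suc n. proj (\<omega> j) = ?y u j) \<longleftrightarrow> (\<forall>j<n. proj (\<omega> j) = x j) \<and> proj (\<omega> n) = u" for \<omega> u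
      by (auto simp: less_Suc_eq)
    have "run'.prb (\<lambda>\<omega>. \<exists>u\<in>outcomes N. (\<forall>j<n. proj (\<omega> j) = x j) \<and> proj (\<omega> n) = u) =
        (\<Sum>u\<in>outcomes N. mass (Suc n) (?y u))"
      unfolding mass_def eq by (intro run'.prb_finite_Union finite_N) auto
    then show ?thesis
      using proj_outcomes by (simp add: mass_def)
  qed
  have Some: "mass (Suc n) (?y (Some c)) = mass n x * pmf ?N (Some c)" if "Some c \<in> outcomes N" for c
    using mass_Suc_Some[of "?y (Some c)" n "fst c" "snd c"] that x False by (simp add: y)
  have "(\<Sum>u\<in>outcomes N. mass (Suc n) (?y u) - mass n x * pmf ?N u) = 0"
  proof -
    have "(\<Sum>u\<in>outcomes N. pmf ?N u) = 1"
      using set_next_step[OF sub is_scheduler_proj, of n x] finite_N by (intro sum_pmf_eq_1)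
    then show ?thesis
      by (simp add: sum_subtractf split sum_distrib_left[symmetric])
  qed
  also have "(\<Sum>u\<in>outcomes N. mass (Suc n) (?y u) - mass n x * pmf ?N u) =
      (\<Sum>u\<in>{None}. mass (Suc n) (?y u) - mass n x * pmf ?N u)"
  proof (rule sum.mono_neutral_right)
    show "\<forall>u\<in>outcomes N - {None}. mass (Suc n) (?y u) - mass n x * pmf ?N u = 0"
      using Some by (metis DiffD1 DiffD2 diff_self insertI1 not_None_eq)
  qed (use finite_N in auto)
  finally have None: "mass (Suc n) (?y None) = mass n x * pmf ?N None" by simp
  have "mass (Suc n) (?y (x n)) = mass n x * pmf ?N (x n)"
    using None Some x[of n] by (cases "x n") auto
  then show ?thesis by simp
qed

lemma path_measure_proj: "run.\<mu> = image"
proof (rule seq_measure_eqI[OF finite_N run.sets_path run.finite_path sets_image finite_image])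
  fix n and x :: "nat \<Rightarrow> ('s \<times> 'a) option" assume x: "\<And>j. x j \<in> outcomes N"
  have "run.prb (\<lambda>\<omega>. \<forall>j<n. \<omega> j = x j) = mass n x"
  proof (induction n)
    case 0
    show ?case by (simp add: mass_def run.path.prob_space run'.path.prob_space)
  next
    case (Suc n)
    then show ?case by (simp only: run.cylinder_Suc[OF x] mass_Suc[OF x])
  qed
  also have "mass n x = measure image {\<omega> \<in> space image. \<forall>j<n. \<omega> j = x j}"
    unfolding mass_def
    by (rule measure_image[symmetric], rule prefix_measure(1)[OF finite_N sets_image finite_image, of n])
      (simp add: determined_def)
  finally show "run.prb (\<lambda>\<omega>. \<forall>j<n. \<omega> j = x j) = measure image {\<omega> \<in> space image. \<forall>j<n. \<omega> j = x j}" .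
qed

lemma Pr_proj:
  assumes "{\<omega> \<in> space run.\<mu>. (\<forall>n. \<omega> n \<noteq> None) \<and> (\<lambda>n. fst (the (\<omega> n))) \<in> \<psi>} \<in> sets run.\<mu>"
    and "{\<omega> \<in> space run'.\<mu>. (\<forall>n. \<omega> n \<noteq> None) \<and> (\<lambda>n. p (fst (the (\<omega> n)))) \<in> \<psi>} \<in> sets run'.\<mu>"
  shows "Pr N proj_sched \<psi> = Pr N' \<sigma>' {\<pi>. (\<lambda>n. p (\<pi> n)) \<in> \<psi>}"
proof -
  let ?B = "\<lambda>\<omega>. (\<forall>n. \<omega> n \<noteq> None) \<and> (\<lambda>n. fst (the (\<omega> n))) \<in> \<psi>"
  have "Pr N proj_sched \<psi> = run'.prb (\<lambda>\<omega>. ?B (\<lambda>n. proj (\<omega> n)))"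
    using measure_image[of ?B] assms(1) by (simp add: Pr_def path_measure_proj)
  also have "\<dots> = run'.prb (\<lambda>\<omega>. (\<forall>n. \<omega> n \<noteq> None) \<and> (\<lambda>n. p (fst (the (\<omega> n)))) \<in> \<psi>)"
  proof (rule run'.prb_cong_AE)
    show "AE \<omega> in run'.\<mu>. ?B (\<lambda>n. proj (\<omega> n)) =
        ((\<forall>n. \<omega> n \<noteq> None) \<and> (\<lambda>n. p (fst (the (\<omega> n)))) \<in> \<psi>)"
      using run'.AE_En
    proof eventually_elim
      case (elim \<omega>)
      have "proj (\<omega> n) = map_option (map_prod p r) (\<omega> n)" for n
        using elim[rule_format, of n] by (auto simp: proj_def)
      then have "(proj (\<omega> n) = None) = (\<omega> n = None)"
        "\<omega> n \<noteq> None \<Longrightarrow> fst (the (proj (\<omega> n))) = p (fst (the (\<omega> n)))" for n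
        by (auto simp: option.map_sel)
      then show ?case by (auto cong: conj_cong)
    qed
    have "{\<omega> \<in> space image. ?B \<omega>} \<in> sets image"
      using assms(1) by (simp add: path_measure_proj)
    from measurable_sets[OF measurable_proj, of "{\<omega> \<in> space image. ?B \<omega>}"] this
    show "{\<omega> \<in> space run'.\<mu>. ?B (\<lambda>n. proj (\<omega> n))} \<in> sets run'.\<mu>"
      by (simp add: sets_image space_image vimage_def Int_def conj_commute proj_outcomes)
  qed (rule assms(2))
  finally show ?thesis by (simp add: Pr_def)
qed

end

section \<open>Maximal end components and exits\<close>

abbreviation cls :: "('s, 'a) mdp \<Rightarrow> 's \<Rightarrow> 's set" where
  "cls M s \<equiv> class_of (D_MEC M) s"

text \<open>These are the pairs that leave their class with positive probability, hence the actions
  that survive in the quotient; see \<open>exit_cond_iff\<close>. Supports instead of probabilities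
  suit arguments about end components.\<close>

definition exits :: "('s, 'a) mdp \<Rightarrow> ('s \<times> 'a) set" where
  "exits M = {(s, a) \<in> En M. \<not> set_spmf (Pdist M s a) \<subseteq> cls M s}"

locale mdp =
  fixes M :: "('s, 'a) mdp"
  assumes is_mdp: "is_mdp M"
begin

lemma is_sub: "is_sub_mdp M"
  using is_mdp by (simp add: is_mdp_def)

lemma fin_states: "finite (states M)" and fin_acts: "finite (acts M)" and init_in: "init M \<in> states M"
  and fin_En: "finite (En M)"
  using is_sub by (auto simp: is_sub_mdp_def En_def intro: finite_subset[of _ "states M \<times> acts M"])

lemma En_states: "(s, a) \<in> En M \<Longrightarrow> s \<in> states M"
  by (simp add: En_def)

lemma lossless: "(s, a) \<in> En M \<Longrightarrow> lossless_spmf (Pdist M s a)"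
  using is_mdp by (auto simp: is_mdp_def)

lemma supp_states: "(s, a) \<in> En M \<Longrightarrow> set_spmf (Pdist M s a) \<subseteq> states M"
  using is_sub by (auto simp only: is_sub_mdp_def)

lemma supp_nonempty: "(s, a) \<in> En M \<Longrightarrow> set_spmf (Pdist M s a) \<noteq> {}"
  using lossless[of s a] set_pmf_not_empty[of "Pdist M s a"]
  by (metis all_not_in_conv in_set_spmf lossless_iff_set_pmf_None not_None_eq)

lemma action_source: "(s, a) \<in> En M \<Longrightarrow> (t, a) \<in> En M \<Longrightarrow> s = t"
  using is_mdp unfolding is_mdp_def enabled_def En_def by blast

lemma finite_D_MEC: "finite (D_MEC M)"
  using D_MEC_subset fin_states by (meson PowI finite_Pow_iff finite_subset subsetI)

lemma cls_eq: "D \<in> D_MEC M \<Longrightarrow> s \<in> D \<Longrightarrow> cls M s = D"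
  using D_MEC_ex1[of s M] class_of_D_MEC[of s M] D_MEC_subset[of D M] by blast

lemma cls_in: "s \<in> states M \<Longrightarrow> cls M s \<in> D_MEC M" and in_cls: "s \<in> states M \<Longrightarrow> s \<in> cls M s"
  by (simp_all add: class_of_D_MEC)

lemma in_cls_iff: "D \<in> D_MEC M \<Longrightarrow> s \<in> states M \<Longrightarrow> s \<in> D \<longleftrightarrow> cls M s = D"
  using cls_eq in_cls by blast

lemma D_MEC_nonempty: "D \<in> D_MEC M \<Longrightarrow> D \<noteq> {}"
  by (auto simp: D_MEC_def is_mec_def is_ec_def ec_states_def)

lemma ec_closed: "is_ec M E \<Longrightarrow> (s, a) \<in> E \<Longrightarrow> set_spmf (Pdist M s a) \<subseteq> ec_states E"
  by (auto simp: is_ec_def)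

lemma ec_En: "is_ec M E \<Longrightarrow> E \<subseteq> En M"
  by (simp add: is_ec_def)

lemma exits_En: "exits M \<subseteq> En M"
  by (auto simp: exits_def)

lemma ec_subset_mec:
  assumes "is_ec M E"
  obtains E' where "is_mec M E'" "E \<subseteq> E'"
proof -
  have fin: "finite {E. is_ec M E}"
    by (rule finite_subset[of _ "Pow (En M)"]) (use fin_En ec_En in blast)+
  obtain E' where "E' \<in> {E. is_ec M E}" "E \<subseteq> E'" "\<forall>F\<in>{E. is_ec M E}. E' \<subseteq> F \<longrightarrow> E' = F"
    using finite_has_maximal2[OF fin, of E] assms by blast
  then show thesis by (intro that[of E']) (auto simp only: is_mec_def mem_Collect_eq)
qed

lemma ec_states_D_MEC: "is_mec M E \<Longrightarrow> ec_states E \<in> D_MEC M"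
  by (auto simp: D_MEC_def)

lemma D_MEC_cases:
  assumes "D \<in> D_MEC M"
  obtains E where "is_mec M E" "D = ec_states E"
  | s where "s \<in> states M" "D = {s}" "\<And>E. is_mec M E \<Longrightarrow> s \<notin> ec_states E"
  using assms unfolding D_MEC_def by blast

lemma ec_connected: "is_ec M E \<Longrightarrow> s \<in> ec_states E \<Longrightarrow> t \<in> ec_states E \<Longrightarrow> (s, t) \<in> (ec_edges M E)\<^sup>*"
  by (simp add: is_ec_def)

lemma mec_ec: "is_mec M E \<Longrightarrow> is_ec M E"
  by (simp add: is_mec_def)

lemma mec_not_exit:
  assumes "is_ec M E" "(s, a) \<in> E"
  shows "(s, a) \<notin> exits M"
proof -
  obtain E' where E': "is_mec M E'" "E \<subseteq> E'" using ec_subset_mec[OF assms(1)] .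
  then have "(s, a) \<in> E'" "s \<in> ec_states E'" using assms(2) by (force simp: ec_states_def)+
  then have "cls M s = ec_states E'" "set_spmf (Pdist M s a) \<subseteq> ec_states E'"
    using cls_eq[OF ec_states_D_MEC[OF E'(1)]] ec_closed[OF mec_ec[OF E'(1)]] by simp_all
  then show ?thesis by (simp add: exits_def)
qed

text \<open>Adding a pair whose successors stay among the states of the component keeps it closed
  and strongly connected, so maximality has already included it. With \<open>mec_not_exit\<close>,
  the pairs of a MEC are exactly the non-exits at its states.\<close>

lemma not_exit_in_mec:
  assumes E: "is_mec M E" "s \<in> ec_states E" and sa: "(s, a) \<in> En M" "(s, a) \<notin> exits M"
  shows "(s, a) \<in> E"
proof -
  let ?F = "insert (s, a) E"
  have "cls M s = ec_states E" using E cls_eq ec_states_D_MEC by blast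
  then have supp: "set_spmf (Pdist M s a) \<subseteq> ec_states E"
    using sa by (simp add: exits_def)
  have st: "ec_states ?F = ec_states E" using E(2) by (auto simp: ec_states_def)
  have "(ec_edges M E)\<^sup>* \<subseteq> (ec_edges M ?F)\<^sup>*"
    by (intro rtrancl_mono) (auto simp: ec_edges_def)
  then have "is_ec M ?F"
    unfolding is_ec_def st
    using supp sa ec_closed[OF mec_ec[OF E(1)]] ec_En[OF mec_ec[OF E(1)]] ec_connected[OF mec_ec[OF E(1)]]
    by (auto; blast)
  then show ?thesis using E(1) unfolding is_mec_def by blast
qed

text \<open>Otherwise the pair would lead back to \<open>s\<close> only and be an end component by
  itself.\<close>

lemma exit_if_no_mec:
  assumes "(s, a) \<in> En M" "\<And>E. is_mec M E \<Longrightarrow> s \<notin> ec_states E"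
  shows "(s, a) \<in> exits M"
proof (rule ccontr)
  assume not: "(s, a) \<notin> exits M"
  have "{s} \<in> D_MEC M" using assms En_states by (auto simp: D_MEC_def)
  then have "cls M s = {s}" using cls_eq by blast
  then have "set_spmf (Pdist M s a) \<subseteq> {s}" using not assms(1) by (simp add: exits_def)
  then have "is_ec M {(s, a)}"
    using assms(1) by (auto simp: is_ec_def ec_states_def)
  then obtain E where "is_mec M E" "{(s, a)} \<subseteq> E" by (rule ec_subset_mec)
  then show False using assms(2)[of E] by (force simp: ec_states_def)
qed

lemma enabled_not_exit:
  assumes "is_mec M E" "s \<in> ec_states E"
  obtains a where "(s, a) \<in> E"
  using assms by (auto simp: ec_states_def)

text \<open>If each class of \<open>B\<close> had an exit staying in \<open>\<Union>B\<close>, these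
  exits and the MECs of \<open>B\<close> would form a closed system of pairs. A bottom strongly
  connected part of it is an end component that contains one of the exits, which is
  impossible.\<close>

lemma exits_leave:
  assumes B: "B \<subseteq> D_MEC M" "B \<noteq> {}"
  shows "\<exists>D\<in>B. \<forall>s a. (s, a) \<in> exits M \<longrightarrow> s \<in> D \<longrightarrow> \<not> set_spmf (Pdist M s a) \<subseteq> \<Union>B"
proof (rule ccontr)
  assume "\<not> ?thesis"
  then have "\<forall>D\<in>B. \<exists>c\<in>exits M. fst c \<in> D \<and> set_spmf (Pdist M (fst c) (snd c)) \<subseteq> \<Union>B"
    by (metis fst_conv snd_conv)
  then obtain e where e: "\<And>D. D \<in> B \<Longrightarrow> e D \<in> exits M" "\<And>D. D \<in> B \<Longrightarrow> fst (e D) \<in> D"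
    "\<And>D. D \<in> B \<Longrightarrow> set_spmf (Pdist M (fst (e D)) (snd (e D))) \<subseteq> \<Union>B"
    by metis
  define E0 where "E0 = e ` B \<union> \<Union>{E. is_mec M E \<and> ec_states E \<in> B}"
  let ?G = "ec_edges M E0"
  let ?R = "\<lambda>s. ?G\<^sup>* `` {s}"
  have B_states: "\<Union>B \<subseteq> states M" using B(1) D_MEC_subset by blast
  have E0_supp: "set_spmf (Pdist M s a) \<subseteq> \<Union>B" if c: "(s, a) \<in> E0" for s a
  proof (cases "(s, a) \<in> e ` B")
    case True
    then obtain D where "D \<in> B" "e D = (s, a)" by auto
    then show ?thesis using e(3)[of D] by simp
  next
    case False
    then obtain E where "is_mec M E" "ec_states E \<in> B" "(s, a) \<in> E" using c by (auto simp: E0_def)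
    then show ?thesis using ec_closed[OF mec_ec, of E s a] by blast
  qed
  have E0_En: "E0 \<subseteq> En M"
    using e(1) exits_En ec_En[OF mec_ec] unfolding E0_def by blast
  have E0_total: "\<exists>a. (s, a) \<in> E0" if s: "s \<in> \<Union>B" for s
  proof -
    obtain D where D: "D \<in> B" "s \<in> D" using s by blast
    then have "D \<in> D_MEC M" using B by blast
    then show ?thesis
    proof (cases rule: D_MEC_cases)
      case (1 E)
      then show ?thesis using D unfolding E0_def by (force simp: ec_states_def)
    next
      case (2 s')
      then have "e D = (s, snd (e D))" using e(2)[OF D(1)] D(2) by (metis prod.collapse singletonD)
      moreover have "e D \<in> E0" using D(1) unfolding E0_def by blast
      ultimately show ?thesis by metis
    qed
  qed
  have R_sub: "?R s \<subseteq> \<Union>B" if sB: "s \<in> \<Union>B" for s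
  proof
    fix t assume "t \<in> ?R s"
    then have "(s, t) \<in> ?G\<^sup>*" by simp
    then show "t \<in> \<Union>B"
    proof (induction rule: rtrancl_induct)
      case (step y z)
      then obtain a where "(y, a) \<in> E0" "z \<in> set_spmf (Pdist M y a)" by (auto simp: ec_edges_def)
      then show ?case using E0_supp by blast
    qed (rule sB)
  qed
  have fin: "finite (\<Union>B)" using B_states fin_states finite_subset by blast
  obtain D0 where "D0 \<in> B" using B by blast
  then have "\<exists>s. s \<in> \<Union>B" using B D_MEC_nonempty by blast
  \<comment> \<open>A state with the fewest reachable states lies in a bottom part: whatever it
    reaches has the same reachable set.\<close>
  then obtain s where s: "s \<in> \<Union>B" and min: "\<And>t. t \<in> \<Union>B \<Longrightarrow> card (?R s) \<le> card (?R t)"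
    using ex_has_least_nat[of "\<lambda>s. s \<in> \<Union>B" _ "\<lambda>s. card (?R s)"] by blast
  have reach_eq: "?R t = ?R s" if t: "t \<in> ?R s" for t
  proof (rule card_subset_eq)
    show "finite (?R s)" using R_sub[OF s] fin finite_subset by blast
    show sub: "?R t \<subseteq> ?R s" using t by auto
    show "card (?R t) = card (?R s)"
      using min[of t] R_sub[OF s] t card_mono[OF \<open>finite (?R s)\<close> sub] by fastforce
  qed
  define E1 where "E1 = {c \<in> E0. fst c \<in> ?R s}"
  have st: "ec_states E1 = ?R s"
    using E0_total R_sub[OF s] unfolding E1_def ec_states_def by force
  have path: "(t, u) \<in> (ec_edges M E1)\<^sup>*" if "(t, u) \<in> ?G\<^sup>*" "t \<in> ?R s" for t u
    using that
  proof (induction rule: rtrancl_induct)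
    case (step y z)
    then have "y \<in> ?R s" by (meson Image_singleton_iff rtrancl_trans)
    then have "(y, z) \<in> ec_edges M E1" using step(2) by (auto simp: ec_edges_def E1_def)
    then show ?case using step by (meson rtrancl.rtrancl_into_rtrancl)
  qed simp
  have "is_ec M E1"
    unfolding is_ec_def st
  proof (intro conjI ballI)
    show "E1 \<noteq> {}" using st by (auto simp: ec_states_def)
    show "E1 \<subseteq> En M" using E0_En by (auto simp: E1_def)
    show "case c of (t, a) \<Rightarrow> set_spmf (Pdist M t a) \<subseteq> ?R s" if "c \<in> E1" for c
    proof (clarsimp split: prod.split)
      fix t a u assume c: "c = (t, a)" "u \<in> set_spmf (Pdist M t a)"
      then have "(s, t) \<in> ?G\<^sup>*" "(t, u) \<in> ?G" using that by (auto simp: E1_def ec_edges_def)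
      then show "(s, u) \<in> ?G\<^sup>*" by simp
    qed
    show "(t, u) \<in> (ec_edges M E1)\<^sup>*" if "t \<in> ?R s" "u \<in> ?R s" for t u
      using path[of t u] reach_eq[OF that(1)] that by auto
  qed
  then obtain E2 where E2: "is_mec M E2" "E1 \<subseteq> E2" by (rule ec_subset_mec)
  obtain D where D: "D \<in> B" "s \<in> D" using s by blast
  then have D': "D \<in> D_MEC M" using B by blast
  \<comment> \<open>The exit chosen for the class of \<open>s\<close> starts at a state reachable
    from \<open>s\<close>: in a MEC by strong connectivity, in a singleton class because it starts
    at \<open>s\<close>.\<close>
  have "fst (e D) \<in> ?R s"
    using D'
  proof (cases rule: D_MEC_cases)
    case (1 E)
    then have "(s, fst (e D)) \<in> (ec_edges M E)\<^sup>*"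
      using D e(2)[OF D(1)] ec_connected mec_ec by blast
    moreover have "ec_edges M E \<subseteq> ?G"
      using 1 D(1) unfolding E0_def by (auto simp: ec_edges_def)
    ultimately show ?thesis using rtrancl_mono by blast
  next
    case (2 s')
    then show ?thesis using D(2) e(2)[OF D(1)] by auto
  qed
  then have "e D \<in> E2" using D(1) E2 unfolding E1_def E0_def by blast
  then show False
    using mec_not_exit[OF mec_ec[OF E2(1)], of "fst (e D)" "snd (e D)"] e(1)[OF D(1)] by simp
qed

text \<open>Peel off a class all of whose exits may leave the set, give it rank 0 and raise the
  other ranks by one. A move out of the smaller set then either leaves \<open>B\<close> or enters
  the peeled class, whose rank is lower.\<close>

lemma class_rank_exists:
  assumes "B \<subseteq> D_MEC M"
  shows "\<exists>r::'s set \<Rightarrow> nat. \<forall>s a. (s, a) \<in> exits M \<longrightarrow> cls M s \<in> B \<longrightarrow>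
    (\<exists>t\<in>set_spmf (Pdist M s a). cls M t \<notin> B \<or> r (cls M t) < r (cls M s))"
  using assms
proof (induction "card B" arbitrary: B)
  case 0
  then have "B = {}" using finite_D_MEC finite_subset by fastforce
  then show ?case by auto
next
  case (Suc n)
  then have "B \<noteq> {}" by auto
  obtain D where D: "D \<in> B" "\<And>s a. (s, a) \<in> exits M \<Longrightarrow> s \<in> D \<Longrightarrow> \<not> set_spmf (Pdist M s a) \<subseteq> \<Union>B"
    using exits_leave[OF Suc(3) \<open>B \<noteq> {}\<close>] by blast
  have "n = card (B - {D})" using Suc(2) D(1) by simp
  from Suc(1)[OF this] Suc(3) obtain r :: "'s set \<Rightarrow> nat" where
    r: "\<forall>s a. (s, a) \<in> exits M \<longrightarrow> cls M s \<in> B - {D} \<longrightarrow>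
      (\<exists>t\<in>set_spmf (Pdist M s a). cls M t \<notin> B - {D} \<or> r (cls M t) < r (cls M s))"
    by auto
  let ?r = "\<lambda>C. if C = D then 0 else Suc (r C)"
  show ?case
  proof (intro exI[of _ ?r] allI impI)
    fix s a assume sa: "(s, a) \<in> exits M" "cls M s \<in> B"
    then have s: "(s, a) \<in> En M" "s \<in> states M" by (auto simp: exits_def En_def)
    show "\<exists>t\<in>set_spmf (Pdist M s a). cls M t \<notin> B \<or> ?r (cls M t) < ?r (cls M s)"
    proof (cases "cls M s = D")
      case True
      then have "s \<in> D" using in_cls s by blast
      then obtain t where t: "t \<in> set_spmf (Pdist M s a)" "t \<notin> \<Union>B" using D(2) sa by blast
      then have "cls M t \<notin> B" using in_cls[of t] supp_states[OF s(1)] by blast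
      then show ?thesis using t by blast
    next
      case False
      then obtain t where "t \<in> set_spmf (Pdist M s a)" "cls M t \<notin> B - {D} \<or> r (cls M t) < r (cls M s)"
        using r[rule_format, of s a] sa False by blast
      then show ?thesis using False by (intro bexI[of _ t]) auto
    qed
  qed
qed

lemma sum_spmf_states: "(s, a) \<in> En M \<Longrightarrow> (\<Sum>t\<in>states M. spmf (Pdist M s a) t) = 1"
proof -
  assume sa: "(s, a) \<in> En M"
  have "(\<Sum>u\<in>Some ` states M. pmf (Pdist M s a) u) = 1"
  proof (rule sum_pmf_eq_1)
    show "set_pmf (Pdist M s a) \<subseteq> Some ` states M"
    proof
      fix u assume u: "u \<in> set_pmf (Pdist M s a)"
      then obtain t where "u = Some t" using lossless[OF sa] by (cases u) (auto simp: lossless_iff_set_pmf_None)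
      then show "u \<in> Some ` states M" using u supp_states[OF sa] by (auto simp: in_set_spmf)
    qed
  qed (use fin_states in auto)
  then show ?thesis by (simp add: sum.reindex)
qed

text \<open>
  Every exit reaches a class of smaller rank with probability at least \<open>p\<close>, which makes
  \<open>C\<^sup>m - C\<^bsup>m - rank\<^esup>\<close> with \<open>C = 2 / p\<close> decrease by \<open>1\<close> in expectation.
\<close>

lemma ranking_function:
  obtains f :: "'s \<Rightarrow> real" where "\<And>s. s \<in> states M \<Longrightarrow> 0 \<le> f s"
    "\<And>s t. s \<in> states M \<Longrightarrow> t \<in> cls M s \<Longrightarrow> f t = f s"
    "\<And>s a. (s, a) \<in> En M \<Longrightarrow>
      (\<Sum>t\<in>states M. spmf (Pdist M s a) t * f t) + of_bool ((s, a) \<in> exits M) \<le> f s"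
proof -
  obtain r :: "'s set \<Rightarrow> nat" where r: "\<And>s a. (s, a) \<in> exits M \<Longrightarrow>
    (\<exists>t\<in>set_spmf (Pdist M s a). r (cls M t) < r (cls M s))"
  proof -
    from class_rank_exists[of "D_MEC M"] obtain r :: "'s set \<Rightarrow> nat" where
      r: "\<forall>s a. (s, a) \<in> exits M \<longrightarrow> cls M s \<in> D_MEC M \<longrightarrow>
        (\<exists>t\<in>set_spmf (Pdist M s a). cls M t \<notin> D_MEC M \<or> r (cls M t) < r (cls M s))"
      by blast
    show thesis
    proof (rule that)
      fix s a assume sa: "(s, a) \<in> exits M"
      then have s: "(s, a) \<in> En M" "s \<in> states M" by (auto simp: exits_def En_def)
      then have "\<exists>t\<in>set_spmf (Pdist M s a). cls M t \<notin> D_MEC M \<or> r (cls M t) < r (cls M s)"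
        using r[rule_format, of s a] sa cls_in[OF s(2)] by blast
      then show "\<exists>t\<in>set_spmf (Pdist M s a). r (cls M t) < r (cls M s)"
        using cls_in supp_states[OF s(1)] by blast
    qed
  qed
  define m where "m = Max (r ` D_MEC M)"
  have r_le: "r (cls M s) \<le> m" if "s \<in> states M" for s
    using finite_D_MEC cls_in[OF that] by (simp add: m_def)
  define V where "V = (\<lambda>((s, a), t). spmf (Pdist M s a) t) `
    (SIGMA c:En M. set_spmf (Pdist M (fst c) (snd c)))"
  have finV: "finite V"
    unfolding V_def using fin_En finite_subset[OF supp_states fin_states]
    by (intro finite_imageI finite_SigmaI) auto
  \<comment> \<open>The element 1 keeps the set nonempty if no pair is enabled, and it yields
    \<open>p \<le> 1\<close>.\<close>
  define p where "p = Min (insert 1 V)"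
  have p: "0 < p" "p \<le> 1" "\<And>s a t. (s, a) \<in> En M \<Longrightarrow> t \<in> set_spmf (Pdist M s a) \<Longrightarrow> p \<le> spmf (Pdist M s a) t"
  proof -
    have "\<forall>v\<in>insert 1 V. 0 < v"
      by (auto simp: V_def in_set_spmf intro!: pmf_positive)
    then show "0 < p" using finV by (simp add: p_def)
    show "p \<le> 1" using finV by (simp add: p_def)
    show "p \<le> spmf (Pdist M s a) t" if "(s, a) \<in> En M" "t \<in> set_spmf (Pdist M s a)" for s a t
      unfolding p_def using finV that by (intro Min_le) (force simp: V_def)+
  qed
  define C where "C = 2 / p"
  have C: "1 \<le> C" "p * C = 2" using p by (auto simp: C_def le_divide_eq)
  define f where "f s = C ^ m - C ^ (m - r (cls M s))" for s
  show thesis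
  proof (rule that[of f])
    fix s assume s: "s \<in> states M"
    show "0 \<le> f s" using C(1) by (simp add: f_def power_increasing)
    fix t assume "t \<in> cls M s"
    then have "cls M t = cls M s" using cls_eq cls_in[OF s] by blast
    then show "f t = f s" by (simp add: f_def)
  next
    fix s a assume sa: "(s, a) \<in> En M"
    let ?P = "spmf (Pdist M s a)" and ?g = "\<lambda>t. C ^ (m - r (cls M t))"
    have E: "(\<Sum>t\<in>states M. ?P t * f t) = C ^ m - (\<Sum>t\<in>states M. ?P t * ?g t)"
      by (simp add: f_def right_diff_distrib sum_subtractf sum_distrib_right[symmetric] sum_spmf_states[OF sa])
    show "(\<Sum>t\<in>states M. ?P t * f t) + of_bool ((s, a) \<in> exits M) \<le> f s"
    proof (cases "(s, a) \<in> exits M")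
      case True
      obtain t where t: "t \<in> set_spmf (Pdist M s a)" "r (cls M t) < r (cls M s)" using r[OF True] by blast
      have ts: "t \<in> states M" using t supp_states[OF sa] by blast
      \<comment> \<open>As \<open>?g s\<close> is at least 1, doubling it gains at least 1. The
        factor 2 is \<open>p * C\<close>: the \<open>C\<close> is paid by the drop in rank, the
        \<open>p\<close> by the probability of that drop.\<close>
      have "?g s + 1 \<le> 2 * ?g s" using C(1) by simp
      also have "\<dots> = p * (C * ?g s)" using C(2) by simp
      also have "C * ?g s = C ^ Suc (m - r (cls M s))" by simp
      also have "\<dots> \<le> ?g t"
        using t(2) r_le[OF En_states[OF sa]] C(1) by (intro power_increasing) linarith+
      also have "p * ?g t \<le> ?P t * ?g t"
        using p(3)[OF sa t(1)] C(1) by (intro mult_right_mono) auto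
      also have "\<dots> \<le> (\<Sum>t\<in>states M. ?P t * ?g t)"
        using ts fin_states C(1) by (intro member_le_sum) auto
      finally have "?g s + 1 \<le> (\<Sum>t\<in>states M. ?P t * ?g t)" using p(1) by simp
      then show ?thesis unfolding E by (simp add: f_def True)
    next
      case False
      then have supp: "set_spmf (Pdist M s a) \<subseteq> cls M s" using sa by (simp add: exits_def)
      \<comment> \<open>\<open>f\<close> is constant on a class, so a pair that stays inside does
        not change its expectation.\<close>
      have "?P t * f t = ?P t * f s" for t
      proof (cases "t \<in> set_spmf (Pdist M s a)")
        case True
        then have "cls M t = cls M s" using supp cls_eq cls_in[OF En_states[OF sa]] by blast
        then show ?thesis by (simp add: f_def)
      next
        case False
        then show ?thesis by (simp add: in_set_spmf set_pmf_iff)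
      qed
      then have "(\<Sum>t\<in>states M. ?P t * f t) = f s"
        by (simp only: sum_distrib_right[symmetric] sum_spmf_states[OF sa] mult_1)
      then show ?thesis using False by simp
    qed
  qed
qed

end

section \<open>Flows and subsystems\<close>

lemma states_subsystem [simp]: "states (subsystem M T) = T"
  and acts_subsystem [simp]: "acts (subsystem M T) = acts M"
  and init_subsystem [simp]: "init (subsystem M T) = init M"
  by (simp_all add: subsystem_def)

lemma En_subsystem: "T \<subseteq> states M \<Longrightarrow> En (subsystem M T) = {c \<in> En M. fst c \<in> T}"
  by (auto simp: En_def subsystem_def)

lemma enabled_subsystem: "T \<subseteq> states M \<Longrightarrow> enabled (subsystem M T) s = (if s \<in> T then enabled M s else {})"
  by (auto simp: enabled_def En_subsystem)

lemma Pdist_subsystem: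
  "T \<subseteq> states M \<Longrightarrow> s \<in> T \<Longrightarrow> Pdist (subsystem M T) s a = restrict_spmf (Pdist M s a) T"
  by (auto simp: Pdist_def En_subsystem) (auto simp: subsystem_def En_def)

lemma sum_spmf_eq_measure: "finite D \<Longrightarrow> (\<Sum>s\<in>D. spmf p s) = measure (measure_spmf p) D"
  by (simp add: measure_measure_spmf_conv_measure_pmf measure_measure_pmf_finite sum.reindex)

text \<open>
  A flow records how often a scheduler takes the exits (\<open>y\<close>) and how likely it stays forever
  in the class \<open>D\<close> with \<open>I\<close> the set of satisfied properties (\<open>z D I\<close>).
\<close>

definition inflow :: "('s, 'a) mdp \<Rightarrow> ('s \<times> 'a \<Rightarrow> real) \<Rightarrow> 's set \<Rightarrow> real" where
  "inflow M y D = of_bool (init M \<in> D) +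
     (\<Sum>c\<in>En M. y c * measure (measure_spmf (Pdist M (fst c) (snd c))) D)"

definition outflow :: "('s, 'a) mdp \<Rightarrow> nat \<Rightarrow> ('s \<times> 'a \<Rightarrow> real) \<Rightarrow> ('s set \<Rightarrow> nat set \<Rightarrow> real) \<Rightarrow> 's set \<Rightarrow> real" where
  "outflow M k y z D = (\<Sum>c | c \<in> En M \<and> fst c \<in> D. y c) + (\<Sum>I\<in>Pow {1..k}. z D I)"

definition live :: "('s, 'a) mdp \<Rightarrow> 's set \<Rightarrow> bool" where
  "live M D \<longleftrightarrow> (\<exists>s\<in>D. enabled M s \<noteq> {})"

text \<open>In a class without enabled actions all that flows in is lost, with no outflow to match
  it; hence balance is demanded at live classes only.\<close>

definition is_flow :: "('s, 'a) mdp \<Rightarrow> nat \<Rightarrow> (nat \<Rightarrow> 's rabin) \<Rightarrow> 's set set \<Rightarrow>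
    ('s \<times> 'a \<Rightarrow> real) \<Rightarrow> ('s set \<Rightarrow> nat set \<Rightarrow> real) \<Rightarrow> bool" where
  "is_flow M k P X y z \<longleftrightarrow>
     (\<forall>c. 0 \<le> y c) \<and> (\<forall>D I. 0 \<le> z D I) \<and>
     (\<forall>c. y c \<noteq> 0 \<longrightarrow> c \<in> exits M \<and> fst c \<in> \<Union>X) \<and>
     (\<forall>D I. z D I \<noteq> 0 \<longrightarrow> D \<in> X \<and> (D, I) \<in> I_star M k P) \<and>
     (\<forall>D\<in>X. live M D \<longrightarrow> inflow M y D = outflow M k y z D)"

text \<open>The common value through which both systems are compared: it bounds the probability of
  violating \<open>P i\<close> in the MDP and of reaching \<open>G_bar k i\<close> in the quotient,
  each from the side that the direction of the transfer requires.\<close>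

definition loss :: "nat \<Rightarrow> 's set set \<Rightarrow> ('s set \<Rightarrow> nat set \<Rightarrow> real) \<Rightarrow> nat \<Rightarrow> real" where
  "loss k X z i = (\<Sum>D\<in>X. \<Sum>I | I \<subseteq> {1..k} \<and> i \<notin> I. z D I)"

section \<open>Limit behaviour of runs in a subsystem\<close>

lemma sat_rabin_if_in_property:
  assumes "(\<lambda>n. \<pi> n) \<in> rabin_property P" "finite S" "range \<pi> \<subseteq> S"
    and J: "ec_states J = {s. \<exists>\<^sub>\<infinity>n. \<pi> n = s}"
  shows "sat_rabin J P"
proof -
  obtain F B where FB: "(F, B) \<in> P" "\<exists>\<^sub>\<infinity>n. \<pi> n \<in> F" "\<forall>\<^sub>\<infinity>n. \<pi> n \<in> B"
    using assms(1) by (auto simp: rabin_property_def)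
  have "\<exists>\<^sub>\<infinity>n. \<exists>s\<in>S \<inter> F. \<pi> n = s"
    using FB(2) by (rule frequently_elim1) (use assms(3) in auto)
  then have "\<exists>s\<in>S \<inter> F. \<exists>\<^sub>\<infinity>n. \<pi> n = s"
    by (intro frequently_bex_finite) (use assms(2) in auto)
  then have "ec_states J \<inter> F \<noteq> {}" using J by auto
  moreover have "ec_states J \<subseteq> B"
  proof
    fix s assume "s \<in> ec_states J"
    then have "\<exists>\<^sub>\<infinity>n. \<pi> n = s" using J by simp
    then have "\<exists>\<^sub>\<infinity>n. \<pi> n = s \<and> \<pi> n \<in> B" using FB(3) by (rule frequently_rev_mp[OF _ eventually_mono]) auto
    then show "s \<in> B" using frequently_ex by fastforce
  qed
  ultimately show ?thesis using FB(1) by (auto simp: sat_rabin_def)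
qed

context mdp_run
begin

definition inf_pairs :: "(nat \<Rightarrow> ('s \<times> 'a) option) \<Rightarrow> ('s \<times> 'a) set" where
  "inf_pairs \<omega> = {c. \<exists>\<^sub>\<infinity>n. \<omega> n = Some c}"

lemma eventually_inf_pairs:
  assumes "\<forall>n. \<omega> n \<in> insert None (Some ` En M)" "\<forall>n. \<omega> n \<noteq> None"
  shows "\<forall>\<^sub>\<infinity>n. \<omega> n \<in> Some ` inf_pairs \<omega>"
proof (rule ccontr)
  assume "\<not> ?thesis"
  then have "\<exists>\<^sub>\<infinity>n. \<omega> n \<notin> Some ` inf_pairs \<omega>" by (simp add: not_eventually)
  then have "\<exists>\<^sub>\<infinity>n. \<exists>c\<in>En M. \<omega> n = Some c \<and> c \<notin> inf_pairs \<omega>"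
    by (rule frequently_elim1) (use assms in blast)
  then have "\<exists>c\<in>En M. \<exists>\<^sub>\<infinity>n. \<omega> n = Some c \<and> c \<notin> inf_pairs \<omega>"
    using finite_En by (simp add: frequently_bex_finite_distrib)
  then obtain c where c: "\<exists>\<^sub>\<infinity>n. \<omega> n = Some c \<and> c \<notin> inf_pairs \<omega>" by blast
  then have "c \<notin> inf_pairs \<omega>" by (auto dest: frequently_ex)
  moreover have "c \<in> inf_pairs \<omega>" unfolding inf_pairs_def using c by (auto elim: frequently_elim1)
  ultimately show False by blast
qed

lemma inf_state_iff:
  assumes "\<forall>n. \<omega> n \<in> insert None (Some ` En M)"
  shows "(\<exists>\<^sub>\<infinity>n. map_option fst (\<omega> n) = Some t) \<longleftrightarrow> t \<in> ec_states (inf_pairs \<omega>)"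
proof
  assume "\<exists>\<^sub>\<infinity>n. map_option fst (\<omega> n) = Some t"
  then have "\<exists>\<^sub>\<infinity>n. \<exists>c\<in>En M. \<omega> n = Some c \<and> fst c = t"
  proof (rule frequently_elim1)
    fix n assume "map_option fst (\<omega> n) = Some t"
    then show "\<exists>c\<in>En M. \<omega> n = Some c \<and> fst c = t" using assms[rule_format, of n] by auto
  qed
  then have "\<exists>c\<in>En M. \<exists>\<^sub>\<infinity>n. \<omega> n = Some c \<and> fst c = t"
    using finite_En by (simp add: frequently_bex_finite_distrib)
  then obtain c where c: "\<exists>\<^sub>\<infinity>n. \<omega> n = Some c \<and> fst c = t" by blast
  then have "fst c = t" by (auto dest: frequently_ex)
  moreover have "c \<in> inf_pairs \<omega>" unfolding inf_pairs_def using c by (auto elim: frequently_elim1)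
  ultimately show "t \<in> ec_states (inf_pairs \<omega>)" by (auto simp: ec_states_def)
next
  assume "t \<in> ec_states (inf_pairs \<omega>)"
  then obtain a where "\<exists>\<^sub>\<infinity>n. \<omega> n = Some (t, a)" by (auto simp: ec_states_def inf_pairs_def)
  then show "\<exists>\<^sub>\<infinity>n. map_option fst (\<omega> n) = Some t" by (rule frequently_elim1) simp
qed

end

locale subsystem_run = mdp M + run: mdp_run "subsystem M T" \<sigma>
  for M :: "('s, 'a) mdp" and T \<sigma> +
  assumes T: "T \<subseteq> states M"
begin

abbreviation "N \<equiv> subsystem M T"

lemma En_N: "c \<in> En N \<longleftrightarrow> c \<in> En M \<and> fst c \<in> T"
  using En_subsystem[OF T] by auto

lemma enabled_N: "enabled N s = (if s \<in> T then enabled M s else {})"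
  by (rule enabled_subsystem[OF T])

lemma spmf_N: "(s, a) \<in> En N \<Longrightarrow> spmf (Pdist N s a) t = of_bool (t \<in> T) * spmf (Pdist M s a) t"
  by (auto simp: En_N Pdist_subsystem[OF T] spmf_restrict_spmf)

lemma set_N: "(s, a) \<in> En N \<Longrightarrow> set_spmf (Pdist N s a) = set_spmf (Pdist M s a) \<inter> T"
  by (auto simp: En_N Pdist_subsystem[OF T])

lemma Pdist_N_eq: "(s, a) \<in> En N \<Longrightarrow> set_spmf (Pdist M s a) \<subseteq> T \<Longrightarrow> Pdist N s a = Pdist M s a"
  by (auto simp: En_N Pdist_subsystem[OF T] restrict_spmf_trivial')

text \<open>The ranking function of the whole MDP serves each of its subsystems: cutting transitions
  only removes nonnegative summands from the expectation.\<close>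

lemma exits_bound:
  obtains r where "\<And>m. (\<Sum>n<m. \<Sum>c\<in>En N \<inter> exits M. run.occ n c) \<le> r"
proof -
  obtain f :: "'s \<Rightarrow> real" where f: "\<And>s. s \<in> states M \<Longrightarrow> 0 \<le> f s"
    "\<And>s a. (s, a) \<in> En M \<Longrightarrow>
      (\<Sum>t\<in>states M. spmf (Pdist M s a) t * f t) + of_bool ((s, a) \<in> exits M) \<le> f s"
    by (rule ranking_function) blast
  have "(\<Sum>n<m. \<Sum>c\<in>En N \<inter> exits M. run.occ n c) \<le> f (init N)" for m
  proof (rule run.ranking_bound)
    show "0 \<le> f s" if "s \<in> states N" for s using f(1) that T by auto
    fix s a assume sa: "(s, a) \<in> En N"
    have "(\<Sum>t\<in>states N. spmf (Pdist N s a) t * f t) = (\<Sum>t\<in>T. spmf (Pdist M s a) t * f t)"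
      by (intro sum.cong) (auto simp: spmf_N[OF sa])
    also have "\<dots> \<le> (\<Sum>t\<in>states M. spmf (Pdist M s a) t * f t)"
      using T fin_states f(1) by (intro sum_mono2) auto
    finally show "(\<Sum>t\<in>states N. spmf (Pdist N s a) t * f t) + of_bool ((s, a) \<in> exits M) \<le> f s"
      using f(2)[of s a] sa by (simp add: En_N)
  qed
  then show thesis by (rule that)
qed

text \<open>What \<open>M\<close> sends to \<open>t\<close> arrives there or is lost, be it because
  \<open>t\<close> is cut off or because it has no action. The proof bounds the complement, which
  consists of moves to other states.\<close>

lemma prob_next_state_or_lost:
  assumes "\<omega> n = Some (s, a)" "(s, a) \<in> En N"
  shows "spmf (Pdist M s a) t \<le>
    measure_pmf.prob (next_step N \<sigma> (Suc n) \<omega>) {u. u = None \<or> map_option fst u = Some t}"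
proof (cases "t \<in> states M")
  case True
  let ?q = "next_step N \<sigma> (Suc n) \<omega>" and ?A = "{u. u = None \<or> map_option fst u = Some t}"
  have "measure_pmf.prob ?q (- ?A) \<le> measure_pmf.prob ?q (\<Union>t'\<in>T - {t}. {u. map_option fst u = Some t'})"
  proof (rule measure_pmf.finite_measure_mono_AE)
    show "AE u in measure_pmf ?q. u \<in> - ?A \<longrightarrow> u \<in> (\<Union>t'\<in>T - {t}. {u. map_option fst u = Some t'})"
      using set_next_step[OF run.sub_mdp run.scheduler, of "Suc n" \<omega>]
      by (fastforce simp: AE_measure_pmf_iff outcomes_def)
  qed simp
  also have "\<dots> \<le> (\<Sum>t'\<in>T - {t}. measure_pmf.prob ?q {u. map_option fst u = Some t'})"
    using run.finite_states by (intro measure_pmf.finite_measure_subadditive_finite) auto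
  also have "\<dots> \<le> (\<Sum>t'\<in>T - {t}. spmf (Pdist M s a) t')"
    by (intro sum_mono) (subst run.prob_next_state_Suc[of \<omega> n, OF assms(1)], simp add: spmf_N[OF assms(2)])
  also have "\<dots> \<le> (\<Sum>t'\<in>states M - {t}. spmf (Pdist M s a) t')"
    using T fin_states by (intro sum_mono2) auto
  also have "\<dots> = 1 - spmf (Pdist M s a) t"
    using sum_spmf_states[of s a] True fin_states assms(2) by (simp add: sum_diff1 En_N)
  finally show ?thesis
    using measure_pmf.prob_compl[of ?A ?q] by (simp add: Compl_eq_Diff_UNIV)
next
  case False
  then have "t \<notin> set_spmf (Pdist M s a)" using supp_states[of s a] assms(2) by (auto simp: En_N)
  then show ?thesis by (simp add: in_set_spmf set_pmf_iff)
qed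

text \<open>The successors are those in \<open>M\<close>, including states outside \<open>T\<close>.
  For such a state, almost surely only loss can fulfil the conclusion, which is how a walk in a cut
  class dies.\<close>

lemma AE_successors:
  "AE \<omega> in run.\<mu>. \<forall>s a t. (s, a) \<in> run.inf_pairs \<omega> \<longrightarrow> t \<in> set_spmf (Pdist M s a) \<longrightarrow>
     (\<exists>\<^sub>\<infinity>n. \<omega> n = None \<or> map_option fst (\<omega> n) = Some t)"
proof -
  have "AE \<omega> in run.\<mu>. \<forall>c\<in>En N. \<forall>t\<in>states M. c \<in> run.inf_pairs \<omega> \<longrightarrow> t \<in> set_spmf (Pdist M (fst c) (snd c)) \<longrightarrow>
     (\<exists>\<^sub>\<infinity>n. \<omega> n = None \<or> map_option fst (\<omega> n) = Some t)"
  proof (intro AE_finite_allI run.finite_En fin_states)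
    fix c t assume c: "c \<in> En N"
    show "AE \<omega> in run.\<mu>. c \<in> run.inf_pairs \<omega> \<longrightarrow> t \<in> set_spmf (Pdist M (fst c) (snd c)) \<longrightarrow>
      (\<exists>\<^sub>\<infinity>n. \<omega> n = None \<or> map_option fst (\<omega> n) = Some t)"
    proof (cases "t \<in> set_spmf (Pdist M (fst c) (snd c))")
      case True
      have "AE \<omega> in run.\<mu>. (\<exists>\<^sub>\<infinity>n. \<omega> n = Some c) \<longrightarrow>
          (\<exists>\<^sub>\<infinity>n. \<omega> n \<in> {u. u = None \<or> map_option fst u = Some t})"
      proof (rule run.AE_infinitely_often_step)
        show "0 < spmf (Pdist M (fst c) (snd c)) t" using True by (simp add: in_set_spmf pmf_positive)
        fix n and \<omega> :: "nat \<Rightarrow> ('s \<times> 'a) option" assume "\<omega> n = Some c"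
        then show "spmf (Pdist M (fst c) (snd c)) t \<le>
            measure_pmf.prob (next_step N \<sigma> (Suc n) \<omega>) {u. u = None \<or> map_option fst u = Some t}"
          using c by (intro prob_next_state_or_lost) simp_all
      qed
      then show ?thesis unfolding run.inf_pairs_def mem_Collect_eq by eventually_elim blast
    qed simp
  qed
  then show ?thesis
    using run.AE_En
  proof eventually_elim
    case (elim \<omega>)
    show ?case
    proof (intro allI impI)
      fix s a t assume c: "(s, a) \<in> run.inf_pairs \<omega>" "t \<in> set_spmf (Pdist M s a)"
      then obtain n where "\<omega> n = Some (s, a)" unfolding run.inf_pairs_def by (auto dest: frequently_ex)
      then have "(s, a) \<in> En N" using elim(2)[rule_format, of n] by auto
      moreover have "t \<in> states M" using c(2) supp_states[of s a] calculation by (auto simp: En_N)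
      ultimately show "\<exists>\<^sub>\<infinity>n. \<omega> n = None \<or> map_option fst (\<omega> n) = Some t"
        using elim(1)[rule_format, of "(s, a)" t] c \<open>(s, a) \<in> En N\<close> by simp
    qed
  qed
qed

text \<open>Closure under successors is \<open>AE_successors\<close>, and the tail of the run itself
  connects the states. The result is an end component of \<open>M\<close> and not just of the
  subsystem: a run that is never lost cannot repeat forever a pair with a successor outside
  \<open>T\<close>.\<close>

lemma AE_inf_pairs_ec: "AE \<omega> in run.\<mu>. (\<forall>n. \<omega> n \<noteq> None) \<longrightarrow> is_ec M (run.inf_pairs \<omega>)"
  using AE_successors run.AE_En run.AE_next_step
proof eventually_elim
  case (elim \<omega>)
  show ?case
  proof
    assume some: "\<forall>n. \<omega> n \<noteq> None"
    let ?J = "run.inf_pairs \<omega>"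
    obtain n0 where n0: "\<And>n. n \<ge> n0 \<Longrightarrow> \<omega> n \<in> Some ` ?J"
      using run.eventually_inf_pairs[OF elim(2) some] by (auto simp: MOST_nat_le)
    have edge: "(fst (the (\<omega> n)), fst (the (\<omega> (Suc n)))) \<in> ec_edges M ?J" if "n \<ge> n0" for n
    proof -
      obtain t b where t: "\<omega> (Suc n) = Some (t, b)" using some by fastforce
      obtain s a where s: "\<omega> n = Some (s, a)" "t \<in> set_spmf (Pdist N s a)"
        using run.step_Suc_Some[OF elim(3)[rule_format] t] by blast
      then have "(s, a) \<in> ?J" "(s, a) \<in> En N"
        using n0[OF that] elim(2)[rule_format, of n] by auto
      then show ?thesis using s t set_N[of s a] by (auto simp: ec_edges_def)
    qed
    have path: "(fst (the (\<omega> n)), fst (the (\<omega> (n + j)))) \<in> (ec_edges M ?J)\<^sup>*" if "n \<ge> n0" for n j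
    proof (induction j)
      case (Suc j)
      then show ?case using edge[of "n + j"] that by (auto intro: rtrancl_into_rtrancl)
    qed simp
    show "is_ec M ?J"
      unfolding is_ec_def
    proof (intro conjI ballI)
      show "?J \<noteq> {}" using n0[of n0] by auto
      show "?J \<subseteq> En M"
      proof
        fix c assume "c \<in> ?J"
        then obtain n where "\<omega> n = Some c" unfolding run.inf_pairs_def by (auto dest: frequently_ex)
        then show "c \<in> En M" using elim(2)[rule_format, of n] by (auto simp: En_N)
      qed
      show "case c of (s, a) \<Rightarrow> set_spmf (Pdist M s a) \<subseteq> ec_states ?J" if "c \<in> ?J" for c
      proof (clarify)
        fix s a t assume "c = (s, a)" "t \<in> set_spmf (Pdist M s a)"
        then have "\<exists>\<^sub>\<infinity>n. \<omega> n = None \<or> map_option fst (\<omega> n) = Some t" using elim(1) that by blast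
        then have "\<exists>\<^sub>\<infinity>n. map_option fst (\<omega> n) = Some t" using some by simp
        then show "t \<in> ec_states ?J" using run.inf_state_iff[OF elim(2)] by blast
      qed
      fix s t assume "s \<in> ec_states ?J" "t \<in> ec_states ?J"
      then have st: "\<exists>\<^sub>\<infinity>n. map_option fst (\<omega> n) = Some s" "\<exists>\<^sub>\<infinity>n. map_option fst (\<omega> n) = Some t"
        using run.inf_state_iff[OF elim(2)] by blast+
      obtain n where n: "n \<ge> n0" "map_option fst (\<omega> n) = Some s" using st(1) unfolding INFM_nat_le by blast
      obtain m where m: "m \<ge> n" "map_option fst (\<omega> m) = Some t" using st(2) unfolding INFM_nat_le by blast
      have "fst (the (\<omega> n)) = s" "fst (the (\<omega> m)) = t" using n m by auto
      then show "(s, t) \<in> (ec_edges M ?J)\<^sup>*" using path[OF n(1), of "m - n"] m(1) by simp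
    qed
  qed
qed

end

section \<open>The flow of a scheduler\<close>

locale rabin_mdp = mdp M for M :: "('s, 'a) mdp" +
  fixes k :: nat and P :: "nat \<Rightarrow> 's rabin"
  assumes rabin: "\<forall>i\<in>{1..k}. P i \<subseteq> Pow (states M) \<times> Pow (states M)"
begin

lemma finite_P: "i \<in> {1..k} \<Longrightarrow> finite (P i)"
  using rabin fin_states by (metis finite_Pow_iff finite_SigmaI finite_subset)

text \<open>Every state of a MEC has an action, and any other class has a single state.\<close>

lemma live_enabled:
  assumes D: "D \<in> D_MEC M" "live M D" and s: "s \<in> D"
  shows "enabled M s \<noteq> {}"
  using D(1)
proof (cases rule: D_MEC_cases)
  case (1 E)
  then obtain a where "(s, a) \<in> E" using s enabled_not_exit by blast
  then show ?thesis using ec_En[OF mec_ec[OF 1(1)]] by (auto simp: enabled_def)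
next
  case (2 t)
  then show ?thesis using D(2) s by (auto simp: live_def)
qed

lemma mec_live: "is_mec M E \<Longrightarrow> live M (ec_states E)"
  using ec_En[OF mec_ec, of E] mec_ec[of E] by (fastforce simp: live_def enabled_def is_ec_def ec_states_def)

end

locale class_run = rabin_mdp M k P + subsystem_run M "\<Union>X" \<sigma>
  for M :: "('s, 'a) mdp" and k P X \<sigma> +
  assumes X: "X \<subseteq> D_MEC M"
begin

definition inside :: "'s set \<Rightarrow> ('s \<times> 'a) option set" where
  "inside D = {u. \<exists>c. u = Some c \<and> fst c \<in> D}"

definition satisfied :: "(nat \<Rightarrow> ('s \<times> 'a) option) \<Rightarrow> nat set" where
  "satisfied \<omega> = {i \<in> {1..k}. (\<lambda>n. fst (the (\<omega> n))) \<in> rabin_property (P i)}"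

text \<open>The set of satisfied properties is recorded exactly, so that these events are disjoint
  for distinct classes or distinct \<open>I\<close> and their probabilities can be added.\<close>

definition settled :: "'s set \<Rightarrow> nat set \<Rightarrow> (nat \<Rightarrow> ('s \<times> 'a) option) \<Rightarrow> bool" where
  "settled D I \<omega> \<longleftrightarrow> (\<forall>n. \<omega> n \<noteq> None) \<and> (\<exists>m. \<forall>n\<ge>m. \<omega> n \<in> inside D) \<and> satisfied \<omega> = I"

definition taken :: "'s \<times> 'a \<Rightarrow> real" where
  "taken c = (if c \<in> En N \<inter> exits M then \<Sum>n. run.occ n c else 0)"

definition settle :: "'s set \<Rightarrow> nat set \<Rightarrow> real" where
  "settle D I = (if D \<in> X then run.prb (settled D I) else 0)"

lemma finite_X: "finite X"
  using X finite_D_MEC finite_subset by blast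

lemma finite_class: "D \<in> X \<Longrightarrow> finite D"
  using X finite_subset[OF D_MEC_subset fin_states] by blast

lemma summable_occ: "c \<in> En N \<inter> exits M \<Longrightarrow> summable (\<lambda>n. run.occ n c)"
proof -
  assume c: "c \<in> En N \<inter> exits M"
  obtain r where r: "\<And>m. (\<Sum>n<m. \<Sum>c\<in>En N \<inter> exits M. run.occ n c) \<le> r" by (rule exits_bound) blast
  show ?thesis
  proof (rule summableI_nonneg_bounded)
    fix m
    have "(\<Sum>n<m. run.occ n c) \<le> (\<Sum>n<m. \<Sum>c\<in>En N \<inter> exits M. run.occ n c)"
      using c run.finite_En by (intro sum_mono member_le_sum) auto
    then show "(\<Sum>n<m. run.occ n c) \<le> r" using r[of m] by linarith
  qed simp
qed

lemma pred_satisfied: "Measurable.pred run.\<mu> (\<lambda>\<omega>. satisfied \<omega> = I)"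
proof -
  have eq: "satisfied \<omega> = I \<longleftrightarrow> I \<subseteq> {1..k} \<and>
    (\<forall>i\<in>{1..k}. (\<lambda>n. fst (the (\<omega> n))) \<in> rabin_property (P i) \<longleftrightarrow> i \<in> I)" for \<omega>
    unfolding satisfied_def by blast
  have "Measurable.pred run.\<mu> (\<lambda>\<omega>. \<forall>i\<in>{1..k}. (\<lambda>n. fst (the (\<omega> n))) \<in> rabin_property (P i) \<longleftrightarrow> i \<in> I)"
  proof (rule pred_intros_finite)
    fix i assume "i \<in> {1..k}"
    from run.pred_rabin[OF finite_P[OF this], of "\<lambda>u. fst (the u)"]
    show "Measurable.pred run.\<mu> (\<lambda>\<omega>. (\<lambda>n. fst (the (\<omega> n))) \<in> rabin_property (P i) \<longleftrightarrow> i \<in> I)"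
      by measurable
  qed simp
  then show ?thesis unfolding eq by measurable
qed

lemma pred_settled [measurable]: "Measurable.pred run.\<mu> (settled D I)"
  using pred_satisfied[of I] unfolding settled_def by measurable

text \<open>The pairs that a typical run of the event repeats forever form an end component inside
  the MEC with state set \<open>D\<close>, and it satisfies \<open>P i\<close> for each
  \<open>i\<close> in \<open>I\<close>. This is a witness for \<open>I_star\<close>.\<close>

lemma settled_I_star:
  assumes D: "D \<in> X" and pos: "run.prb (settled D I) \<noteq> 0"
  shows "(D, I) \<in> I_star M k P"
proof (rule ccontr)
  assume no: "(D, I) \<notin> I_star M k P"
  have "run.prb (settled D I) = 0"
  proof (rule run.prb_eq_0)
    show "AE \<omega> in run.\<mu>. \<not> settled D I \<omega>"
      using AE_inf_pairs_ec run.AE_En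
    proof eventually_elim
      case (elim \<omega>)
      show ?case
      proof
        assume st: "settled D I \<omega>"
        let ?J = "run.inf_pairs \<omega>" and ?\<pi> = "\<lambda>n. fst (the (\<omega> n))"
        have some: "\<forall>n. \<omega> n \<noteq> None" using st by (simp add: settled_def)
        then have ec: "is_ec M ?J" using elim(1) by blast
        obtain E where E: "is_mec M E" "?J \<subseteq> E" by (rule ec_subset_mec[OF ec])
        have st_iff: "s \<in> ec_states ?J \<longleftrightarrow> (\<exists>\<^sub>\<infinity>n. ?\<pi> n = s)" for s
        proof -
          have "map_option fst (\<omega> n) = Some s \<longleftrightarrow> ?\<pi> n = s" for n
            using some[rule_format, of n] by auto
          then show ?thesis using run.inf_state_iff[OF elim(2), of s] by simp
        qed
        have "ec_states ?J \<noteq> {}" using ec by (auto simp: is_ec_def ec_states_def)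
        then obtain s where s: "s \<in> ec_states ?J" by blast
        obtain m where m: "\<And>n. n \<ge> m \<Longrightarrow> \<omega> n \<in> inside D" using st by (auto simp: settled_def)
        obtain n where "n \<ge> m" "?\<pi> n = s" using s unfolding st_iff INFM_nat_le by blast
        then have "s \<in> D" using m[of n] by (auto simp: inside_def)
        moreover have "s \<in> ec_states E" using s E(2) by (auto simp: ec_states_def)
        ultimately have "ec_states E = D"
          using cls_eq[of D s] cls_eq[OF ec_states_D_MEC[OF E(1)], of s] D X by blast
        moreover have "I = satisfied \<omega>" using st by (simp add: settled_def)
        moreover have "sat_rabin ?J (P i)" if "i \<in> satisfied \<omega>" for i
        proof (rule sat_rabin_if_in_property[of ?\<pi> _ "states M"])
          show "?\<pi> \<in> rabin_property (P i)" using that by (simp add: satisfied_def)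
          show "range ?\<pi> \<subseteq> states M"
          proof clarify
            fix n show "?\<pi> n \<in> states M"
              using elim(2)[rule_format, of n] some[rule_format, of n] T by (auto simp: En_N)
          qed
          show "ec_states ?J = {s. \<exists>\<^sub>\<infinity>n. ?\<pi> n = s}" using st_iff by blast
        qed (rule fin_states)
        moreover have "satisfied \<omega> \<subseteq> {1..k}" by (auto simp: satisfied_def)
        ultimately have "(D, I) \<in> I_star M k P"
          unfolding I_star_def using E ec by blast
        then show False using no by simp
      qed
    qed
  qed
  then show False using pos by simp
qed

lemma measure_nonexit:
  assumes c: "(s, a) \<in> En M" "(s, a) \<notin> exits M" and D: "D \<in> D_MEC M"
  shows "measure (measure_spmf (Pdist M s a)) D = of_bool (s \<in> D)"
proof (cases "s \<in> D")
  case True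
  then have supp: "set_spmf (Pdist M s a) \<subseteq> D" using c cls_eq[OF D] by (simp add: exits_def)
  have "measure (measure_spmf (Pdist M s a)) D = measure (measure_spmf (Pdist M s a)) (space (measure_spmf (Pdist M s a)))"
    using supp by (intro measure_spmf.finite_measure_eq_AE) (auto simp: AE_measure_spmf_iff)
  then show ?thesis
    using True lossless_weight_spmfD[OF lossless[OF c(1)]] by (simp add: weight_spmf_def)
next
  case False
  have "set_spmf (Pdist M s a) \<inter> D = {}"
  proof (rule ccontr)
    assume "set_spmf (Pdist M s a) \<inter> D \<noteq> {}"
    then obtain t where "t \<in> D" "t \<in> cls M s" using c by (auto simp: exits_def)
    then have "cls M s = D" using cls_eq[OF D] cls_eq[OF cls_in[OF En_states[OF c(1)]]] by blast
    then show False using False in_cls[OF En_states[OF c(1)]] by blast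
  qed
  then show ?thesis using False by (simp add: measure_spmf_zero_iff)
qed

section \<open>Mass in a class and its limit\<close>

definition at_class :: "nat \<Rightarrow> 's set \<Rightarrow> real" where
  "at_class n D = (\<Sum>s\<in>D. run.vis n s)"

lemma at_class_eq:
  assumes "D \<in> X"
  shows "at_class n D = (\<Sum>c | c \<in> En N \<and> fst c \<in> D. run.occ n c)"
proof -
  have D: "D \<subseteq> \<Union>X" using assms by blast
  have "at_class n D = (\<Sum>s\<in>\<Union>X. run.vis n s * of_bool (s \<in> D))"
    unfolding at_class_def using D run.finite_states by (intro sum.mono_neutral_cong_left) auto
  also have "\<dots> = (\<Sum>c\<in>En N. run.occ n c * of_bool (fst c \<in> D))"
    using run.sum_occ_fst[of n "\<lambda>s. of_bool (s \<in> D)"] by simp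
  also have "\<dots> = (\<Sum>c | c \<in> En N \<and> fst c \<in> D. run.occ n c)"
    using run.finite_En by (intro sum.mono_neutral_cong_right) auto
  finally show ?thesis .
qed

lemma at_class_prob: "D \<in> X \<Longrightarrow> at_class n D = run.prb (\<lambda>\<omega>. \<omega> n \<in> inside D)"
proof -
  assume D: "D \<in> X"
  have "run.prb (\<lambda>\<omega>. \<exists>s\<in>D. map_option fst (\<omega> n) = Some s) = at_class n D"
    unfolding at_class_def run.vis_def using finite_class[OF D]
    by (intro run.prb_finite_Union) auto
  moreover have "(\<exists>s\<in>D. map_option fst u = Some s) \<longleftrightarrow> u \<in> inside D" for u :: "('s \<times> 'a) option"
    by (auto simp: inside_def)
  ultimately show ?thesis by simp
qed

text \<open>Non-exits neither enter nor leave a class, so the mass in \<open>D\<close> changes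
  through exits alone. Liveness excludes mass that arrives and is lost at once.\<close>

lemma at_class_balance:
  assumes D: "D \<in> X" "live M D"
  shows "at_class m D + (\<Sum>n<m. \<Sum>c | c \<in> En N \<inter> exits M \<and> fst c \<in> D. run.occ n c) =
    of_bool (init M \<in> D) +
    (\<Sum>n<m. \<Sum>c\<in>En N \<inter> exits M. run.occ n c * measure (measure_spmf (Pdist M (fst c) (snd c))) D)"
proof (induction m)
  case 0
  have D': "D \<in> D_MEC M" "D \<subseteq> \<Union>X" using D X by blast+
  have "at_class 0 D = (\<Sum>s\<in>D. of_bool (s = init M))"
    unfolding at_class_def
    using live_enabled[OF D'(1) D(2)] D'(2)
    by (intro sum.cong) (auto simp: run.vis_0 enabled_N)
  also have "\<dots> = of_bool (init M \<in> D)"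
    using finite_class[OF D(1)] by (simp add: of_bool_def)
  finally show ?case by simp
next
  case (Suc m)
  have D': "D \<in> D_MEC M" "D \<subseteq> \<Union>X" using D X by blast+
  let ?p = "\<lambda>c. measure (measure_spmf (Pdist M (fst c) (snd c))) D"
  have "at_class (Suc m) D = (\<Sum>s\<in>D. \<Sum>c\<in>En N. run.occ m c * spmf (Pdist M (fst c) (snd c)) s)"
    unfolding at_class_def
  proof (rule sum.cong[OF refl])
    fix s assume s: "s \<in> D"
    have "run.vis (Suc m) s = (\<Sum>c\<in>En N. run.occ m c * spmf (Pdist N (fst c) (snd c)) s)"
      using live_enabled[OF D'(1) D(2) s] s D' by (auto simp: run.vis_Suc enabled_N)
    also have "\<dots> = (\<Sum>c\<in>En N. run.occ m c * spmf (Pdist M (fst c) (snd c)) s)"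
      using s D' by (intro sum.cong refl) (auto simp: spmf_N)
    finally show "run.vis (Suc m) s = (\<Sum>c\<in>En N. run.occ m c * spmf (Pdist M (fst c) (snd c)) s)" .
  qed
  also have "\<dots> = (\<Sum>c\<in>En N. run.occ m c * ?p c)"
    by (subst sum.swap) (simp add: sum_distrib_left[symmetric] sum_spmf_eq_measure finite_class[OF D(1)])
  also have "\<dots> = (\<Sum>c\<in>En N \<inter> exits M. run.occ m c * ?p c) + (\<Sum>c\<in>En N - exits M. run.occ m c * ?p c)"
    by (subst sum.Int_Diff[OF run.finite_En, of _ "exits M"]) simp
  also have "(\<Sum>c\<in>En N - exits M. run.occ m c * ?p c) = (\<Sum>c | c \<in> En N - exits M \<and> fst c \<in> D. run.occ m c)"
    using run.finite_En by (intro sum.mono_neutral_cong_right) (auto simp: En_N measure_nonexit[OF _ _ D'(1)])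
  finally have step: "at_class (Suc m) D = (\<Sum>c\<in>En N \<inter> exits M. run.occ m c * ?p c) +
    (\<Sum>c | c \<in> En N - exits M \<and> fst c \<in> D. run.occ m c)" .
  have "at_class m D = (\<Sum>c | c \<in> En N \<inter> exits M \<and> fst c \<in> D. run.occ m c) +
      (\<Sum>c | c \<in> En N - exits M \<and> fst c \<in> D. run.occ m c)"
    unfolding at_class_eq[OF D(1)] using run.finite_En
    by (subst sum.Int_Diff[of _ _ "exits M"]) (auto intro!: arg_cong2[where f="(+)"] sum.cong)
  then show ?case using Suc step by simp
qed

text \<open>The class lies entirely in the subsystem and all its states have actions, so a step that
  is no exit can neither leave it nor be lost.\<close>

lemma stay_step:
  assumes ok: "\<forall>n. \<omega> n \<in> set_pmf (next_step N \<sigma> n \<omega>)"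
    and D: "D \<in> X" "live M D" and n: "\<omega> n \<in> inside D" "\<omega> n \<notin> Some ` exits M"
  shows "\<omega> (Suc n) \<in> inside D"
proof -
  have D': "D \<in> D_MEC M" "D \<subseteq> \<Union>X" using D X by blast+
  obtain s a where s: "\<omega> n = Some (s, a)" "s \<in> D" using n by (auto simp: inside_def)
  have sa: "(s, a) \<in> En N" by (rule run.step_Some_En[OF ok[rule_format] s(1)])
  then have saM: "(s, a) \<in> En M" by (simp add: En_N)
  have "set_spmf (Pdist M s a) \<subseteq> D"
    using n(2) s saM cls_eq[OF D'(1)] by (auto simp: exits_def)
  moreover from this have P: "Pdist N s a = Pdist M s a"
    using D' by (intro Pdist_N_eq[OF sa]) blast
  ultimately have supp: "set_spmf (Pdist N s a) \<subseteq> D" by simp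
  have "\<omega> (Suc n) \<noteq> None"
    using supp live_enabled[OF D'(1) D(2)] D' lossless[OF saM]
    by (intro run.step_not_None[OF ok[rule_format] s(1)]) (auto simp: P enabled_N)
  then obtain t b where t: "\<omega> (Suc n) = Some (t, b)" by fastforce
  have "t \<in> set_spmf (Pdist N s a)"
    using run.step_Suc_Some[OF ok[rule_format] t] s by force
  then show ?thesis using t supp by (auto simp: inside_def)
qed

text \<open>To be in \<open>D\<close> at time \<open>m\<close> and yet not stay there forever, a run
  must take an exit at time \<open>m\<close> or later. The probability of this is at most the tail
  of a convergent series.\<close>

lemma at_class_limit:
  assumes D: "D \<in> X" "live M D"
  shows "(\<lambda>m. at_class m D) \<longlonglongrightarrow> (\<Sum>I\<in>Pow {1..k}. settle D I)"
proof -
  let ?A = "En N \<inter> exits M"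
  let ?S = "\<lambda>m \<omega>. \<forall>n\<ge>m. \<omega> n \<in> inside D"
  let ?e = "\<lambda>n. run.prb (\<lambda>\<omega>. \<omega> n \<in> Some ` ?A)"
  have finA: "finite ?A" using run.finite_En by blast
  obtain r where r: "\<And>m. (\<Sum>n<m. \<Sum>c\<in>En N \<inter> exits M. run.occ n c) \<le> r" by (rule exits_bound) blast
  have sum_e: "summable ?e" by (rule run.summable_outcome(1)[OF finA r])
  have lim1: "(\<lambda>m. run.prb (?S m)) \<longlonglongrightarrow> measure run.\<mu> (\<Union>m. {\<omega> \<in> space run.\<mu>. ?S m \<omega>})"
  proof (rule run.path.finite_Lim_measure_incseq)
    show "range (\<lambda>m. {\<omega> \<in> space run.\<mu>. ?S m \<omega>}) \<subseteq> sets run.\<mu>" by (intro image_subsetI) measurable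
    show "incseq (\<lambda>m. {\<omega> \<in> space run.\<mu>. ?S m \<omega>})" by (auto simp: incseq_def)
  qed
  have "measure run.\<mu> (\<Union>m. {\<omega> \<in> space run.\<mu>. ?S m \<omega>}) = run.prb (\<lambda>\<omega>. \<exists>m. ?S m \<omega>)"
    by (intro arg_cong[where f="measure _"]) auto
  \<comment> \<open>A run that remains in a class is never lost, as loss is absorbing; hence it
    settles with exactly one set \<open>I\<close>.\<close>
  also have "\<dots> = run.prb (\<lambda>\<omega>. \<exists>I\<in>Pow {1..k}. settled D I \<omega>)"
  proof (rule run.prb_cong_AE)
    show "AE \<omega> in run.\<mu>. (\<exists>m. ?S m \<omega>) = (\<exists>I\<in>Pow {1..k}. settled D I \<omega>)"
      using run.AE_None_absorbing
    proof eventually_elim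
      case (elim \<omega>)
      have "\<omega> n \<noteq> None" if S: "?S m \<omega>" for n m
      proof
        assume "\<omega> n = None"
        then have "\<omega> (max n m) = None" using elim by (metis max.cobounded1)
        then show False using S by (auto simp: inside_def dest: spec[of _ "max n m"])
      qed
      moreover have "satisfied \<omega> \<subseteq> {1..k}" by (auto simp: satisfied_def)
      ultimately show ?case unfolding settled_def by blast
    qed
  qed measurable
  also have "\<dots> = (\<Sum>I\<in>Pow {1..k}. settle D I)"
  proof -
    have "run.prb (\<lambda>\<omega>. \<exists>I\<in>Pow {1..k}. settled D I \<omega>) = (\<Sum>I\<in>Pow {1..k}. run.prb (settled D I))"
      by (rule run.prb_finite_Union[OF _ pred_settled]) (simp, simp add: settled_def)
    then show ?thesis using D by (simp add: settle_def)
  qed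
  finally have lim2: "(\<lambda>m. run.prb (?S m)) \<longlonglongrightarrow> (\<Sum>I\<in>Pow {1..k}. settle D I)"
    using lim1 by simp
  have diff: "\<bar>at_class m D - run.prb (?S m)\<bar> \<le> (\<Sum>n. ?e (n + m))" for m
  proof -
    have le: "run.prb (?S m) \<le> at_class m D"
      unfolding at_class_prob[OF D(1)] by (intro run.path.finite_measure_mono) (auto, measurable)
    have "at_class m D = run.prb (?S m) + run.prb (\<lambda>\<omega>. \<omega> m \<in> inside D \<and> \<not> ?S m \<omega>)"
      unfolding at_class_prob[OF D(1)]
      by (subst run.path.finite_measure_Union[symmetric]) (auto intro!: arg_cong[where f="measure _"])
    also have "run.prb (\<lambda>\<omega>. \<omega> m \<in> inside D \<and> \<not> ?S m \<omega>) \<le> run.prb (\<lambda>\<omega>. \<exists>n. \<omega> (n + m) \<in> Some ` ?A)"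
    proof (rule run.path.finite_measure_mono_AE)
      show "AE \<omega> in run.\<mu>. \<omega> \<in> {\<omega> \<in> space run.\<mu>. \<omega> m \<in> inside D \<and> \<not> ?S m \<omega>} \<longrightarrow>
          \<omega> \<in> {\<omega> \<in> space run.\<mu>. \<exists>n. \<omega> (n + m) \<in> Some ` ?A}"
        using run.AE_next_step
      proof eventually_elim
        case (elim \<omega>)
        show ?case
        proof (clarify, rule ccontr)
          fix n assume \<omega>: "\<omega> m \<in> inside D" "m \<le> n" "\<omega> n \<notin> inside D" and no: "\<nexists>n. \<omega> (n + m) \<in> Some ` ?A"
          have "\<omega> (m + j) \<in> inside D" for j
          proof (induction j)
            case (Suc j)
            have "\<omega> (m + j) \<notin> Some ` exits M"
            proof
              assume "\<omega> (m + j) \<in> Some ` exits M"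
              then obtain c where c: "\<omega> (m + j) = Some c" "c \<in> exits M" by blast
              then have "c \<in> En N" using run.step_Some_En[OF elim[rule_format], of "m + j" "fst c" "snd c"] by simp
              then show False using no c by (metis IntI add.commute imageI)
            qed
            then show ?case using stay_step[OF elim D Suc] by simp
          qed (simp add: \<omega>)
          from this[of "n - m"] show False using \<omega> by simp
        qed
      qed
    qed measurable
    also have "\<dots> \<le> (\<Sum>n. ?e (n + m))"
    proof -
      have "{\<omega> \<in> space run.\<mu>. \<exists>n. \<omega> (n + m) \<in> Some ` ?A} = (\<Union>n. {\<omega> \<in> space run.\<mu>. \<omega> (n + m) \<in> Some ` ?A})"
        by blast
      moreover have "measure run.\<mu> (\<Union>n. {\<omega> \<in> space run.\<mu>. \<omega> (n + m) \<in> Some ` ?A}) \<le> (\<Sum>n. ?e (n + m))"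
      proof (rule run.path.finite_measure_subadditive_countably)
        show "range (\<lambda>n. {\<omega> \<in> space run.\<mu>. \<omega> (n + m) \<in> Some ` ?A}) \<subseteq> sets run.\<mu>"
          by (intro image_subsetI) measurable
        show "summable (\<lambda>n. ?e (n + m))" using sum_e by (simp only: summable_iff_shift[of ?e])
      qed
      ultimately show ?thesis by simp
    qed
    finally show ?thesis using le by simp
  qed
  have tail: "(\<lambda>m. \<Sum>n. ?e (n + m)) \<longlonglongrightarrow> 0"
  proof -
    have "(\<lambda>m. suminf ?e - (\<Sum>n<m. ?e n)) \<longlonglongrightarrow> suminf ?e - suminf ?e"
      by (intro tendsto_diff tendsto_const summable_LIMSEQ sum_e)
    then show ?thesis by (simp add: suminf_minus_initial_segment[OF sum_e])
  qed
  have "(\<lambda>m. at_class m D - run.prb (?S m)) \<longlonglongrightarrow> 0"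
    by (rule Lim_null_comparison[OF _ tail]) (use diff in simp)
  from tendsto_add[OF this lim2] show ?thesis by simp
qed

lemma taken_outside: "c \<notin> En N \<inter> exits M \<Longrightarrow> taken c = 0"
  by (auto simp: taken_def)

lemma sum_taken: "finite A \<Longrightarrow> A \<subseteq> En N \<inter> exits M \<Longrightarrow>
  (\<lambda>m. \<Sum>n<m. \<Sum>c\<in>A. run.occ n c * g c) \<longlonglongrightarrow> (\<Sum>c\<in>A. taken c * g c)"
proof -
  assume A: "finite A" "A \<subseteq> En N \<inter> exits M"
  have "(\<lambda>m. \<Sum>c\<in>A. (\<Sum>n<m. run.occ n c) * g c) \<longlonglongrightarrow> (\<Sum>c\<in>A. taken c * g c)"
    using A summable_occ by (intro tendsto_sum tendsto_mult_right) (auto simp: taken_def intro!: summable_LIMSEQ)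
  then show ?thesis
    by (subst sum.swap) (simp add: sum_distrib_right)
qed

lemma taken_settle_balance:
  assumes D: "D \<in> X" "live M D"
  shows "inflow M taken D = outflow M k taken settle D"
proof -
  let ?A = "En N \<inter> exits M"
  let ?p = "\<lambda>c. measure (measure_spmf (Pdist M (fst c) (snd c))) D"
  have finA: "finite ?A" using run.finite_En by blast
  have "(\<lambda>m. at_class m D + (\<Sum>n<m. \<Sum>c | c \<in> ?A \<and> fst c \<in> D. run.occ n c * 1)) \<longlonglongrightarrow>
      (\<Sum>I\<in>Pow {1..k}. settle D I) + (\<Sum>c | c \<in> ?A \<and> fst c \<in> D. taken c * 1)"
    by (intro tendsto_add at_class_limit[OF D] sum_taken rev_finite_subset[OF finA]) auto
  moreover have "(\<lambda>m. at_class m D + (\<Sum>n<m. \<Sum>c | c \<in> ?A \<and> fst c \<in> D. run.occ n c * 1)) \<longlonglongrightarrow>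
      of_bool (init M \<in> D) + (\<Sum>c\<in>?A. taken c * ?p c)"
    unfolding mult_1_right at_class_balance[OF D] by (intro tendsto_add tendsto_const sum_taken finA subset_refl)
  ultimately have "(\<Sum>I\<in>Pow {1..k}. settle D I) + (\<Sum>c | c \<in> ?A \<and> fst c \<in> D. taken c) =
      of_bool (init M \<in> D) + (\<Sum>c\<in>?A. taken c * ?p c)"
    using LIMSEQ_unique by force
  moreover have "(\<Sum>c\<in>?A. taken c * ?p c) = (\<Sum>c\<in>En M. taken c * ?p c)"
    using fin_En taken_outside by (intro sum.mono_neutral_left) (auto simp: En_N)
  moreover have "(\<Sum>c | c \<in> ?A \<and> fst c \<in> D. taken c) = (\<Sum>c | c \<in> En M \<and> fst c \<in> D. taken c)"
    using fin_En taken_outside by (intro sum.mono_neutral_left) (auto simp: En_N)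
  ultimately show ?thesis by (simp add: inflow_def outflow_def)
qed

lemma flow_of_run: "is_flow M k P X taken settle"
  unfolding is_flow_def
proof (intro conjI allI ballI impI)
  show "0 \<le> taken c" for c using summable_occ[of c] by (auto simp: taken_def intro: suminf_nonneg)
  show "0 \<le> settle D I" for D I by (simp add: settle_def)
  show "c \<in> exits M" "fst c \<in> \<Union>X" if "taken c \<noteq> 0" for c
    using that taken_outside[of c] by (auto simp: En_N)
  show "D \<in> X" "(D, I) \<in> I_star M k P" if "settle D I \<noteq> 0" for D I
    using that settled_I_star[of D I] by (auto simp: settle_def split: if_splits)
  show "inflow M taken D = outflow M k taken settle D" if "D \<in> X" "live M D" for D
    using that by (rule taken_settle_balance)
qed

text \<open>The events \<open>settled D I\<close> with \<open>i \<notin> I\<close> are pairwise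
  disjoint and consist of complete runs that violate \<open>P i\<close>.\<close>

lemma loss_le_Pr:
  assumes i: "i \<in> {1..k}"
  shows "loss k X settle i \<le> Pr N \<sigma> (- rabin_property (P i))"
proof -
  let ?Z = "X \<times> {I. I \<subseteq> {1..k} \<and> i \<notin> I}"
  have finZ: "finite ?Z" using finite_X by (intro finite_cartesian_product) (auto intro: finite_subset[of _ "Pow {1..k}"])
  have "loss k X settle i = (\<Sum>(D, I)\<in>?Z. run.prb (settled D I))"
    unfolding loss_def sum.cartesian_product by (intro sum.cong) (auto simp: settle_def)
  also have "\<dots> = (\<Sum>d\<in>?Z. run.prb (settled (fst d) (snd d)))" by (simp add: split_beta)
  also have "\<dots> = run.prb (\<lambda>\<omega>. \<exists>d\<in>?Z. settled (fst d) (snd d) \<omega>)"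
  proof (rule run.prb_finite_Union[symmetric, OF finZ])
    fix d e \<omega> assume d: "d \<in> ?Z" "e \<in> ?Z" and s: "settled (fst d) (snd d) \<omega>" "settled (fst e) (snd e) \<omega>"
    obtain m m' where m: "\<forall>n\<ge>m. \<omega> n \<in> inside (fst d)" "\<forall>n\<ge>m'. \<omega> n \<in> inside (fst e)"
      using s by (auto simp: settled_def)
    then have "\<omega> (max m m') \<in> inside (fst d)" "\<omega> (max m m') \<in> inside (fst e)" by auto
    then obtain t where "t \<in> fst d" "t \<in> fst e" by (auto simp: inside_def)
    moreover have "fst d \<in> D_MEC M" "fst e \<in> D_MEC M" using d X by auto
    ultimately have "fst d = fst e" using cls_eq by metis
    moreover have "snd d = snd e" using s by (simp add: settled_def)
    ultimately show "d = e" by (rule prod_eqI)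
  qed (rule pred_settled)
  also have "\<dots> \<le> Pr N \<sigma> (- rabin_property (P i))"
    unfolding Pr_def
  proof (rule run.path.finite_measure_mono)
    show "{\<omega> \<in> space run.\<mu>. \<exists>d\<in>?Z. settled (fst d) (snd d) \<omega>} \<subseteq>
        {\<omega> \<in> space run.\<mu>. (\<forall>n. \<omega> n \<noteq> None) \<and> (\<lambda>n. fst (the (\<omega> n))) \<in> - rabin_property (P i)}"
    proof safe
      fix \<omega> D I assume "settled (fst (D, I)) (snd (D, I)) \<omega>" "i \<notin> I"
        "(\<lambda>n. fst (the (\<omega> n))) \<in> rabin_property (P i)"
      then show False using i by (auto simp: settled_def satisfied_def)
    qed (auto simp: settled_def)
  qed (rule run.sets_not_rabin[OF finite_P[OF i], of "\<lambda>u. fst (the u)"])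
  finally show ?thesis .
qed

end

section \<open>The MEC quotient\<close>

context mdp
begin

lemma measure_eq_1_iff:
  assumes "(s, a) \<in> En M"
  shows "measure (measure_spmf (Pdist M s a)) D = 1 \<longleftrightarrow> set_spmf (Pdist M s a) \<subseteq> D"
proof -
  let ?p = "measure_spmf (Pdist M s a)"
  have "measure ?p UNIV = 1"
    using lossless_weight_spmfD[OF lossless[OF assms]] by (simp add: weight_spmf_def)
  then have "measure ?p (- D) = 1 - measure ?p D"
    using measure_spmf.finite_measure_compl[of D "Pdist M s a"] lossless_weight_spmfD[OF lossless[OF assms]]
    by (simp add: Compl_eq_Diff_UNIV space_measure_spmf)
  moreover have "measure ?p (- D) = 0 \<longleftrightarrow> set_spmf (Pdist M s a) \<subseteq> D"
    unfolding measure_spmf_zero_iff by blast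
  ultimately show ?thesis by auto
qed

lemma sum_by_class: "(\<Sum>D\<in>D_MEC M. \<Sum>t\<in>D. g t) = (\<Sum>t\<in>states M. g t)"
proof -
  have "\<Union>(D_MEC M) = states M"
    using D_MEC_subset cls_in in_cls by blast
  moreover have "sum g (\<Union>(D_MEC M)) = (\<Sum>D\<in>D_MEC M. sum g D)"
  proof (rule sum.Union_disjoint[simplified o_def])
    show "\<forall>A\<in>D_MEC M. finite A" using D_MEC_subset finite_subset[OF _ fin_states] by blast
    show "\<forall>A\<in>D_MEC M. \<forall>B\<in>D_MEC M. A \<noteq> B \<longrightarrow> A \<inter> B = {}" using cls_eq by blast
  qed
  ultimately show ?thesis by simp
qed

lemma exits_states: "c \<in> exits M \<Longrightarrow> fst c \<in> states M"
  by (auto simp: exits_def En_def)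

lemma inj_exits: "inj_on snd (exits M)"
  using action_source exits_En by (fastforce simp: inj_on_def)

end

context rabin_mdp
begin

abbreviation "Q \<equiv> mec_quotient M k P"

lemma states_Q: "states Q = Cls ` D_MEC M \<union> Bot ` Pow {1..k}"
  and acts_Q: "acts Q = Orig ` acts M \<union> Tau ` Pow {1..k}"
  and init_Q: "init Q = Cls (cls M (init M))"
  by (simp_all add: mec_quotient_def quotient_def)

lemma I_starD:
  assumes "(D, I) \<in> I_star M k P"
  obtains E E' where "is_mec M E" "D = ec_states E" "I \<subseteq> {1..k}" "is_ec M E'" "E' \<subseteq> E"
    "\<And>i. i \<in> I \<Longrightarrow> sat_rabin E' (P i)"
  using assms unfolding I_star_def by blast

lemma I_star_subset: "(D, I) \<in> I_star M k P \<Longrightarrow> D \<in> D_MEC M \<and> I \<subseteq> {1..k}"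
  by (erule I_starD) (auto simp: ec_states_D_MEC)

lemma I_star_empty: "is_mec M E \<Longrightarrow> (ec_states E, {}) \<in> I_star M k P"
  using mec_ec unfolding I_star_def by blast

lemma exit_cond_iff:
  assumes "D \<in> D_MEC M"
  shows "(\<exists>s\<in>D. (s, a) \<in> En M \<and> measure (measure_spmf (Pdist M s a)) D < 1) \<longleftrightarrow> (\<exists>s\<in>D. (s, a) \<in> exits M)"
proof -
  have "(s, a) \<in> En M \<and> measure (measure_spmf (Pdist M s a)) D < 1 \<longleftrightarrow> (s, a) \<in> exits M" if "s \<in> D" for s
    using measure_eq_1_iff[of s a D] measure_spmf.subprob_measure_le_1[of "Pdist M s a" D] cls_eq[OF assms that]
    by (auto simp: exits_def)
  then show ?thesis by blast
qed

lemma tran_Q_Orig: "D \<in> D_MEC M \<Longrightarrow> s \<in> D \<Longrightarrow> (s, a) \<in> exits M \<Longrightarrow>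
  tran Q (Cls D) (Orig a) = Some (map_spmf (\<lambda>t. Cls (cls M t)) (Pdist M s a))"
proof -
  assume a: "D \<in> D_MEC M" "s \<in> D" "(s, a) \<in> exits M"
  have "(THE s. s \<in> D \<and> (s, a) \<in> En M) = s"
    using a action_source exits_En by (intro the_equality) blast+
  moreover have "\<exists>s\<in>D. (s, a) \<in> En M \<and> measure (measure_spmf (Pdist M s a)) D < 1"
    using a exit_cond_iff by blast
  ultimately show ?thesis by (simp add: mec_quotient_def quotient_def quotient_trans_def)
qed

lemma En_Q_Cls: "D \<in> D_MEC M \<Longrightarrow> (Cls D, b) \<in> En Q \<longleftrightarrow>
  (\<exists>s\<in>D. \<exists>a. b = Orig a \<and> (s, a) \<in> exits M) \<or> (\<exists>I. b = Tau I \<and> (D, I) \<in> I_star M k P)"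
proof (cases b)
  case (Orig a)
  assume D: "D \<in> D_MEC M"
  have "(Cls D, Orig a) \<in> En Q \<longleftrightarrow> a \<in> acts M \<and> (\<exists>s\<in>D. (s, a) \<in> exits M)"
    unfolding exit_cond_iff[OF D, symmetric]
    using D by (auto simp: En_def mec_quotient_def quotient_def quotient_trans_def)
  then show ?thesis using Orig exits_En by (auto simp: En_def)
next
  case (Tau I)
  assume "D \<in> D_MEC M"
  then have "(Cls D, Tau I) \<in> En Q \<longleftrightarrow> (D, I) \<in> I_star M k P"
    using I_star_subset[of D I] by (auto simp: En_def mec_quotient_def quotient_def quotient_trans_def)
  then show ?thesis using Tau by simp
qed

lemma En_Q_Bot: "(Bot I, b) \<in> En Q \<longleftrightarrow> b = Tau I \<and> I \<subseteq> {1..k}"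
  by (cases b) (auto simp: En_def mec_quotient_def quotient_def quotient_trans_def)

lemma Pdist_Q_Orig:
  "D \<in> D_MEC M \<Longrightarrow> s \<in> D \<Longrightarrow> (s, a) \<in> exits M \<Longrightarrow>
   Pdist Q (Cls D) (Orig a) = map_spmf (\<lambda>t. Cls (cls M t)) (Pdist M s a)"
  using tran_Q_Orig[of D s a] En_Q_Cls[of D "Orig a"] by (auto simp: Pdist_def[of Q])

lemma spmf_Q_Orig:
  assumes "D \<in> D_MEC M" "s \<in> D" "(s, a) \<in> exits M" "D' \<in> D_MEC M"
  shows "spmf (Pdist Q (Cls D) (Orig a)) (Cls D') = measure (measure_spmf (Pdist M s a)) D'"
proof -
  have "spmf (Pdist Q (Cls D) (Orig a)) (Cls D') =
      measure (measure_spmf (Pdist M s a)) ((\<lambda>t. Cls (cls M t)) -` {Cls D'})"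
    by (simp add: Pdist_Q_Orig[OF assms(1-3)] spmf_map)
  also have "\<dots> = measure (measure_spmf (Pdist M s a)) D'"
  proof (rule measure_spmf.finite_measure_eq_AE)
    show "AE t in measure_spmf (Pdist M s a). (t \<in> (\<lambda>t. Cls (cls M t)) -` {Cls D'}) = (t \<in> D')"
      using supp_states[of s a] exits_En assms(3) in_cls_iff[OF assms(4)]
      by (auto simp: AE_measure_spmf_iff)
  qed auto
  finally show ?thesis .
qed

lemma Pdist_Q_Tau: "(D, I) \<in> I_star M k P \<Longrightarrow> Pdist Q (Cls D) (Tau I) = return_spmf (Bot I)"
  using En_Q_Cls[of D "Tau I"] I_star_subset[of D I]
  by (auto simp: Pdist_def) (auto simp: mec_quotient_def quotient_def quotient_trans_def)

lemma Pdist_Q_Bot: "I \<subseteq> {1..k} \<Longrightarrow> Pdist Q (Bot I) (Tau I) = return_spmf (Bot I)"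
  using En_Q_Bot[of I "Tau I"]
  by (auto simp: Pdist_def) (auto simp: mec_quotient_def quotient_def quotient_trans_def)

text \<open>A MEC without exits still offers \<open>Tau {}\<close>, since any end component
  satisfies the empty set of properties, while a state in no MEC has only exits. So runs stop for
  lack of actions in the same classes of both systems.\<close>

lemma enabled_Q_iff_live:
  assumes "D \<in> D_MEC M"
  shows "enabled Q (Cls D) \<noteq> {} \<longleftrightarrow> live M D"
proof
  assume "enabled Q (Cls D) \<noteq> {}"
  then obtain b where "(Cls D, b) \<in> En Q" by (auto simp: enabled_def)
  then consider s a where "s \<in> D" "(s, a) \<in> exits M" | I where "(D, I) \<in> I_star M k P"
    using En_Q_Cls[OF assms] by blast
  then show "live M D"
  proof cases
    case 1
    then show ?thesis using exits_En by (auto simp: live_def enabled_def)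
  next
    case 2
    then show ?thesis by (rule I_starD) (simp add: mec_live)
  qed
next
  assume live: "live M D"
  show "enabled Q (Cls D) \<noteq> {}"
    using assms
  proof (cases rule: D_MEC_cases)
    case (1 E)
    then show ?thesis using I_star_empty[OF 1(1)] En_Q_Cls[OF assms] by (auto simp: enabled_def)
  next
    case (2 s)
    then obtain a where "(s, a) \<in> En M" using live by (auto simp: live_def enabled_def)
    then have "(s, a) \<in> exits M" using 2(3) by (rule exit_if_no_mec)
    then show ?thesis using 2 En_Q_Cls[OF assms] by (auto simp: enabled_def)
  qed
qed

definition lift_pair :: "'s \<times> 'a \<Rightarrow> 's qstate \<times> 'a qact" where
  "lift_pair c = (Cls (cls M (fst c)), Orig (snd c))"

lemma inj_lift_pair: "inj_on lift_pair (exits M)"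
  using inj_exits by (auto simp: inj_on_def lift_pair_def)

lemma En_Q_eq: "En Q = lift_pair ` exits M \<union> {(Cls D, Tau I) | D I. (D, I) \<in> I_star M k P} \<union>
  {(Bot I, Tau I) | I. I \<subseteq> {1..k}}"
proof -
  have "(q, b) \<in> En Q \<longleftrightarrow> (q, b) \<in> lift_pair ` exits M \<union> {(Cls D, Tau I) | D I. (D, I) \<in> I_star M k P} \<union>
    {(Bot I, Tau I) | I. I \<subseteq> {1..k}}" for q b
  proof (cases q)
    case (Cls D)
    show ?thesis
    proof (cases "D \<in> D_MEC M")
      case True
      have "(\<exists>s\<in>D. \<exists>a. b = Orig a \<and> (s, a) \<in> exits M) \<longleftrightarrow> (Cls D, b) \<in> lift_pair ` exits M"
      proof
        assume "\<exists>s\<in>D. \<exists>a. b = Orig a \<and> (s, a) \<in> exits M"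
        then obtain s a where "s \<in> D" "b = Orig a" "(s, a) \<in> exits M" by blast
        then show "(Cls D, b) \<in> lift_pair ` exits M"
          using cls_eq[OF True] by (intro image_eqI[of _ _ "(s, a)"]) (auto simp: lift_pair_def)
      next
        assume "(Cls D, b) \<in> lift_pair ` exits M"
        then obtain c where "c \<in> exits M" "D = cls M (fst c)" "b = Orig (snd c)" by (auto simp: lift_pair_def)
        then show "\<exists>s\<in>D. \<exists>a. b = Orig a \<and> (s, a) \<in> exits M"
          using in_cls[OF exits_states] by (metis prod.collapse)
      qed
      then show ?thesis using True Cls by (auto simp: En_Q_Cls)
    next
      case False
      then have "(Cls D, b) \<notin> En Q" by (auto simp: En_def states_Q)
      moreover have "(Cls D, b) \<notin> lift_pair ` exits M"
        using False cls_in[OF exits_states] by (auto simp: lift_pair_def)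
      ultimately show ?thesis using False Cls I_star_subset by auto
    qed
  qed (auto simp: En_Q_Bot lift_pair_def)
  then show ?thesis by (auto simp only: set_eq_iff split_paired_All)
qed

lemma finite_I_star: "finite (I_star M k P)"
proof (rule finite_subset)
  show "I_star M k P \<subseteq> D_MEC M \<times> Pow {1..k}" using I_star_subset by auto
qed (use finite_D_MEC in auto)

lemma is_sub_Q: "is_sub_mdp Q"
  by (rule is_sub_mdp_mec_quotient[OF is_mdp])

text \<open>An action has only one source state, so the sum has at most one term; it spares naming
  that state.\<close>

primrec weight :: "('s \<times> 'a \<Rightarrow> real) \<Rightarrow> ('s set \<Rightarrow> nat set \<Rightarrow> real) \<Rightarrow> 's set \<Rightarrow> 'a qact \<Rightarrow> real" where
  "weight y z D (Orig a) = (\<Sum>c | c \<in> exits M \<and> fst c \<in> D \<and> snd c = a. y c)"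
| "weight y z D (Tau I) = z D I"

lemma weight_Orig: "c \<in> exits M \<Longrightarrow> fst c \<in> D \<Longrightarrow> weight y z D (Orig (snd c)) = y c"
proof -
  assume c: "c \<in> exits M" "fst c \<in> D"
  then have "{c'. c' \<in> exits M \<and> fst c' \<in> D \<and> snd c' = snd c} = {c}"
    using inj_exits by (auto dest: inj_onD)
  then show ?thesis by simp
qed

lemma enabled_Q_Cls:
  assumes D: "D \<in> D_MEC M"
  shows "enabled Q (Cls D) = (\<lambda>c. Orig (snd c)) ` {c \<in> exits M. fst c \<in> D} \<union> Tau ` {I. (D, I) \<in> I_star M k P}"
  by (force simp: enabled_def En_Q_Cls[OF D])

lemma finite_enabled_Q: "finite (enabled Q q)"
  using is_sub_Q by (auto simp: enabled_def En_def is_sub_mdp_def intro: finite_subset[of _ "acts Q"])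

lemma sum_weight:
  assumes flow: "is_flow M k P X y z" and D: "D \<in> D_MEC M"
  shows "(\<Sum>b\<in>enabled Q (Cls D). weight y z D b) = outflow M k y z D"
proof -
  let ?A = "{c \<in> exits M. fst c \<in> D}" and ?B = "{I. (D, I) \<in> I_star M k P}"
  have fin: "finite ?A" "finite ?B"
  proof -
    show "finite ?A" by (rule finite_subset[OF _ fin_En]) (use exits_En in blast)
    show "finite ?B" by (rule finite_subset[of _ "Pow {1..k}"]) (use I_star_subset in blast, simp)
  qed
  have "(\<Sum>b\<in>enabled Q (Cls D). weight y z D b) =
      (\<Sum>b\<in>(\<lambda>c. Orig (snd c)) ` ?A. weight y z D b) + (\<Sum>b\<in>Tau ` ?B. weight y z D b)"
    unfolding enabled_Q_Cls[OF D] using fin by (intro sum.union_disjoint) auto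
  also have "(\<Sum>b\<in>(\<lambda>c. Orig (snd c)) ` ?A. weight y z D b) = (\<Sum>c\<in>?A. y c)"
    using inj_exits by (subst sum.reindex) (auto simp: inj_on_def weight_Orig simp del: weight.simps)
  also have "\<dots> = (\<Sum>c | c \<in> En M \<and> fst c \<in> D. y c)"
    using fin_En flow exits_En by (intro sum.mono_neutral_left) (auto simp: is_flow_def)
  also have "(\<Sum>b\<in>Tau ` ?B. weight y z D b) = (\<Sum>I\<in>?B. z D I)"
    by (subst sum.reindex) (auto simp: inj_on_def)
  also have "\<dots> = (\<Sum>I\<in>Pow {1..k}. z D I)"
    using flow I_star_subset by (intro sum.mono_neutral_left) (auto simp: is_flow_def)
  finally show ?thesis by (simp add: outflow_def)
qed

lemma weight_nonneg: "is_flow M k P X y z \<Longrightarrow> 0 \<le> weight y z D b"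
  by (cases b) (auto simp: is_flow_def intro: sum_nonneg)

text \<open>The product form covers classes without inflow: by balance all weights vanish there, and
  any enabled action will do.\<close>

lemma flow_choice_exists:
  assumes flow: "is_flow M k P X y z" and D: "D \<in> X" "D \<in> D_MEC M" "live M D"
  shows "\<exists>p. set_pmf p \<subseteq> enabled Q (Cls D) \<and>
    (\<forall>b\<in>enabled Q (Cls D). inflow M y D * pmf p b = weight y z D b)"
proof -
  have sum: "(\<Sum>b\<in>enabled Q (Cls D). weight y z D b) = inflow M y D"
    using flow D by (simp add: sum_weight[OF flow D(2)] is_flow_def)
  show ?thesis
  proof (cases "inflow M y D > 0")
    case True
    obtain p where "set_pmf p = {b \<in> enabled Q (Cls D). 0 < weight y z D b}"
      "\<And>b. b \<in> enabled Q (Cls D) \<Longrightarrow> pmf p b = weight y z D b / inflow M y D"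
      by (rule pmf_of_weights[OF finite_enabled_Q, of "Cls D" "weight y z D", unfolded sum])
        (use weight_nonneg[OF flow] True in auto)
    then show ?thesis using True by (intro exI[of _ p]) auto
  next
    case False
    moreover have "0 \<le> inflow M y D"
      unfolding sum[symmetric] by (intro sum_nonneg weight_nonneg[OF flow])
    ultimately have 0: "inflow M y D = 0" by simp
    then have w0: "\<forall>b\<in>enabled Q (Cls D). weight y z D b = 0"
      using sum sum_nonneg_eq_0_iff[OF finite_enabled_Q, of "Cls D" "weight y z D"] weight_nonneg[OF flow] by simp
    obtain b where "b \<in> enabled Q (Cls D)" using enabled_Q_iff_live D by blast
    then show ?thesis using 0 w0 by (intro exI[of _ "return_pmf b"]) auto
  qed
qed

definition flow_choice :: "('s \<times> 'a \<Rightarrow> real) \<Rightarrow> ('s set \<Rightarrow> nat set \<Rightarrow> real) \<Rightarrow> 's set \<Rightarrow> 'a qact pmf" where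
  "flow_choice y z D = (SOME p. set_pmf p \<subseteq> enabled Q (Cls D) \<and>
    (\<forall>b\<in>enabled Q (Cls D). inflow M y D * pmf p b = weight y z D b))"

lemma flow_choice:
  assumes "is_flow M k P X y z" "D \<in> X" "D \<in> D_MEC M" "live M D"
  shows "set_pmf (flow_choice y z D) \<subseteq> enabled Q (Cls D)"
    "b \<in> enabled Q (Cls D) \<Longrightarrow> inflow M y D * pmf (flow_choice y z D) b = weight y z D b"
  using someI_ex[OF flow_choice_exists[OF assms]] unfolding flow_choice_def by blast+

end

section \<open>Runs in a subsystem of the quotient\<close>

locale quotient_run = rabin_mdp M k P + run: mdp_run "subsystem (mec_quotient M k P) T" \<sigma>
  for M :: "('s, 'a) mdp" and k P and T :: "'s qstate set" and \<sigma> +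
  assumes T: "T \<subseteq> states (mec_quotient M k P)"
begin

abbreviation "N \<equiv> subsystem Q T"

definition X :: "'s set set" where "X = {D \<in> D_MEC M. Cls D \<in> T}"

lemma finite_X: "finite X" and X_sub: "X \<subseteq> D_MEC M"
  using finite_D_MEC by (auto simp: X_def)

lemma En_N: "c \<in> En N \<longleftrightarrow> c \<in> En Q \<and> fst c \<in> T"
  using En_subsystem[OF T] by auto

lemma enabled_N: "enabled N q = (if q \<in> T then enabled Q q else {})"
  by (rule enabled_subsystem[OF T])

lemma spmf_N: "(q, b) \<in> En N \<Longrightarrow> spmf (Pdist N q b) t = of_bool (t \<in> T) * spmf (Pdist Q q b) t"
  by (auto simp: En_N Pdist_subsystem[OF T] spmf_restrict_spmf)

lemma set_N: "(q, b) \<in> En N \<Longrightarrow> set_spmf (Pdist N q b) = set_spmf (Pdist Q q b) \<inter> T"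
  by (auto simp: En_N Pdist_subsystem[OF T])

definition out :: "('s \<times> 'a) set" where
  "out = {c \<in> exits M. cls M (fst c) \<in> X}"

definition taus :: "('s set \<times> nat set) set" where
  "taus = {d \<in> I_star M k P. fst d \<in> X}"

definition tau_pair :: "'s set \<times> nat set \<Rightarrow> 's qstate \<times> 'a qact" where
  "tau_pair d = (Cls (fst d), Tau (snd d))"

definition bots :: "nat set set" where "bots = {I. I \<subseteq> {1..k} \<and> Bot I \<in> T}"

lemma En_N_eq: "En N = lift_pair ` out \<union> tau_pair ` taus \<union> (\<lambda>I. (Bot I, Tau I)) ` bots"
proof -
  have "lift_pair ` out = {c \<in> lift_pair ` exits M. fst c \<in> T}"
    using cls_in[OF exits_states] by (auto simp: out_def lift_pair_def X_def)
  moreover have "tau_pair ` taus = {c \<in> {(Cls D, Tau I) | D I. (D, I) \<in> I_star M k P}. fst c \<in> T}"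
    using I_star_subset by (auto simp: taus_def tau_pair_def X_def image_iff)
  moreover have "(\<lambda>I. (Bot I, Tau I :: 'a qact)) ` bots = {c \<in> {(Bot I, Tau I) | I. I \<subseteq> {1..k}}. fst c \<in> T}"
    by (auto simp: bots_def)
  moreover have "En N = {c \<in> lift_pair ` exits M. fst c \<in> T} \<union>
      {c \<in> {(Cls D, Tau I) | D I. (D, I) \<in> I_star M k P}. fst c \<in> T} \<union>
      {c \<in> {(Bot I, Tau I) | I. I \<subseteq> {1..k}}. fst c \<in> T}"
    unfolding set_eq_iff En_N En_Q_eq by blast
  ultimately show ?thesis by (simp only:)
qed

lemma finite_out: "finite out" and finite_taus: "finite taus" and finite_bots: "finite bots"
  using finite_subset[OF exits_En fin_En] finite_I_star finite_subset[of bots "Pow {1..k}"]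
  by (auto simp: out_def taus_def bots_def)

lemma sum_En_N: "(\<Sum>c\<in>En N. g c) =
  (\<Sum>c\<in>out. g (lift_pair c)) + (\<Sum>d\<in>taus. g (tau_pair d)) + (\<Sum>I\<in>bots. g (Bot I, Tau I))"
proof -
  have "(\<Sum>c\<in>En N. g c) = sum g (lift_pair ` out \<union> tau_pair ` taus) + sum g ((\<lambda>I. (Bot I, Tau I)) ` bots)"
    unfolding En_N_eq using finite_out finite_taus finite_bots
    by (intro sum.union_disjoint) (auto simp: lift_pair_def tau_pair_def)
  also have "sum g (lift_pair ` out \<union> tau_pair ` taus) = sum g (lift_pair ` out) + sum g (tau_pair ` taus)"
    using finite_out finite_taus by (intro sum.union_disjoint) (auto simp: lift_pair_def tau_pair_def)
  also have "sum g (lift_pair ` out) = (\<Sum>c\<in>out. g (lift_pair c))"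
    using inj_on_subset[OF inj_lift_pair] by (subst sum.reindex) (auto simp: out_def)
  also have "sum g (tau_pair ` taus) = (\<Sum>d\<in>taus. g (tau_pair d))"
    by (subst sum.reindex) (auto simp: inj_on_def tau_pair_def prod_eq_iff)
  also have "sum g ((\<lambda>I. (Bot I, Tau I)) ` bots) = (\<Sum>I\<in>bots. g (Bot I, Tau I))"
    by (subst sum.reindex) (auto simp: inj_on_def)
  finally show ?thesis .
qed

lemma out_En: "c \<in> out \<Longrightarrow> lift_pair c \<in> En N" and taus_En: "d \<in> taus \<Longrightarrow> tau_pair d \<in> En N"
  and bots_En: "I \<in> bots \<Longrightarrow> (Bot I, Tau I) \<in> En N"
  by (auto simp: En_N_eq)

lemma spmf_N_lift:
  assumes "c \<in> out" "D \<in> X"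
  shows "spmf (Pdist N (fst (lift_pair c)) (snd (lift_pair c))) (Cls D) =
    measure (measure_spmf (Pdist M (fst c) (snd c))) D"
proof -
  have c: "(fst c, snd c) \<in> exits M" "fst c \<in> states M" using assms(1) exits_states[of c] by (auto simp: out_def)
  then have "spmf (Pdist Q (Cls (cls M (fst c))) (Orig (snd c))) (Cls D) = measure (measure_spmf (Pdist M (fst c) (snd c))) D"
    using assms(2) X_sub by (intro spmf_Q_Orig cls_in in_cls) auto
  moreover have "(Cls (cls M (fst c)), Orig (snd c)) \<in> En N" using out_En[OF assms(1)] by (simp add: lift_pair_def)
  ultimately show ?thesis using assms(2) by (simp add: lift_pair_def spmf_N X_def)
qed

lemma set_N_lift: "c \<in> out \<Longrightarrow> set_spmf (Pdist N (fst (lift_pair c)) (snd (lift_pair c))) \<subseteq> range Cls"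
proof -
  assume c: "c \<in> out"
  then have c': "(fst c, snd c) \<in> exits M" "fst c \<in> states M" using exits_states[of c] by (auto simp: out_def)
  show ?thesis
    using out_En[OF c] Pdist_Q_Orig[OF cls_in[OF c'(2)] in_cls[OF c'(2)] c'(1)]
    by (auto simp: set_N lift_pair_def)
qed

lemma spmf_N_tau: "d \<in> taus \<Longrightarrow> spmf (Pdist N (fst (tau_pair d)) (snd (tau_pair d))) t = of_bool (t \<in> T \<and> t = Bot (snd d))"
  using taus_En[of d] Pdist_Q_Tau[of "fst d" "snd d"] by (auto simp: tau_pair_def taus_def spmf_N)

lemma spmf_N_bot: "I \<in> bots \<Longrightarrow> spmf (Pdist N (Bot I) (Tau I)) t = of_bool (t = Bot I)"
  using bots_En[of I] Pdist_Q_Bot[of I] by (auto simp: bots_def spmf_N)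

lemma vis_Suc_Cls:
  assumes D: "D \<in> X"
  shows "run.vis (Suc n) (Cls D) = of_bool (live M D) *
    (\<Sum>c\<in>out. run.occ n (lift_pair c) * measure (measure_spmf (Pdist M (fst c) (snd c))) D)"
proof -
  have "enabled N (Cls D) \<noteq> {} \<longleftrightarrow> live M D"
    using D enabled_Q_iff_live by (auto simp: enabled_N X_def)
  moreover have "(\<Sum>c\<in>En N. run.occ n c * spmf (Pdist N (fst c) (snd c)) (Cls D)) =
      (\<Sum>c\<in>out. run.occ n (lift_pair c) * measure (measure_spmf (Pdist M (fst c) (snd c))) D)"
    unfolding sum_En_N by (simp add: spmf_N_lift[OF _ D] spmf_N_tau spmf_N_bot)
  ultimately show ?thesis unfolding run.vis_Suc by simp
qed

lemma vis_0_Cls: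
  assumes "D \<in> X"
  shows "run.vis 0 (Cls D) = of_bool (init M \<in> D \<and> live M D)"
proof -
  have "init N = Cls D \<longleftrightarrow> init M \<in> D"
    using assms in_cls_iff[OF _ init_in] by (auto simp: init_Q X_def)
  moreover have "enabled N (Cls D) \<noteq> {} \<longleftrightarrow> live M D"
    using assms enabled_Q_iff_live by (auto simp: enabled_N X_def)
  ultimately show ?thesis by (auto simp: run.vis_0)
qed

lemma vis_Cls_eq:
  assumes D: "D \<in> X"
  shows "run.vis n (Cls D) = (\<Sum>c | c \<in> out \<and> fst c \<in> D. run.occ n (lift_pair c)) +
    (\<Sum>d | d \<in> taus \<and> fst d = D. run.occ n (tau_pair d))"
proof -
  have "run.vis n (Cls D) = (\<Sum>q\<in>states N. run.vis n q * of_bool (q = Cls D))"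
    using D run.finite_states by (simp add: of_bool_def if_distrib X_def cong: if_cong)
  also have "\<dots> = (\<Sum>c\<in>En N. run.occ n c * of_bool (fst c = Cls D))"
    by (rule run.sum_occ_fst[symmetric])
  also have "\<dots> = (\<Sum>c\<in>out. run.occ n (lift_pair c) * of_bool (cls M (fst c) = D)) +
      (\<Sum>d\<in>taus. run.occ n (tau_pair d) * of_bool (fst d = D))"
    unfolding sum_En_N by (simp add: lift_pair_def tau_pair_def)
  also have "(\<Sum>c\<in>out. run.occ n (lift_pair c) * of_bool (cls M (fst c) = D)) =
      (\<Sum>c | c \<in> out \<and> fst c \<in> D. run.occ n (lift_pair c))"
  proof (rule sum.mono_neutral_cong_right[OF finite_out])
    have "fst c \<in> D \<longleftrightarrow> cls M (fst c) = D" if "c \<in> out" for c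
      using that exits_states[of c] D X_sub by (intro in_cls_iff) (auto simp: out_def)
    then show "\<forall>c\<in>out - {c \<in> out. fst c \<in> D}. run.occ n (lift_pair c) * of_bool (cls M (fst c) = D) = 0"
      "\<And>c. c \<in> {c \<in> out. fst c \<in> D} \<Longrightarrow>
        run.occ n (lift_pair c) * of_bool (cls M (fst c) = D) = run.occ n (lift_pair c)" by auto
  qed auto
  also have "(\<Sum>d\<in>taus. run.occ n (tau_pair d) * of_bool (fst d = D)) =
      (\<Sum>d | d \<in> taus \<and> fst d = D. run.occ n (tau_pair d))"
    using finite_taus by (intro sum.mono_neutral_cong_right) auto
  finally show ?thesis .
qed

lemma taus_D: "D \<in> X \<Longrightarrow> (\<Sum>d | d \<in> taus \<and> fst d = D. g d) = (\<Sum>I | (D, I) \<in> I_star M k P. g (D, I))"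
proof -
  assume D: "D \<in> X"
  have "{d. d \<in> taus \<and> fst d = D} = Pair D ` {I. (D, I) \<in> I_star M k P}"
    using D by (auto simp: taus_def)
  then show ?thesis by (simp add: sum.reindex inj_on_def)
qed

lemma loss_eq: "(\<And>D I. z D I \<noteq> 0 \<Longrightarrow> D \<in> X \<and> (D, I) \<in> I_star M k P) \<Longrightarrow>
  loss k X z i = (\<Sum>d | d \<in> taus \<and> i \<notin> snd d. z (fst d) (snd d))"
proof -
  assume z: "\<And>D I. z D I \<noteq> 0 \<Longrightarrow> D \<in> X \<and> (D, I) \<in> I_star M k P"
  have "loss k X z i = (\<Sum>d\<in>X \<times> {I. I \<subseteq> {1..k} \<and> i \<notin> I}. z (fst d) (snd d))"
    unfolding loss_def by (simp add: sum.cartesian_product split_beta)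
  also have "\<dots> = (\<Sum>d | d \<in> taus \<and> i \<notin> snd d. z (fst d) (snd d))"
  proof (rule sum.mono_neutral_right)
    show "finite (X \<times> {I. I \<subseteq> {1..k} \<and> i \<notin> I})"
      using finite_X by (intro finite_cartesian_product) (auto intro: finite_subset[of _ "Pow {1..k}"])
    show "{d. d \<in> taus \<and> i \<notin> snd d} \<subseteq> X \<times> {I. I \<subseteq> {1..k} \<and> i \<notin> I}"
    proof
      fix d assume "d \<in> {d. d \<in> taus \<and> i \<notin> snd d}"
      then show "d \<in> X \<times> {I. I \<subseteq> {1..k} \<and> i \<notin> I}"
        using I_star_subset[of "fst d" "snd d"] by (simp add: taus_def mem_Times_iff)
    qed
    show "\<forall>d\<in>X \<times> {I. I \<subseteq> {1..k} \<and> i \<notin> I} - {d. d \<in> taus \<and> i \<notin> snd d}. z (fst d) (snd d) = 0"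
      using z by (auto simp: taus_def)
  qed
  finally show ?thesis .
qed

text \<open>An absorbing state is entered only by its own \<open>Tau\<close> action or from itself,
  and the run starts in a class, so tracing the run backwards must meet that action.\<close>

lemma support_Bot:
  assumes ok: "\<forall>n. \<omega> n \<in> set_pmf (next_step N \<sigma> n \<omega>)" and n: "map_option fst (\<omega> n) = Some (Bot I)"
  shows "\<exists>m<n. \<exists>d\<in>taus. \<omega> m = Some (tau_pair d) \<and> snd d = I"
  using n
proof (induction n)
  case 0
  then obtain b where "\<omega> 0 = Some (Bot I, b)" by auto
  from run.step_0_Some[OF ok[rule_format] this] show ?case by (simp add: init_Q)
next
  case (Suc n)
  then obtain b where "\<omega> (Suc n) = Some (Bot I, b)" by auto
  then obtain q c where c: "\<omega> n = Some (q, c)" "Bot I \<in> set_spmf (Pdist N q c)"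
    using run.step_Suc_Some[OF ok[rule_format]] by metis
  have "(q, c) \<in> En N" by (rule run.step_Some_En[OF ok[rule_format] c(1)])
  then consider e where "e \<in> out" "(q, c) = lift_pair e" | d where "d \<in> taus" "(q, c) = tau_pair d"
    | J where "J \<in> bots" "(q, c) = (Bot J, Tau J)"
    unfolding En_N_eq by auto
  then show ?case
  proof cases
    case 1
    then show ?thesis using set_N_lift[OF 1(1)] c(2) by (metis fst_conv qstate.distinct(1) rangeE snd_conv subsetD)
  next
    case 2
    have "spmf (Pdist N q c) (Bot I) \<noteq> 0" using c(2) by (simp add: in_set_spmf set_pmf_iff)
    then have "snd d = I" using spmf_N_tau[OF 2(1), of "Bot I"] 2(2)[symmetric] by (auto split: if_splits)
    then show ?thesis using 2 c(1) by auto
  next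
    case 3
    have "spmf (Pdist N q c) (Bot I) \<noteq> 0" using c(2) by (simp add: in_set_spmf set_pmf_iff)
    then have "J = I" using spmf_N_bot[OF 3(1), of "Bot I"] 3(2) by (auto split: if_splits)
    then have "map_option fst (\<omega> n) = Some (Bot I)" using 3 c(1) by simp
    then show ?thesis using Suc.IH less_SucI by blast
  qed
qed

text \<open>A visit to \<open>G_bar k i\<close> is preceded by a \<open>Tau I\<close> with
  \<open>i \<notin> I\<close>, and the probability of ever taking such an action is at most the
  expected number of times it is taken.\<close>

lemma reach_le:
  assumes bound: "\<And>m d. d \<in> taus \<Longrightarrow> (\<Sum>n<m. run.occ n (tau_pair d)) \<le> z (fst d) (snd d)"
    and z: "\<And>D I. z D I \<noteq> 0 \<Longrightarrow> D \<in> X \<and> (D, I) \<in> I_star M k P"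
  shows "Pr N \<sigma> (reach (G_bar k i)) \<le> loss k X z i"
proof -
  let ?A = "tau_pair ` {d. d \<in> taus \<and> i \<notin> snd d}"
  have finA: "finite {d. d \<in> taus \<and> i \<notin> snd d}" using finite_taus by simp
  have "Pr N \<sigma> (reach (G_bar k i)) \<le> run.prb (\<lambda>\<omega>. \<exists>n. \<omega> n \<in> Some ` ?A)"
    unfolding Pr_def
  proof (rule run.path.finite_measure_mono_AE)
    show "AE \<omega> in run.\<mu>. \<omega> \<in> {\<omega> \<in> space run.\<mu>. (\<forall>n. \<omega> n \<noteq> None) \<and> (\<lambda>n. fst (the (\<omega> n))) \<in> reach (G_bar k i)} \<longrightarrow>
        \<omega> \<in> {\<omega> \<in> space run.\<mu>. \<exists>n. \<omega> n \<in> Some ` ?A}"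
      using run.AE_next_step
    proof eventually_elim
      case (elim \<omega>)
      show ?case
      proof clarify
        assume some: "\<forall>n. \<omega> n \<noteq> None" and r: "(\<lambda>n. fst (the (\<omega> n))) \<in> reach (G_bar k i)"
        then obtain n I where n: "fst (the (\<omega> n)) = Bot I" "i \<notin> I" by (auto simp: reach_def G_bar_def)
        then have "map_option fst (\<omega> n) = Some (Bot I)" using some[rule_format, of n] by auto
        then obtain m d where "d \<in> taus" "\<omega> m = Some (tau_pair d)" "snd d = I"
          using support_Bot[OF elim] by blast
        then show "\<exists>n. \<omega> n \<in> Some ` ?A" using n(2) by blast
      qed
    qed
  qed measurable
  also have "\<dots> \<le> loss k X z i"
  proof (rule run.prob_Ex_outcome_le)
    fix m
    have "(\<Sum>n<m. \<Sum>c\<in>?A. run.occ n c) = (\<Sum>d | d \<in> taus \<and> i \<notin> snd d. \<Sum>n<m. run.occ n (tau_pair d))"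
      by (subst sum.swap) (auto simp: sum.reindex inj_on_def tau_pair_def prod_eq_iff)
    also have "\<dots> \<le> (\<Sum>d | d \<in> taus \<and> i \<notin> snd d. z (fst d) (snd d))"
      by (intro sum_mono bound) auto
    also have "\<dots> = loss k X z i"
      by (rule loss_eq[symmetric]) (use z in blast)
    finally show "(\<Sum>n<m. \<Sum>c\<in>?A. run.occ n c) \<le> loss k X z i" .
  qed (use finA in auto)
  finally show ?thesis .
qed

end

section \<open>Flows in the quotient\<close>

context rabin_mdp
begin

lemma flow_nonneg: "is_flow M k P X y z \<Longrightarrow> 0 \<le> y c" "is_flow M k P X y z \<Longrightarrow> 0 \<le> z D I"
  unfolding is_flow_def by blast+

lemma inflow_nonneg: "is_flow M k P X y z \<Longrightarrow> 0 \<le> inflow M y D"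
  unfolding inflow_def using flow_nonneg by (intro add_nonneg_nonneg sum_nonneg mult_nonneg_nonneg) auto

lemma exit_live: "c \<in> exits M \<Longrightarrow> live M (cls M (fst c))"
  using in_cls[OF exits_states] by (force simp: exits_def live_def enabled_def)

lemma I_star_live: "(D, I) \<in> I_star M k P \<Longrightarrow> live M D"
  by (erule I_starD) (simp add: mec_live)

definition flow_scheduler :: "('s \<times> 'a \<Rightarrow> real) \<Rightarrow> ('s set \<Rightarrow> nat set \<Rightarrow> real) \<Rightarrow> ('s qstate, 'a qact) scheduler" where
  "flow_scheduler y z h q = (case q of Cls D \<Rightarrow> flow_choice y z D | Bot I \<Rightarrow> return_pmf (Tau I))"

text \<open>Expected visits up to time \<open>m\<close> arise by iterating a monotone recursion from
  0, of which the inflow is a fixed point at live classes. Induction on \<open>m\<close> therefore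
  bounds visits by inflow. States missing from \<open>T\<close> only lower the visits.\<close>

lemma scheduler_of_flow:
  assumes T: "T \<subseteq> states Q" "init Q \<in> T" and X: "X = {D \<in> D_MEC M. Cls D \<in> T}"
    and flow: "is_flow M k P X y z"
  shows "is_scheduler (subsystem Q T) (flow_scheduler y z)"
    and "Pr (subsystem Q T) (flow_scheduler y z) (reach (G_bar k i)) \<le> loss k X z i"
proof -
  show sched: "is_scheduler (subsystem Q T) (flow_scheduler y z)"
    unfolding is_scheduler_def
  proof (intro allI ballI impI)
    fix h q assume q: "q \<in> states (subsystem Q T)" "enabled (subsystem Q T) q \<noteq> {}"
    then have q': "q \<in> T" "enabled Q q \<noteq> {}" by (auto simp: enabled_subsystem[OF T(1)])
    show "set_pmf (flow_scheduler y z h q) \<subseteq> enabled (subsystem Q T) q"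
    proof (cases q)
      case (Cls D)
      then have "D \<in> X" "D \<in> D_MEC M" using q' T by (auto simp: X states_Q)
      moreover from this have "live M D" using q' Cls enabled_Q_iff_live by blast
      ultimately have "set_pmf (flow_choice y z D) \<subseteq> enabled Q (Cls D)"
        by (rule flow_choice(1)[OF flow])
      then show ?thesis using Cls q' by (simp add: flow_scheduler_def enabled_subsystem[OF T(1)])
    next
      case (Bot I)
      have "enabled (subsystem Q T) q = enabled Q q" using q'(1) by (simp add: enabled_subsystem[OF T(1)])
      then show ?thesis using q'(2) Bot by (auto simp: flow_scheduler_def enabled_def En_Q_Bot)
    qed
  qed
  interpret R: quotient_run M k P T "flow_scheduler y z"
    by unfold_locales (rule is_sub_mdp_subsystem[OF is_sub_Q T(2,1)], rule sched, rule T(1))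
  have XX: "R.X = X" by (simp add: X R.X_def)
  have occ: "R.run.occ n (Cls D, b) = R.run.vis n (Cls D) * pmf (flow_choice y z D) b" for n D b
    by (rule R.run.occ_memoryless) (simp add: flow_scheduler_def)
  have occ_le: "(\<Sum>n<m. R.run.occ n (Cls D, b)) \<le> weight y z D b"
    if D: "D \<in> X" "D \<in> D_MEC M" "live M D" "b \<in> enabled Q (Cls D)" and le: "(\<Sum>n<m. R.run.vis n (Cls D)) \<le> inflow M y D"
    for m D b
    using mult_right_mono[OF le, of "pmf (flow_choice y z D) b"] flow_choice(2)[OF flow D]
    by (simp add: occ sum_distrib_right)
  have vis: "(\<Sum>n<m. R.run.vis n (Cls D)) \<le> inflow M y D" if "D \<in> X" for m D
    using that
  proof (induction m arbitrary: D)
    case 0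
    then show ?case using inflow_nonneg[OF flow] by simp
  next
    case (Suc m)
    let ?p = "\<lambda>c. measure (measure_spmf (Pdist M (fst c) (snd c))) D"
    have "(\<Sum>n<Suc m. R.run.vis n (Cls D)) = R.run.vis 0 (Cls D) + (\<Sum>n<m. R.run.vis (Suc n) (Cls D))"
      by (rule sum.lessThan_Suc_shift)
    also have "\<dots> \<le> of_bool (init M \<in> D) + (\<Sum>n<m. \<Sum>c\<in>R.out. R.run.occ n (lift_pair c) * ?p c)"
      using Suc.prems by (intro add_mono sum_mono) (auto simp: R.vis_0_Cls R.vis_Suc_Cls XX intro: sum_nonneg)
    also have "(\<Sum>n<m. \<Sum>c\<in>R.out. R.run.occ n (lift_pair c) * ?p c) =
        (\<Sum>c\<in>R.out. (\<Sum>n<m. R.run.occ n (lift_pair c)) * ?p c)"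
      by (subst sum.swap) (simp add: sum_distrib_right)
    \<comment> \<open>Visits to the source class are at most its inflow by the induction hypothesis,
      and \<open>flow_choice\<close> splits the inflow in proportion to the flow.\<close>
    also have "\<dots> \<le> (\<Sum>c\<in>R.out. y c * ?p c)"
    proof (intro sum_mono mult_right_mono)
      fix c assume c: "c \<in> R.out"
      then have c': "c \<in> exits M" "cls M (fst c) \<in> X" "cls M (fst c) \<in> D_MEC M"
        using X by (auto simp: R.out_def XX)
      then have "lift_pair c \<in> En Q" by (simp add: En_Q_eq)
      then have "(\<Sum>n<m. R.run.occ n (lift_pair c)) \<le> weight y z (cls M (fst c)) (Orig (snd c))"
        unfolding lift_pair_def using Suc.IH[OF c'(2)] c' exit_live[OF c'(1)]
        by (intro occ_le) (simp_all add: enabled_def)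
      also have "\<dots> = y c"
        by (rule weight_Orig[OF c'(1)]) (rule in_cls[OF exits_states[OF c'(1)]])
      finally show "(\<Sum>n<m. R.run.occ n (lift_pair c)) \<le> y c" .
    qed simp
    also have "\<dots> \<le> (\<Sum>c\<in>En M. y c * ?p c)"
      using exits_En flow_nonneg[OF flow] by (intro sum_mono2 fin_En) (auto simp: R.out_def)
    finally show ?case by (simp add: inflow_def)
  qed
  show "Pr (subsystem Q T) (flow_scheduler y z) (reach (G_bar k i)) \<le> loss k X z i"
    unfolding XX[symmetric]
  proof (rule R.reach_le)
    fix m d assume d: "d \<in> R.taus"
    then have d': "(fst d, snd d) \<in> I_star M k P" "fst d \<in> X" by (auto simp: R.taus_def XX)
    then have "(\<Sum>n<m. R.run.occ n (tau_pair d)) \<le> weight y z (fst d) (Tau (snd d))" if "tau_pair = R.tau_pair" for tau_pair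
      unfolding that R.tau_pair_def using I_star_subset[OF d'(1)] I_star_live[OF d'(1)] vis[OF d'(2)]
      by (intro occ_le) (simp_all add: enabled_Q_Cls)
    then show "(\<Sum>n<m. R.run.occ n (R.tau_pair d)) \<le> z (fst d) (snd d)" by simp
  qed (use flow in \<open>auto simp: is_flow_def XX\<close>)
qed

end

section \<open>The flow of a scheduler of the quotient\<close>

context quotient_run
begin

definition expected :: "'s qstate \<times> 'a qact \<Rightarrow> real" where
  "expected c = (\<Sum>n. run.occ n c)"

text \<open>The ranking function is constant on classes, so it descends to the quotient, where
  \<open>Tau\<close> actions have to be counted besides exits. The loops at absorbing states recur
  forever and are left out.\<close>

lemma summable_occ: "\<exists>r. \<forall>m. (\<Sum>n<m. \<Sum>c\<in>En N \<inter> {c. fst c \<in> range Cls}. run.occ n c) \<le> r"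
proof -
  obtain f :: "'s \<Rightarrow> real" where f: "\<And>s. s \<in> states M \<Longrightarrow> 0 \<le> f s"
    "\<And>s t. s \<in> states M \<Longrightarrow> t \<in> cls M s \<Longrightarrow> f t = f s"
    "\<And>s a. (s, a) \<in> En M \<Longrightarrow>
      (\<Sum>t\<in>states M. spmf (Pdist M s a) t * f t) + of_bool ((s, a) \<in> exits M) \<le> f s"
    by (rule ranking_function) blast
  define F where "F D = f (SOME s. s \<in> D)" for D
  have F: "F D = f s" if "D \<in> D_MEC M" "s \<in> D" for D s
  proof -
    have "(SOME s. s \<in> D) \<in> D" using that(2) by (rule someI)
    then show ?thesis
      unfolding F_def using that f(2)[of s] cls_eq[OF that] D_MEC_subset[OF that(1)] by auto
  qed
  have F_nonneg: "0 \<le> F D" if "D \<in> D_MEC M" for D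
    using F[OF that] D_MEC_nonempty[OF that] f(1) D_MEC_subset[OF that] by fastforce
  \<comment> \<open>The additional 1 at each class pays for the one \<open>Tau\<close> action, which
    leads to value 0. Along an exit it is passed on, and \<open>F\<close> pays for the exit.\<close>
  define g where "g q = (case q of Cls D \<Rightarrow> F D + 1 | Bot I \<Rightarrow> 0)" for q :: "'s qstate"
  have "(\<Sum>n<m. \<Sum>c\<in>En N \<inter> {c. fst c \<in> range Cls}. run.occ n c) \<le> g (init N)" for m
  proof (rule run.ranking_bound)
    show "0 \<le> g q" if "q \<in> states N" for q
      using that T F_nonneg by (force simp: g_def states_Q split: qstate.split)
    fix q b assume qb: "(q, b) \<in> En N"
    then consider e where "e \<in> out" "(q, b) = lift_pair e" | d where "d \<in> taus" "(q, b) = tau_pair d"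
      | J where "J \<in> bots" "(q, b) = (Bot J, Tau J)"
      unfolding En_N_eq by auto
    then show "(\<Sum>t\<in>states N. spmf (Pdist N q b) t * g t) + of_bool ((q, b) \<in> {c. fst c \<in> range Cls}) \<le> g q"
    proof cases
      case 1
      have e: "e \<in> exits M" "fst e \<in> states M" using 1 exits_states[of e] by (auto simp: out_def)
      let ?P = "Pdist M (fst e) (snd e)"
      have q: "q = Cls (cls M (fst e))" using 1 by (simp add: lift_pair_def)
      have "(\<Sum>t\<in>states N. spmf (Pdist N q b) t * g t) = (\<Sum>t\<in>Cls ` X. spmf (Pdist N q b) t * g t)"
      proof (rule sum.mono_neutral_right)
        show "\<forall>t\<in>states N - Cls ` X. spmf (Pdist N q b) t * g t = 0"
        proof
          fix t assume t: "t \<in> states N - Cls ` X"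
          then have "t \<notin> range Cls" using T by (auto simp: X_def states_Q)
          moreover have "set_spmf (Pdist N q b) \<subseteq> range Cls" using set_N_lift[OF 1(1)] by (simp flip: 1(2))
          ultimately have "t \<notin> set_spmf (Pdist N q b)" by blast
          then show "spmf (Pdist N q b) t * g t = 0" by (simp add: in_set_spmf set_pmf_iff)
        qed
      qed (use run.finite_states in \<open>auto simp: X_def\<close>)
      also have "\<dots> = (\<Sum>D\<in>X. measure (measure_spmf ?P) D * (F D + 1))"
        using spmf_N_lift[OF 1(1), folded 1(2)] by (subst sum.reindex) (auto simp: inj_on_def g_def)
      also have "\<dots> \<le> (\<Sum>D\<in>D_MEC M. measure (measure_spmf ?P) D * (F D + 1))"
        using X_sub F_nonneg by (intro sum_mono2 finite_D_MEC) (auto intro!: mult_nonneg_nonneg add_nonneg_nonneg)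
      also have "\<dots> = (\<Sum>D\<in>D_MEC M. \<Sum>t\<in>D. spmf ?P t * (f t + 1))"
      proof (rule sum.cong[OF refl])
        fix D assume D: "D \<in> D_MEC M"
        have "(\<Sum>t\<in>D. spmf ?P t * (f t + 1)) = (\<Sum>t\<in>D. spmf ?P t * (F D + 1))"
          using F[OF D] by (intro sum.cong) auto
        then show "measure (measure_spmf ?P) D * (F D + 1) = (\<Sum>t\<in>D. spmf ?P t * (f t + 1))"
          by (simp add: sum_distrib_right[symmetric] sum_spmf_eq_measure finite_subset[OF D_MEC_subset[OF D] fin_states])
      qed
      also have "\<dots> = (\<Sum>t\<in>states M. spmf ?P t * f t) + 1"
        using sum_spmf_states[of "fst e" "snd e"] subsetD[OF exits_En e(1)]
        by (simp add: sum_by_class distrib_left sum.distrib)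
      also have "\<dots> \<le> f (fst e)"
        using f(3)[of "fst e" "snd e"] e exits_En by auto
      also have "\<dots> = F (cls M (fst e))"
        using F[OF cls_in in_cls] e by simp
      finally show ?thesis by (simp add: q g_def)
    next
      case 2
      have q: "q = Cls (fst d)" using 2 by (simp add: tau_pair_def)
      have "(\<Sum>t\<in>states N. spmf (Pdist N q b) t * g t) = 0"
        using spmf_N_tau[OF 2(1)] 2(2)[symmetric] by (intro sum.neutral) (auto simp: g_def)
      moreover have "fst d \<in> D_MEC M" using 2(1) X_sub by (auto simp: taus_def)
      ultimately show ?thesis using F_nonneg by (simp add: q g_def)
    next
      case 3
      then have "(\<Sum>t\<in>states N. spmf (Pdist N q b) t * g t) = 0"
        by (intro sum.neutral) (auto simp: spmf_N_bot g_def)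
      then show ?thesis using 3 by (auto simp: g_def)
    qed
  qed
  then show ?thesis by blast
qed

lemma sums_expected:
  assumes "c \<in> lift_pair ` out \<union> tau_pair ` taus"
  shows "(\<lambda>n. run.occ n c) sums expected c"
proof -
  have c: "c \<in> En N \<inter> {c. fst c \<in> range Cls}"
    using assms out_En taus_En by (auto simp: lift_pair_def tau_pair_def)
  obtain r where r: "\<And>m. (\<Sum>n<m. \<Sum>c\<in>En N \<inter> {c. fst c \<in> range Cls}. run.occ n c) \<le> r"
    using summable_occ by blast
  have "summable (\<lambda>n. run.occ n c)"
  proof (rule summableI_nonneg_bounded)
    fix m
    have "(\<Sum>n<m. run.occ n c) \<le> (\<Sum>n<m. \<Sum>c\<in>En N \<inter> {c. fst c \<in> range Cls}. run.occ n c)"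
      using c run.finite_En by (intro sum_mono member_le_sum) auto
    then show "(\<Sum>n<m. run.occ n c) \<le> r" using r[of m] by linarith
  qed simp
  then show ?thesis by (simp add: expected_def summable_sums)
qed

definition exit_flow :: "'s \<times> 'a \<Rightarrow> real" where
  "exit_flow c = (if c \<in> out then expected (lift_pair c) else 0)"

definition tau_flow :: "'s set \<Rightarrow> nat set \<Rightarrow> real" where
  "tau_flow D I = (if (D, I) \<in> taus then expected (tau_pair (D, I)) else 0)"

lemma expected_nonneg: "c \<in> lift_pair ` out \<union> tau_pair ` taus \<Longrightarrow> 0 \<le> expected c"
  using sums_expected[of c] unfolding expected_def by (intro suminf_nonneg) (auto simp: sums_iff)

text \<open>Visits to \<open>D\<close> are summed in two ways: by the pair chosen there, and by the
  start together with the exits leading into \<open>D\<close>.\<close>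

lemma balance:
  assumes D: "D \<in> X" "live M D"
  shows "inflow M exit_flow D = outflow M k exit_flow tau_flow D"
proof -
  let ?p = "\<lambda>c. measure (measure_spmf (Pdist M (fst c) (snd c))) D"
  let ?A = "{c. c \<in> out \<and> fst c \<in> D}" and ?B = "{d. d \<in> taus \<and> fst d = D}"
  have "(\<lambda>n. run.vis n (Cls D)) sums ((\<Sum>c\<in>?A. expected (lift_pair c)) + (\<Sum>d\<in>?B. expected (tau_pair d)))"
    unfolding vis_Cls_eq[OF D(1)] by (intro sums_add sums_sum sums_expected) auto
  moreover have "(\<lambda>n. run.vis (Suc n) (Cls D)) sums (\<Sum>c\<in>out. expected (lift_pair c) * ?p c)"
    unfolding vis_Suc_Cls[OF D(1)] using D(2) by simp (intro sums_sum sums_mult2 sums_expected; simp)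
  then have "(\<lambda>n. run.vis n (Cls D)) sums ((\<Sum>c\<in>out. expected (lift_pair c) * ?p c) + run.vis 0 (Cls D))"
    by (rule sums_Suc)
  ultimately have "(\<Sum>c\<in>?A. expected (lift_pair c)) + (\<Sum>d\<in>?B. expected (tau_pair d)) =
      (\<Sum>c\<in>out. expected (lift_pair c) * ?p c) + run.vis 0 (Cls D)"
    by (rule sums_unique2)
  moreover have "run.vis 0 (Cls D) = of_bool (init M \<in> D)" using D by (simp add: vis_0_Cls)
  moreover have "(\<Sum>c\<in>?A. expected (lift_pair c)) = (\<Sum>c | c \<in> En M \<and> fst c \<in> D. exit_flow c)"
    using exits_En by (intro sum.mono_neutral_cong_left) (auto simp: exit_flow_def out_def fin_En)
  moreover have "(\<Sum>c\<in>out. expected (lift_pair c) * ?p c) = (\<Sum>c\<in>En M. exit_flow c * ?p c)"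
    using exits_En by (intro sum.mono_neutral_cong_left) (auto simp: exit_flow_def out_def fin_En)
  moreover have "(\<Sum>d\<in>?B. expected (tau_pair d)) = (\<Sum>I\<in>Pow {1..k}. tau_flow D I)"
  proof -
    have "(\<Sum>I | (D, I) \<in> I_star M k P. expected (tau_pair (D, I))) = (\<Sum>I\<in>Pow {1..k}. tau_flow D I)"
    proof (rule sum.mono_neutral_cong_left)
      show "{I. (D, I) \<in> I_star M k P} \<subseteq> Pow {1..k}" using I_star_subset by blast
    qed (use D in \<open>auto simp: tau_flow_def taus_def\<close>)
    then show ?thesis unfolding taus_D[OF D(1)] .
  qed
  ultimately show ?thesis by (simp add: inflow_def outflow_def)
qed

lemma flow_of_quotient_run: "is_flow M k P X exit_flow tau_flow"
  unfolding is_flow_def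
proof (intro conjI allI ballI impI)
  show "0 \<le> exit_flow c" for c by (simp add: exit_flow_def expected_nonneg)
  show "0 \<le> tau_flow D I" for D I by (simp add: tau_flow_def expected_nonneg)
  show "c \<in> exits M" if "exit_flow c \<noteq> 0" for c
    using that by (auto simp: exit_flow_def out_def split: if_splits)
  show "fst c \<in> \<Union>X" if "exit_flow c \<noteq> 0" for c
    using that in_cls[OF exits_states, of c] by (auto simp: exit_flow_def out_def split: if_splits)
  show "D \<in> X" "(D, I) \<in> I_star M k P" if "tau_flow D I \<noteq> 0" for D I
    using that by (auto simp: tau_flow_def taus_def split: if_splits)
  show "inflow M exit_flow D = outflow M k exit_flow tau_flow D" if "D \<in> X" "live M D" for D
    using that by (rule balance)
qed

text \<open>The state is absorbing, so whoever took the corresponding \<open>Tau\<close> before time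
  \<open>m\<close> is still there.\<close>

lemma vis_Bot:
  assumes I: "I \<in> bots"
  shows "run.vis m (Bot I) = (\<Sum>n<m. \<Sum>d | d \<in> taus \<and> snd d = I. run.occ n (tau_pair d))"
proof (induction m)
  case 0
  show ?case by (simp add: run.vis_0 init_Q)
next
  case (Suc m)
  have en: "enabled N (Bot I) \<noteq> {}" using bots_En[OF I] by (auto simp: enabled_def)
  have lift0: "spmf (Pdist N (fst (lift_pair c)) (snd (lift_pair c))) (Bot I) = 0" if "c \<in> out" for c
  proof -
    have "Bot I \<notin> set_spmf (Pdist N (fst (lift_pair c)) (snd (lift_pair c)))"
      using set_N_lift[OF that] by blast
    then show ?thesis by (simp add: in_set_spmf set_pmf_iff)
  qed
  have "run.vis (Suc m) (Bot I) = (\<Sum>d\<in>taus. run.occ m (tau_pair d) * of_bool (snd d = I)) +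
      (\<Sum>J\<in>bots. run.occ m (Bot J, Tau J) * of_bool (J = I))"
    unfolding run.vis_Suc sum_En_N using en I
    by (simp add: lift0 spmf_N_tau spmf_N_bot bots_def eq_commute[of I] cong: conj_cong)
  also have "(\<Sum>d\<in>taus. run.occ m (tau_pair d) * of_bool (snd d = I)) =
      (\<Sum>d | d \<in> taus \<and> snd d = I. run.occ m (tau_pair d))"
    using finite_taus by (intro sum.mono_neutral_cong_right) auto
  also have "(\<Sum>J\<in>bots. run.occ m (Bot J, Tau J) * of_bool (J = I)) = run.vis m (Bot I)"
  proof -
    have "(\<Sum>c\<in>En N. run.occ m c * of_bool (fst c = Bot I)) = (\<Sum>q\<in>states N. run.vis m q * of_bool (q = Bot I))"
      by (rule run.sum_occ_fst)
    also have "\<dots> = run.vis m (Bot I)"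
      using I run.finite_states by (simp add: of_bool_def if_distrib bots_def cong: if_cong)
    finally show ?thesis unfolding sum_En_N by (simp add: lift_pair_def tau_pair_def)
  qed
  finally show ?case using Suc by simp
qed

lemma stay_Bot:
  assumes ok: "\<forall>n. \<omega> n \<in> set_pmf (next_step N \<sigma> n \<omega>)" and I: "I \<in> bots"
    and n: "map_option fst (\<omega> n) = Some (Bot I)"
  shows "map_option fst (\<omega> (n + j)) = Some (Bot I)"
proof (induction j)
  case (Suc j)
  then obtain b where b: "\<omega> (n + j) = Some (Bot I, b)" by auto
  then have "(Bot I, b) \<in> En N" by (rule run.step_Some_En[OF ok[rule_format]])
  then have [simp]: "b = Tau I" by (simp add: En_N En_Q_Bot)
  have eq: "Pdist N (Bot I) (Tau I) = return_spmf (Bot I)"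
    by (rule spmf_eqI) (simp add: spmf_N_bot[OF I] indicator_def)
  have "\<omega> (Suc (n + j)) \<noteq> None"
    using bots_En[OF I] by (intro run.step_not_None[OF ok[rule_format] b]) (auto simp: eq enabled_def)
  then obtain t c where t: "\<omega> (Suc (n + j)) = Some (t, c)" by fastforce
  have "t \<in> set_spmf (Pdist N (Bot I) (Tau I))"
    using run.step_Suc_Some[OF ok[rule_format] t] b by force
  then show ?case using t by (simp add: eq)
qed (simp add: n)

text \<open>With all absorbing states present, no \<open>Tau\<close> step is lost. Those with
  \<open>i \<notin> I\<close> before time \<open>m\<close> then add up to the probability of being
  in \<open>G_bar k i\<close> at time \<open>m\<close>, and the loss is the limit of these
  sums.\<close>

lemma loss_le_reach:
  assumes bots: "bots = Pow {1..k}"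
  shows "loss k X tau_flow i \<le> Pr N \<sigma> (reach (G_bar k i))"
proof -
  let ?d = "{d. d \<in> taus \<and> i \<notin> snd d}" and ?I = "{I. I \<subseteq> {1..k} \<and> i \<notin> I}"
  have finI: "finite ?I" by (rule finite_subset[of _ "Pow {1..k}"]) auto
  have "(\<lambda>m. \<Sum>d\<in>?d. \<Sum>n<m. run.occ n (tau_pair d)) \<longlonglongrightarrow> (\<Sum>d\<in>?d. expected (tau_pair d))"
    using sums_expected by (intro tendsto_sum) (auto simp: sums_def)
  also have "(\<Sum>d\<in>?d. expected (tau_pair d)) = loss k X tau_flow i"
    by (subst loss_eq[of tau_flow]) (auto simp: tau_flow_def taus_def split: if_splits)
  finally show ?thesis
  proof (rule LIMSEQ_le_const2, intro exI allI impI)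
    fix m
    have "(\<Sum>d\<in>?d. \<Sum>n<m. run.occ n (tau_pair d)) =
        (\<Sum>I\<in>?I. \<Sum>d | d \<in> ?d \<and> snd d = I. \<Sum>n<m. run.occ n (tau_pair d))"
    proof (rule sum.group[symmetric, OF _ finI])
      show "snd ` ?d \<subseteq> ?I"
      proof
        fix I assume "I \<in> snd ` ?d"
        then obtain D where "(D, I) \<in> I_star M k P" "i \<notin> I" by (auto simp: taus_def)
        then show "I \<in> ?I" using I_star_subset by blast
      qed
    qed (use finite_taus in simp)
    also have "\<dots> = (\<Sum>I\<in>?I. run.vis m (Bot I))"
    proof (rule sum.cong[OF refl])
      fix I assume I: "I \<in> ?I"
      then have "{d. d \<in> ?d \<and> snd d = I} = {d. d \<in> taus \<and> snd d = I}" by auto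
      then show "(\<Sum>d | d \<in> ?d \<and> snd d = I. \<Sum>n<m. run.occ n (tau_pair d)) = run.vis m (Bot I)"
        using I by (subst vis_Bot) (auto simp: bots intro: sum.swap)
    qed
    also have "\<dots> = run.prb (\<lambda>\<omega>. \<exists>I\<in>?I. map_option fst (\<omega> m) = Some (Bot I))"
      unfolding run.vis_def by (rule run.prb_finite_Union[symmetric, OF finI]) auto
    also have "\<dots> \<le> Pr N \<sigma> (reach (G_bar k i))"
      unfolding Pr_def
    proof (rule run.path.finite_measure_mono_AE)
      show "AE \<omega> in run.\<mu>. \<omega> \<in> {\<omega> \<in> space run.\<mu>. \<exists>I\<in>?I. map_option fst (\<omega> m) = Some (Bot I)} \<longrightarrow>
          \<omega> \<in> {\<omega> \<in> space run.\<mu>. (\<forall>n. \<omega> n \<noteq> None) \<and> (\<lambda>n. fst (the (\<omega> n))) \<in> reach (G_bar k i)}"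
        using run.AE_next_step run.AE_None_absorbing
      proof eventually_elim
        case (elim \<omega>)
        show ?case
        proof
          assume "\<omega> \<in> {\<omega> \<in> space run.\<mu>. \<exists>I\<in>?I. map_option fst (\<omega> m) = Some (Bot I)}"
          then obtain I where sp: "\<omega> \<in> space run.\<mu>" and I: "I \<subseteq> {1..k}" "i \<notin> I"
            and m: "map_option fst (\<omega> m) = Some (Bot I)" by blast
          have "\<forall>n. \<omega> n \<noteq> None"
          proof (rule ccontr)
            assume "\<not> (\<forall>n. \<omega> n \<noteq> None)"
            then obtain n where "\<omega> n = None" by blast
            then have "\<omega> (m + n) = None" using elim(2)[rule_format, of n "m + n"] by simp
            moreover have "map_option fst (\<omega> (m + n)) = Some (Bot I)"
              using I by (intro stay_Bot[OF elim(1) _ m]) (simp add: bots)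
            ultimately show False by simp
          qed
          moreover have "fst (the (\<omega> m)) = Bot I" using m by auto
          then have "(\<lambda>n. fst (the (\<omega> n))) \<in> reach (G_bar k i)"
            using I by (auto simp: reach_def G_bar_def)
          ultimately show "\<omega> \<in> {\<omega> \<in> space run.\<mu>. (\<forall>n. \<omega> n \<noteq> None) \<and> (\<lambda>n. fst (the (\<omega> n))) \<in> reach (G_bar k i)}"
            using sp by blast
        qed
      qed
    qed (rule run.sets_reach[of "\<lambda>u. fst (the u)"])
    finally show "(\<Sum>d\<in>?d. \<Sum>n<m. run.occ n (tau_pair d)) \<le> Pr N \<sigma> (reach (G_bar k i))" .
  qed
qed

end

section \<open>Realizing a flow\<close>

text \<open>
  A flow on the classes contained in \<open>S\<close> is realized on \<open>subsystem M S\<close> by a scheduler that picks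
  a goal (an exit, or a set \<open>I\<close> to be satisfied forever) whenever it enters a class and then walks
  randomly inside the class. The goal is kept in the state of a product MDP. In a class that is
  only partially contained in \<open>S\<close> the walk is lost almost surely.
\<close>

locale realization = rabin_mdp M k P for M :: "('s, 'a) mdp" and k P +
  fixes S :: "'s set" and y :: "'s \<times> 'a \<Rightarrow> real" and z :: "'s set \<Rightarrow> nat set \<Rightarrow> real"
  assumes S: "S \<subseteq> states M" "init M \<in> S"
    and flow: "is_flow M k P {D \<in> D_MEC M. D \<subseteq> S} y z"
begin

definition X :: "'s set set" where "X = {D \<in> D_MEC M. D \<subseteq> S}"

lemma flow_X: "is_flow M k P X y z"
  using flow by (simp add: X_def)

lemma X_D_MEC: "D \<in> X \<Longrightarrow> D \<in> D_MEC M"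
  by (simp add: X_def)

definition target :: "'s set \<Rightarrow> nat set \<Rightarrow> ('s \<times> 'a) set" where
  "target D I = (SOME E. is_ec M E \<and> ec_states E \<subseteq> D \<and> (\<forall>i\<in>I. sat_rabin E (P i)))"

lemma target:
  assumes "(D, I) \<in> I_star M k P"
  shows "is_ec M (target D I)" "ec_states (target D I) \<subseteq> D" "i \<in> I \<Longrightarrow> sat_rabin (target D I) (P i)"
proof -
  have "\<exists>E. is_ec M E \<and> ec_states E \<subseteq> D \<and> (\<forall>i\<in>I. sat_rabin E (P i))"
    using assms by (rule I_starD) (force simp: ec_states_def)
  from someI_ex[OF this] show "is_ec M (target D I)" "ec_states (target D I) \<subseteq> D"
    "i \<in> I \<Longrightarrow> sat_rabin (target D I) (P i)"
    unfolding target_def by blast+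
qed

definition inner_acts :: "'s \<Rightarrow> 'a set" where
  "inner_acts s = {a \<in> enabled M s. (s, a) \<notin> exits M}"

text \<open>With an exit as goal, the walk roams the MEC until it stands at the source of that exit;
  with \<open>Tau I\<close> it roams until it meets \<open>target\<close> and then keeps to it. In a
  cut class it roams whatever the goal.\<close>

definition goal_acts :: "'s \<Rightarrow> 'a qact \<Rightarrow> 'a set" where
  "goal_acts s g =
     (if cls M s \<in> X
      then (case g of
          Orig a \<Rightarrow> if (s, a) \<in> exits M then {a} else inner_acts s
        | Tau I \<Rightarrow> if (cls M s, I) \<in> I_star M k P \<and> s \<in> ec_states (target (cls M s) I)
            then {a. (s, a) \<in> target (cls M s) I} else inner_acts s)
      else inner_acts s)"

text \<open>The fallback makes the set nonempty wherever some action is enabled, as a uniform choice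
  from it requires.\<close>

definition walk :: "'s \<Rightarrow> 'a qact \<Rightarrow> 'a set" where
  "walk s g = (if goal_acts s g = {} then enabled M s else goal_acts s g)"

lemma goal_acts_enabled: "goal_acts s g \<subseteq> enabled M s"
  using exits_En ec_En[OF target(1)]
  by (auto simp: goal_acts_def inner_acts_def enabled_def split: qact.splits if_splits)

lemma walk_enabled: "walk s g \<subseteq> enabled M s" and walk_nonempty: "enabled M s \<noteq> {} \<Longrightarrow> walk s g \<noteq> {}"
  using goal_acts_enabled[of s g] by (auto simp: walk_def)

lemma finite_walk: "finite (walk s g)"
  using walk_enabled[of s g] fin_acts by (auto simp: enabled_def En_def intro: finite_subset)

lemma inner_acts_mec:
  assumes "is_mec M E" "s \<in> ec_states E"
  shows "inner_acts s = {a. (s, a) \<in> E}" "inner_acts s \<noteq> {}"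
proof -
  show "inner_acts s = {a. (s, a) \<in> E}"
    using not_exit_in_mec[OF assms] mec_not_exit[OF mec_ec[OF assms(1)]] ec_En[OF mec_ec[OF assms(1)]]
    by (auto simp: inner_acts_def enabled_def)
  then show "inner_acts s \<noteq> {}" using assms(2) by (auto simp: ec_states_def)
qed

lemma class_mec_or_singleton:
  assumes "s \<in> states M"
  obtains E where "is_mec M E" "cls M s = ec_states E" "s \<in> ec_states E" | "cls M s = {s}"
  using cls_in[OF assms]
proof (cases rule: D_MEC_cases)
  case (1 E)
  then show thesis using that(1)[of E] in_cls[OF assms] by simp
next
  case (2 t)
  then show thesis using that(2) in_cls[OF assms] by simp
qed

text \<open>The singleton class of a state in \<open>S\<close> is contained in \<open>S\<close>, so
  a cut class is a MEC; the walk chooses among all its pairs.\<close>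

lemma walk_partial:
  assumes s: "s \<in> S" "cls M s \<notin> X"
  obtains E where "is_mec M E" "cls M s = ec_states E" "s \<in> ec_states E" "walk s g = {a. (s, a) \<in> E}"
proof -
  have sM: "s \<in> states M" using s S by blast
  from sM show thesis
  proof (cases rule: class_mec_or_singleton)
    case (1 E)
    then have "walk s g = {a. (s, a) \<in> E}"
      using inner_acts_mec[OF 1(1,3)] s(2) by (auto simp: walk_def goal_acts_def)
    then show ?thesis using that 1 by blast
  next
    case 2
    then show ?thesis using s cls_in[OF sM] by (auto simp: X_def)
  qed
qed

lemma walk_exit_partial: "s \<in> S \<Longrightarrow> cls M s \<notin> X \<Longrightarrow> a \<in> walk s g \<Longrightarrow> (s, a) \<notin> exits M"
  by (erule (1) walk_partial[of s g]) (auto dest: mec_not_exit[OF mec_ec])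

text \<open>Away from the source of the goal the walk uses non-exits, which are available since such
  a class is a MEC; with a goal \<open>Tau I\<close> all pairs used belong to end
  components.\<close>

lemma walk_exit_goal:
  assumes s: "s \<in> S" "cls M s \<in> X" and g: "g \<in> enabled Q (Cls (cls M s))"
    and a: "a \<in> walk s g" "(s, a) \<in> exits M"
  shows "g = Orig a"
proof -
  have sM: "s \<in> states M" using s S by blast
  have D: "cls M s \<in> D_MEC M" by (rule cls_in[OF sM])
  from g consider s' b where "s' \<in> cls M s" "g = Orig b" "(s', b) \<in> exits M"
    | I where "g = Tau I" "(cls M s, I) \<in> I_star M k P"
    unfolding enabled_def mem_Collect_eq En_Q_Cls[OF D] by blast
  then show ?thesis
  proof cases
    case 1
    show ?thesis
    proof (cases "(s, b) \<in> exits M")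
      case True
      then show ?thesis using a s 1 by (simp add: walk_def goal_acts_def)
    next
      case False
      from sM show ?thesis
      proof (cases rule: class_mec_or_singleton)
        case mec: (1 E)
        then have "walk s g = inner_acts s"
          using inner_acts_mec(2)[OF mec(1,3)] s(2) 1 False by (auto simp: walk_def goal_acts_def)
        then show ?thesis using a by (simp add: inner_acts_def)
      next
        case 2
        then show ?thesis using 1 False by simp
      qed
    qed
  next
    case 2
    from 2(2) obtain E where E: "is_mec M E" "cls M s = ec_states E" by (rule I_starD)
    then have inner: "inner_acts s \<noteq> {}" using inner_acts_mec(2)[OF E(1), of s] in_cls[OF sM] by simp
    have "(s, a) \<notin> exits M"
    proof (cases "s \<in> ec_states (target (cls M s) I)")
      case True
      then have "goal_acts s g = {a. (s, a) \<in> target (cls M s) I}" "goal_acts s g \<noteq> {}"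
        using 2 s by (auto simp: goal_acts_def ec_states_def)
      then show ?thesis using a(1) mec_not_exit[OF target(1)[OF 2(2)]] by (auto simp: walk_def split: if_splits)
    next
      case False
      then have "goal_acts s g = inner_acts s" using 2 s by (simp add: goal_acts_def)
      then have "walk s g = inner_acts s" using inner by (simp add: walk_def)
      then show ?thesis using a(1) by (simp add: inner_acts_def)
    qed
    then show ?thesis using a(2) by simp
  qed
qed

text \<open>In a cut class the goal is a dummy that the walk ignores.\<close>

definition pick_goal :: "'s \<Rightarrow> 'a qact pmf" where
  "pick_goal s = (if cls M s \<in> X then flow_choice y z (cls M s) else return_pmf (Tau {}))"

lemma set_pick_goal:
  assumes "s \<in> states M" "enabled M s \<noteq> {}"
  shows "set_pmf (pick_goal s) \<subseteq> acts Q"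
    "cls M s \<in> X \<Longrightarrow> set_pmf (pick_goal s) \<subseteq> enabled Q (Cls (cls M s))"
proof -
  have live: "live M (cls M s)" using assms in_cls by (auto simp: live_def)
  show *: "set_pmf (pick_goal s) \<subseteq> enabled Q (Cls (cls M s))" if "cls M s \<in> X"
    using flow_choice(1)[OF flow_X that X_D_MEC[OF that] live] that by (simp add: pick_goal_def)
  have "enabled Q (Cls (cls M s)) \<subseteq> acts Q" by (auto simp: enabled_def En_def)
  then show "set_pmf (pick_goal s) \<subseteq> acts Q"
    using * by (cases "cls M s \<in> X") (auto simp: pick_goal_def acts_Q)
qed

text \<open>An exit erases the goal, so \<open>None\<close> marks the entry into a class, possibly
  the same one again, where a new goal is due. Counting states with \<open>None\<close> thus counts
  entries.\<close>

definition memo :: "'s \<Rightarrow> 'a \<Rightarrow> 'a qact \<Rightarrow> 'a qact option" where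
  "memo s a g = (if (s, a) \<in> exits M then None else Some g)"

section \<open>The product with the remembered goal\<close>

abbreviation "N \<equiv> subsystem M S"

text \<open>The goal is part of the action as well, so that a run shows it already at the step where
  it is drawn and the memory is still \<open>None\<close>.\<close>

definition product_mdp :: "('s \<times> 'a qact option, 'a \<times> 'a qact) mdp" where
  "product_mdp =
     \<lparr>states = S \<times> insert None (Some ` acts Q),
      acts = acts M \<times> acts Q,
      init = (init M, None),
      tran = (\<lambda>(s, m) (a, g). if (s, a) \<in> En M \<and> s \<in> S
         then Some (map_spmf (\<lambda>t. (t, memo s a g)) (Pdist N s a)) else None)\<rparr>"

abbreviation "N' \<equiv> product_mdp"

text \<open>The history is ignored: this makes \<open>occ_memoryless\<close> applicable and gives
  each continuation of a pair a fixed probability.\<close>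

definition goal_sched :: "('s \<times> 'a qact option, 'a \<times> 'a qact) scheduler" where
  "goal_sched h q =
     bind_pmf (case snd q of None \<Rightarrow> pick_goal (fst q) | Some g \<Rightarrow> return_pmf g)
       (\<lambda>g. map_pmf (\<lambda>a. (a, g)) (pmf_of_set (walk (fst q) g)))"

lemma states_N': "states N' = S \<times> insert None (Some ` acts Q)" and init_N': "init N' = (init M, None)"
  by (simp_all add: product_mdp_def)

lemma En_N': "((s, m), (a, g)) \<in> En N' \<longleftrightarrow>
  (s, a) \<in> En M \<and> s \<in> S \<and> m \<in> insert None (Some ` acts Q) \<and> g \<in> acts Q"
  by (auto simp: En_def product_mdp_def)

lemma Pdist_N': "((s, m), (a, g)) \<in> En N' \<Longrightarrow>
  Pdist N' (s, m) (a, g) = map_spmf (\<lambda>t. (t, memo s a g)) (Pdist N s a)"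
  by (simp add: Pdist_def[of N'] En_N') (simp add: product_mdp_def)

lemma En_N: "c \<in> En N \<longleftrightarrow> c \<in> En M \<and> fst c \<in> S"
  using En_subsystem[OF S(1)] by auto

lemma set_Pdist_N: "(s, a) \<in> En N \<Longrightarrow> set_spmf (Pdist N s a) = set_spmf (Pdist M s a) \<inter> S"
  by (auto simp: En_N Pdist_subsystem[OF S(1)])

lemma spmf_N: "(s, a) \<in> En N \<Longrightarrow> spmf (Pdist N s a) t = of_bool (t \<in> S) * spmf (Pdist M s a) t"
  by (auto simp: En_N Pdist_subsystem[OF S(1)] spmf_restrict_spmf)

lemma spmf_N':
  assumes "((s, m), (a, g)) \<in> En N'"
  shows "spmf (Pdist N' (s, m) (a, g)) (t, m') = of_bool (m' = memo s a g \<and> t \<in> S) * spmf (Pdist M s a) t"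
proof -
  have sa: "(s, a) \<in> En N" using assms by (simp add: En_N' En_N)
  have "spmf (map_spmf (\<lambda>t. (t, memo s a g)) (Pdist N s a)) (t, m') =
      of_bool (m' = memo s a g) * spmf (Pdist N s a) t"
  proof (cases "m' = memo s a g")
    case True
    have "(\<lambda>t. (t, memo s a g)) -` {(t, memo s a g)} = {t}" by auto
    then show ?thesis unfolding spmf_map True by (simp add: spmf_conv_measure_spmf)
  next
    case False
    then have "(\<lambda>t. (t, memo s a g)) -` {(t, m')} = {}" by auto
    then show ?thesis using False by (simp add: spmf_map)
  qed
  then show ?thesis using sa by (simp add: Pdist_N'[OF assms] spmf_N)
qed

lemma finite_acts_Q: "finite (acts Q)"
  using is_sub_Q by (simp add: is_sub_mdp_def)

lemma acts_Q_nonempty: "acts Q \<noteq> {}"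
  by (auto simp: acts_Q)

lemma is_sub_N: "is_sub_mdp N"
  by (rule is_sub_mdp_subsystem[OF is_sub S(2,1)])

lemma is_sub_N': "is_sub_mdp N'"
  unfolding is_sub_mdp_def
proof (intro conjI ballI)
  show "finite (states N')" using finite_acts_Q finite_subset[OF S(1) fin_states] by (simp add: states_N')
  show "finite (acts N')" using finite_acts_Q fin_acts by (simp add: product_mdp_def)
  show "init N' \<in> states N'" using S by (simp add: states_N' init_N')
  show "case c of (q, b) \<Rightarrow> set_spmf (Pdist N' q b) \<subseteq> states N'" if "c \<in> En N'" for c
  proof -
    obtain s m a g where c: "c = ((s, m), (a, g))" by (metis surj_pair)
    have "memo s a g \<in> insert None (Some ` acts Q)" using that c by (auto simp: memo_def En_N')
    moreover have "(s, a) \<in> En N" using that c by (simp add: En_N' En_N)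
    ultimately show ?thesis using that c by (auto simp: Pdist_N' states_N' set_Pdist_N)
  qed
qed

lemma enabled_N': "(s, m) \<in> states N' \<Longrightarrow> enabled N' (s, m) = enabled M s \<times> acts Q"
  by (auto simp: enabled_def En_N' states_N')

lemma set_goal_sched:
  assumes "enabled M s \<noteq> {}"
  shows "(a, g) \<in> set_pmf (goal_sched h (s, m)) \<longleftrightarrow>
    a \<in> walk s g \<and> (case m of None \<Rightarrow> g \<in> set_pmf (pick_goal s) | Some g' \<Rightarrow> g = g')"
  using set_pmf_of_set[OF walk_nonempty[OF assms] finite_walk]
  by (auto simp: goal_sched_def split: option.splits)

lemma is_scheduler_goal: "is_scheduler N' goal_sched"
  unfolding is_scheduler_def
proof (intro allI ballI impI)
  fix h q assume q: "q \<in> states N'" "enabled N' q \<noteq> {}"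
  obtain s m where sm: "q = (s, m)" by (metis surj_pair)
  have en: "enabled M s \<noteq> {}" and s: "s \<in> S" "m \<in> insert None (Some ` acts Q)"
    using q enabled_N'[of s m] by (auto simp: sm states_N')
  show "set_pmf (goal_sched h q) \<subseteq> enabled N' q"
  proof
    fix b assume "b \<in> set_pmf (goal_sched h q)"
    then obtain a g where b: "b = (a, g)" "a \<in> walk s g" "case m of None \<Rightarrow> g \<in> set_pmf (pick_goal s) | Some g' \<Rightarrow> g = g'"
      using set_goal_sched[OF en] by (metis sm surj_pair)
    then have "g \<in> acts Q"
      using set_pick_goal(1)[OF _ en] s S by (auto split: option.splits)
    then show "b \<in> enabled N' q"
      using b walk_enabled enabled_N'[of s m] q(1) by (auto simp: sm)
  qed
qed

sublocale proj: mdp_projection N' goal_sched N fst fst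
proof unfold_locales
  show "is_sub_mdp N'" by (rule is_sub_N')
  show "is_scheduler N' goal_sched" by (rule is_scheduler_goal)
  show "is_sub_mdp N" by (rule is_sub_N)
  show "fst (init N') = init N" by (simp add: init_N')
  show "(fst q, fst b) \<in> En N" if "(q, b) \<in> En N'" for q b
    using that by (cases q; cases b) (simp add: En_N' En_N)
  show "map_spmf fst (Pdist N' q b) = Pdist N (fst q) (fst b)" if "(q, b) \<in> En N'" for q b
    using that by (cases q; cases b) (simp add: Pdist_N' spmf.map_comp o_def)
  show "enabled N (fst q) = {}" if "q \<in> states N'" "enabled N' q = {}" for q
    using that acts_Q_nonempty enabled_N'[of "fst q" "snd q"]
    by (auto simp: enabled_subsystem[OF S(1)])
qed

sublocale sub: subsystem_run M S proj.proj_sched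
  by unfold_locales (rule S(1))

section \<open>Pathwise behaviour of the goal scheduler\<close>

abbreviation "valid \<omega> \<equiv> \<forall>n. \<omega> n \<in> set_pmf (next_step N' goal_sched n \<omega>)"

lemma valid_En:
  assumes "valid \<omega>" "\<omega> n = Some ((s, m), (a, g))"
  shows "(s, a) \<in> En M" "s \<in> S" "s \<in> states M" "enabled M s \<noteq> {}" "g \<in> acts Q"
  using proj.run'.step_Some_En[OF assms(1)[rule_format] assms(2)] S
  by (auto simp: En_N' enabled_def)

lemma valid_walk:
  assumes ok: "valid \<omega>" and n: "\<omega> n = Some ((s, m), (a, g))"
  shows "a \<in> walk s g" "case m of None \<Rightarrow> g \<in> set_pmf (pick_goal s) | Some g' \<Rightarrow> g = g'"
proof -
  have "\<exists>h. (a, g) \<in> set_pmf (goal_sched h (s, m))"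
  proof (cases n)
    case 0
    then show ?thesis using proj.run'.step_0_Some(2)[of \<omega> "(s, m)" "(a, g)"] ok n by blast
  next
    case (Suc n')
    then show ?thesis using proj.run'.step_Suc_Some[of \<omega> n' "(s, m)" "(a, g)"] ok n by metis
  qed
  then show "a \<in> walk s g" "case m of None \<Rightarrow> g \<in> set_pmf (pick_goal s) | Some g' \<Rightarrow> g = g'"
    using set_goal_sched[OF valid_En(4)[OF ok n]] by auto
qed

lemma valid_0:
  assumes "valid \<omega>" "\<omega> 0 = Some ((s, m), b)"
  shows "s = init M \<and> m = None"
  using proj.run'.step_0_Some(1)[OF assms(1)[rule_format] assms(2)] by (simp add: init_N')

lemma valid_Suc:
  assumes ok: "valid \<omega>" and n: "\<omega> (Suc n) = Some ((t, m'), b)"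
  obtains s m a g where "\<omega> n = Some ((s, m), (a, g))" "t \<in> set_spmf (Pdist M s a)" "m' = memo s a g"
proof -
  obtain q c where c: "\<omega> n = Some (q, c)" "(t, m') \<in> set_spmf (Pdist N' q c)"
    using proj.run'.step_Suc_Some[OF ok[rule_format] n] by metis
  obtain s m a g where q: "q = (s, m)" "c = (a, g)" by (metis surj_pair)
  have En: "((s, m), (a, g)) \<in> En N'"
    using proj.run'.step_Some_En[OF ok[rule_format] c(1)] q by simp
  then have "(t, m') \<in> (\<lambda>t. (t, memo s a g)) ` set_spmf (Pdist N s a)"
    using c(2) q by (simp add: Pdist_N')
  moreover have "(s, a) \<in> En N" using En by (simp add: En_N' En_N)
  ultimately show thesis using that c(1) q by (auto simp: set_Pdist_N)
qed

lemma stay_in_class: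
  assumes "(s, a) \<in> En M" "(s, a) \<notin> exits M" "t \<in> set_spmf (Pdist M s a)"
  shows "cls M t = cls M s"
  using assms cls_eq[OF cls_in[OF En_states[OF assms(1)]]] by (auto simp: exits_def)

text \<open>Memory survives only steps that stay in the class, so following it backwards ends at a
  step in the same class where the goal was drawn.\<close>

lemma valid_origin:
  assumes ok: "valid \<omega>"
  shows "\<omega> n = Some ((s, m), (a, g)) \<Longrightarrow>
    \<exists>n' s' a'. \<omega> n' = Some ((s', None), (a', g)) \<and> cls M s' = cls M s \<and> s' \<in> S"
proof (induction n arbitrary: s m a)
  case 0
  then show ?case using valid_0[OF ok 0] S(2) by blast
next
  case (Suc n)
  show ?case
  proof (cases m)
    case None
    then show ?thesis using Suc.prems valid_En(2)[OF ok Suc.prems] by blast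
  next
    case (Some g')
    obtain s0 m0 a0 g0 where p: "\<omega> n = Some ((s0, m0), (a0, g0))" "s \<in> set_spmf (Pdist M s0 a0)" "m = memo s0 a0 g0"
      by (rule valid_Suc[OF ok Suc.prems])
    have "(s0, a0) \<notin> exits M" "g0 = g'" using p(3) Some by (auto simp: memo_def split: if_splits)
    moreover have "g = g'" using valid_walk(2)[OF ok Suc.prems] Some by simp
    moreover have "cls M s = cls M s0"
      using stay_in_class[OF valid_En(1)[OF ok p(1)] _ p(2)] calculation by blast
    ultimately show ?thesis using Suc.IH[of s0 m0 a0] p(1) by simp
  qed
qed

lemma valid_goal:
  assumes ok: "valid \<omega>" and n: "\<omega> n = Some ((s, m), (a, g))" and X: "cls M s \<in> X"
  shows "g \<in> enabled Q (Cls (cls M s))"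
proof -
  obtain n' s' a' where og: "\<omega> n' = Some ((s', None), (a', g))" "cls M s' = cls M s" "s' \<in> S"
    using valid_origin[OF ok n] by blast
  then have "g \<in> set_pmf (pick_goal s')" using valid_walk(2)[OF ok og(1)] by simp
  then show ?thesis
    using set_pick_goal(2)[OF valid_En(3,4)[OF ok og(1)]] X og(2) by auto
qed

lemma valid_exit:
  assumes ok: "valid \<omega>" and n: "\<omega> n = Some ((s, m), (a, g))" and e: "(s, a) \<in> exits M"
  shows "cls M s \<in> X" "g = Orig a"
proof -
  note v = valid_walk(1)[OF ok n] valid_En[OF ok n]
  show X: "cls M s \<in> X" using walk_exit_partial[OF v(3) _ v(1)] e by blast
  show "g = Orig a" by (rule walk_exit_goal[OF v(3) X valid_goal[OF ok n X] v(1) e])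
qed

section \<open>Expected entries, drawn goals and exits\<close>

abbreviation "occ \<equiv> proj.run'.occ"
abbreviation "vis \<equiv> proj.run'.vis"
abbreviation "prb \<equiv> \<lambda>B. measure proj.run'.\<mu> {\<omega> \<in> space proj.run'.\<mu>. B \<omega>}"

definition pair_of :: "('s \<times> 'a qact option) \<times> ('a \<times> 'a qact) \<Rightarrow> 's \<times> 'a" where
  "pair_of c = (fst (fst c), fst (snd c))"

definition fresh :: "nat \<Rightarrow> 's set \<Rightarrow> real" where
  "fresh n D = (\<Sum>s\<in>D. vis n (s, None))"

text \<open>Life of a goal \<open>g\<close> in \<open>D\<close>: it is \<open>picked\<close> while
  the memory is empty, \<open>held\<close> as long as it is in force, \<open>kept\<close> once it
  sits in the memory, and \<open>executed\<close> when an exit is taken.\<close>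

definition picked :: "'s set \<Rightarrow> 'a qact \<Rightarrow> (('s \<times> 'a qact option) \<times> ('a \<times> 'a qact)) set" where
  "picked D g = (\<lambda>(s, a). ((s, None), (a, g))) ` (D \<times> acts M)"

definition held :: "'s set \<Rightarrow> 'a qact \<Rightarrow> (('s \<times> 'a qact option) \<times> ('a \<times> 'a qact)) option set" where
  "held D g = {u. \<exists>s m a. u = Some ((s, m), (a, g)) \<and> s \<in> D}"

definition kept :: "'s set \<Rightarrow> 'a qact \<Rightarrow> (('s \<times> 'a qact option) \<times> ('a \<times> 'a qact)) option set" where
  "kept D g = {u. \<exists>s a. u = Some ((s, Some g), (a, g)) \<and> s \<in> D}"

definition executed :: "'s set \<Rightarrow> 'a qact \<Rightarrow> (('s \<times> 'a qact option) \<times> ('a \<times> 'a qact)) option set" where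
  "executed D g = {u. \<exists>s m a. u = Some ((s, m), (a, g)) \<and> s \<in> D \<and> (s, a) \<in> exits M}"

lemma finite_class: "D \<in> X \<Longrightarrow> finite D"
  using finite_subset[OF D_MEC_subset fin_states] X_D_MEC by blast

lemma finite_picked: "D \<in> X \<Longrightarrow> finite (picked D g)"
  using finite_class fin_acts by (simp add: picked_def)

lemma sum_picked_le:
  assumes D: "D \<in> X"
  shows "(\<Sum>c\<in>picked D g. occ n c) \<le> fresh n D * pmf (flow_choice y z D) g"
proof -
  have "(\<Sum>c\<in>picked D g. occ n c) = (\<Sum>s\<in>D. \<Sum>a\<in>acts M. occ n ((s, None), (a, g)))"
    unfolding picked_def by (subst sum.reindex) (auto simp: inj_on_def sum.cartesian_product split_beta)
  also have "\<dots> \<le> (\<Sum>s\<in>D. vis n (s, None) * pmf (flow_choice y z D) g)"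
  proof (rule sum_mono)
    fix s assume s: "s \<in> D"
    let ?\<rho> = "goal_sched [] (s, None)"
    have "occ n ((s, None), (a, g)) = vis n (s, None) * pmf ?\<rho> (a, g)" for a
      by (rule proj.run'.occ_memoryless) (simp add: goal_sched_def)
    then have "(\<Sum>a\<in>acts M. occ n ((s, None), (a, g))) = vis n (s, None) * (\<Sum>a\<in>acts M. pmf ?\<rho> (a, g))"
      by (simp add: sum_distrib_left)
    also have "(\<Sum>a\<in>acts M. pmf ?\<rho> (a, g)) = measure_pmf.prob ?\<rho> ((\<lambda>a. (a, g)) ` acts M)"
      using fin_acts by (subst measure_measure_pmf_finite) (auto simp: sum.reindex inj_on_def)
    also have "\<dots> \<le> measure_pmf.prob ?\<rho> (snd -` {g})"
      by (intro measure_pmf.finite_measure_mono) auto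
    also have "\<dots> = pmf (map_pmf snd ?\<rho>) g" by (simp add: pmf_map)
    also have "map_pmf snd ?\<rho> = pick_goal s"
      by (simp add: goal_sched_def map_bind_pmf pmf.map_comp o_def bind_return_pmf')
    also have "pick_goal s = flow_choice y z D"
      using cls_eq[OF X_D_MEC[OF D] s] D by (simp add: pick_goal_def)
    finally show "(\<Sum>a\<in>acts M. occ n ((s, None), (a, g))) \<le> vis n (s, None) * pmf (flow_choice y z D) g"
      by (simp add: mult_left_mono)
  qed
  also have "\<dots> = fresh n D * pmf (flow_choice y z D) g"
    by (simp add: fresh_def sum_distrib_right)
  finally show ?thesis .
qed

lemma prob_held:
  assumes D: "D \<in> X"
  shows "prb (\<lambda>\<omega>. \<omega> n \<in> held D g) \<le> (\<Sum>c\<in>picked D g. occ n c) + prb (\<lambda>\<omega>. \<omega> n \<in> kept D g)"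
proof -
  have "prb (\<lambda>\<omega>. \<omega> n \<in> held D g) \<le> prb (\<lambda>\<omega>. \<omega> n \<in> Some ` picked D g \<or> \<omega> n \<in> kept D g)"
  proof (rule proj.run'.path.finite_measure_mono_AE)
    show "AE \<omega> in proj.run'.\<mu>. \<omega> \<in> {\<omega> \<in> space proj.run'.\<mu>. \<omega> n \<in> held D g} \<longrightarrow>
        \<omega> \<in> {\<omega> \<in> space proj.run'.\<mu>. \<omega> n \<in> Some ` picked D g \<or> \<omega> n \<in> kept D g}"
      using proj.run'.AE_next_step
    proof eventually_elim
      case (elim \<omega>)
      have "\<omega> n \<in> Some ` picked D g \<or> \<omega> n \<in> kept D g" if "\<omega> n \<in> held D g"
      proof -
        from that obtain s m a where u: "\<omega> n = Some ((s, m), (a, g))" "s \<in> D" by (auto simp: held_def)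
        show ?thesis
        proof (cases m)
          case None
          have "a \<in> acts M" using valid_En(1)[OF elim u(1)] by (simp add: En_def)
          then show ?thesis using u None by (auto simp: picked_def)
        next
          case (Some g')
          then show ?thesis using u valid_walk(2)[OF elim u(1)] by (auto simp: kept_def)
        qed
      qed
      then show ?case by blast
    qed
  qed measurable
  also have "\<dots> \<le> prb (\<lambda>\<omega>. \<omega> n \<in> Some ` picked D g) + prb (\<lambda>\<omega>. \<omega> n \<in> kept D g)"
  proof -
    have "{\<omega> \<in> space proj.run'.\<mu>. \<omega> n \<in> Some ` picked D g \<or> \<omega> n \<in> kept D g} =
        {\<omega> \<in> space proj.run'.\<mu>. \<omega> n \<in> Some ` picked D g} \<union> {\<omega> \<in> space proj.run'.\<mu>. \<omega> n \<in> kept D g}" by blast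
    moreover have "measure proj.run'.\<mu> ({\<omega> \<in> space proj.run'.\<mu>. \<omega> n \<in> Some ` picked D g} \<union>
        {\<omega> \<in> space proj.run'.\<mu>. \<omega> n \<in> kept D g}) \<le>
        prb (\<lambda>\<omega>. \<omega> n \<in> Some ` picked D g) + prb (\<lambda>\<omega>. \<omega> n \<in> kept D g)"
      by (rule measure_Un_le) measurable
    ultimately show ?thesis by simp
  qed
  also have "\<dots> \<le> (\<Sum>c\<in>picked D g. occ n c) + prb (\<lambda>\<omega>. \<omega> n \<in> kept D g)"
    using proj.run'.prob_outcome_le_sum[OF finite_picked[OF D], of n g] by simp
  finally show ?thesis .
qed

text \<open>A goal found in the memory at the next step was held and not executed at this one, so
  the two events are disjoint parts of holding it now.\<close>

lemma prob_kept_Suc: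
  assumes D: "D \<in> X"
  shows "prb (\<lambda>\<omega>. \<omega> (Suc n) \<in> kept D g) + prb (\<lambda>\<omega>. \<omega> n \<in> executed D g) \<le> prb (\<lambda>\<omega>. \<omega> n \<in> held D g)"
proof -
  let ?K = "{\<omega> \<in> space proj.run'.\<mu>. \<omega> (Suc n) \<in> kept D g \<and> \<omega> n \<notin> executed D g}"
  let ?E = "{\<omega> \<in> space proj.run'.\<mu>. \<omega> n \<in> executed D g}"
  have key: "AE \<omega> in proj.run'.\<mu>. \<omega> (Suc n) \<in> kept D g \<longrightarrow> \<omega> n \<in> held D g \<and> \<omega> n \<notin> executed D g"
    using proj.run'.AE_next_step
  proof eventually_elim
    case (elim \<omega>)
    show ?case
    proof
      assume "\<omega> (Suc n) \<in> kept D g"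
      then obtain t b where t: "\<omega> (Suc n) = Some ((t, Some g), (b, g))" "t \<in> D" by (auto simp: kept_def)
      obtain s m a g' where s: "\<omega> n = Some ((s, m), (a, g'))" "t \<in> set_spmf (Pdist M s a)" "Some g = memo s a g'"
        by (rule valid_Suc[OF elim t(1)])
      have ne: "(s, a) \<notin> exits M" "g' = g" using s(3) by (auto simp: memo_def split: if_splits)
      then have "cls M t = cls M s" using stay_in_class[OF valid_En(1)[OF elim s(1)] _ s(2)] by blast
      then have "s \<in> D"
        using cls_eq[OF X_D_MEC[OF D] t(2)] in_cls[OF valid_En(3)[OF elim s(1)]] by simp
      then show "\<omega> n \<in> held D g \<and> \<omega> n \<notin> executed D g"
        using s ne by (auto simp: held_def executed_def)
    qed
  qed
  have K: "prb (\<lambda>\<omega>. \<omega> (Suc n) \<in> kept D g) = measure proj.run'.\<mu> ?K"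
    by (rule proj.run'.prb_cong_AE) (use key in \<open>auto elim: eventually_mono\<close>)
  have "measure proj.run'.\<mu> ?K + measure proj.run'.\<mu> ?E = measure proj.run'.\<mu> (?K \<union> ?E)"
    by (rule proj.run'.path.finite_measure_Union[symmetric]) auto
  also have "\<dots> \<le> prb (\<lambda>\<omega>. \<omega> n \<in> held D g)"
  proof (rule proj.run'.path.finite_measure_mono_AE)
    show "AE \<omega> in proj.run'.\<mu>. \<omega> \<in> ?K \<union> ?E \<longrightarrow> \<omega> \<in> {\<omega> \<in> space proj.run'.\<mu>. \<omega> n \<in> held D g}"
      using key by eventually_elim (auto simp: executed_def held_def)
  qed measurable
  finally show ?thesis unfolding K .
qed

text \<open>Each picked goal is executed at most once, since executing an exit erases the memory.\<close>

lemma executed_le_picked: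
  assumes D: "D \<in> X"
  shows "(\<Sum>n<m. prb (\<lambda>\<omega>. \<omega> n \<in> executed D g)) \<le> (\<Sum>n<m. \<Sum>c\<in>picked D g. occ n c)"
proof -
  \<comment> \<open>Goals in the memory are those drawn and not yet executed; adding them makes the
    claim inductive.\<close>
  have "(\<Sum>n<m. prb (\<lambda>\<omega>. \<omega> n \<in> executed D g)) + prb (\<lambda>\<omega>. \<omega> m \<in> kept D g) \<le>
      (\<Sum>n<m. \<Sum>c\<in>picked D g. occ n c)"
  proof (induction m)
    case 0
    have "prb (\<lambda>\<omega>. \<omega> 0 \<in> kept D g) = 0"
    proof (rule proj.run'.prb_eq_0)
      show "AE \<omega> in proj.run'.\<mu>. \<omega> 0 \<notin> kept D g"
        using proj.run'.AE_next_step by eventually_elim (auto simp: kept_def dest: valid_0)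
    qed
    then show ?case by simp
  next
    case (Suc m)
    then show ?case using prob_kept_Suc[OF D, of m g] prob_held[OF D, of m g] by simp
  qed
  then show ?thesis
    using measure_nonneg[of proj.run'.\<mu> "{\<omega> \<in> space proj.run'.\<mu>. \<omega> m \<in> kept D g}"] by linarith
qed

definition exit_prob :: "nat \<Rightarrow> 's \<times> 'a \<Rightarrow> real" where
  "exit_prob n e = (\<Sum>c | c \<in> En N' \<and> pair_of c = e. occ n c)"

lemma exit_prob_eq: "exit_prob n e = prb (\<lambda>\<omega>. \<exists>c\<in>{c \<in> En N'. pair_of c = e}. \<omega> n = Some c)"
  unfolding exit_prob_def proj.run'.occ_def
  by (rule proj.run'.prb_finite_Union[symmetric]) (use proj.run'.finite_En in auto)

lemma exit_prob_partial: "e \<in> exits M \<Longrightarrow> cls M (fst e) \<notin> X \<Longrightarrow> exit_prob n e = 0"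
proof -
  assume e: "e \<in> exits M" "cls M (fst e) \<notin> X"
  show ?thesis
    unfolding exit_prob_eq
  proof (rule proj.run'.prb_eq_0)
    show "AE \<omega> in proj.run'.\<mu>. \<not> (\<exists>c\<in>{c \<in> En N'. pair_of c = e}. \<omega> n = Some c)"
      using proj.run'.AE_next_step
    proof eventually_elim
      case (elim \<omega>)
      show ?case
      proof
        assume "\<exists>c\<in>{c \<in> En N'. pair_of c = e}. \<omega> n = Some c"
        then obtain m g where "\<omega> n = Some ((fst e, m), (snd e, g))" by (auto simp: pair_of_def)
        from valid_exit(1)[OF elim this] e show False by simp
      qed
    qed
  qed
qed

lemma exit_prob_le:
  assumes e: "e \<in> exits M" "cls M (fst e) \<in> X"
  shows "exit_prob n e \<le> prb (\<lambda>\<omega>. \<omega> n \<in> executed (cls M (fst e)) (Orig (snd e)))"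
  unfolding exit_prob_eq
proof (rule proj.run'.path.finite_measure_mono_AE)
  show "AE \<omega> in proj.run'.\<mu>. \<omega> \<in> {\<omega> \<in> space proj.run'.\<mu>. \<exists>c\<in>{c \<in> En N'. pair_of c = e}. \<omega> n = Some c} \<longrightarrow>
      \<omega> \<in> {\<omega> \<in> space proj.run'.\<mu>. \<omega> n \<in> executed (cls M (fst e)) (Orig (snd e))}"
    using proj.run'.AE_next_step
  proof eventually_elim
    case (elim \<omega>)
    have "\<omega> n \<in> executed (cls M (fst e)) (Orig (snd e))" if c: "\<exists>c\<in>{c \<in> En N'. pair_of c = e}. \<omega> n = Some c"
    proof -
      from c obtain m g where u: "\<omega> n = Some ((fst e, m), (snd e, g))" by (auto simp: pair_of_def)
      have "g = Orig (snd e)" using valid_exit(2)[OF elim u] e by simp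
      then show ?thesis using u e in_cls[OF exits_states[OF e(1)]] by (auto simp: executed_def)
    qed
    then show ?case by blast
  qed
qed measurable

lemma fresh_0: "D \<in> X \<Longrightarrow> fresh 0 D \<le> of_bool (init M \<in> D)"
proof -
  assume D: "D \<in> X"
  have "fresh 0 D \<le> (\<Sum>s\<in>D. of_bool (s = init M))"
    unfolding fresh_def by (intro sum_mono) (simp add: proj.run'.vis_0 init_N')
  also have "\<dots> = of_bool (init M \<in> D)" using finite_class[OF D] by (simp add: of_bool_def)
  finally show ?thesis .
qed

lemma fresh_Suc:
  assumes D: "D \<in> X"
  shows "fresh (Suc n) D \<le> (\<Sum>e\<in>exits M. exit_prob n e * measure (measure_spmf (Pdist M (fst e) (snd e))) D)"
proof -
  let ?p = "\<lambda>e. measure (measure_spmf (Pdist M (fst e) (snd e))) D"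
  let ?h = "\<lambda>e. of_bool (e \<in> exits M) * ?p e"
  have "fresh (Suc n) D \<le> (\<Sum>s\<in>D. \<Sum>c\<in>En N'. occ n c * spmf (Pdist N' (fst c) (snd c)) (s, None))"
    unfolding fresh_def proj.run'.vis_Suc by (intro sum_mono) (auto intro: sum_nonneg)
  also have "\<dots> = (\<Sum>c\<in>En N'. occ n c * (\<Sum>s\<in>D. spmf (Pdist N' (fst c) (snd c)) (s, None)))"
    by (subst sum.swap) (simp add: sum_distrib_left)
  also have "\<dots> \<le> (\<Sum>c\<in>En N'. occ n c * ?h (pair_of c))"
  proof (intro sum_mono mult_left_mono)
    fix c assume c: "c \<in> En N'"
    obtain s m a g where [simp]: "c = ((s, m), (a, g))" by (metis surj_pair)
    have "(\<Sum>t\<in>D. spmf (Pdist N' (fst c) (snd c)) (t, None)) \<le> (\<Sum>t\<in>D. of_bool ((s, a) \<in> exits M) * spmf (Pdist M s a) t)"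
      using c by (intro sum_mono) (simp add: spmf_N' memo_def)
    also have "\<dots> = ?h (pair_of c)"
      by (simp add: sum_distrib_left[symmetric] sum_spmf_eq_measure finite_class[OF D] pair_of_def)
    finally show "(\<Sum>t\<in>D. spmf (Pdist N' (fst c) (snd c)) (t, None)) \<le> ?h (pair_of c)" .
  qed simp
  also have "\<dots> = (\<Sum>e\<in>En M. \<Sum>c | c \<in> En N' \<and> pair_of c = e. occ n c * ?h (pair_of c))"
    by (rule sum.group[symmetric]) (auto simp: proj.run'.finite_En fin_En pair_of_def En_N')
  also have "\<dots> = (\<Sum>e\<in>En M. exit_prob n e * ?h e)"
    unfolding exit_prob_def sum_distrib_right by (intro sum.cong) auto
  also have "\<dots> = (\<Sum>e\<in>exits M. exit_prob n e * ?p e)"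
    using exits_En by (intro sum.mono_neutral_cong_right fin_En) auto
  finally show ?thesis .
qed

text \<open>The iteration of the quotient again, with entries in place of visits: entries bound
  drawn goals, these bound executed exits, and exits bound the entries one step later.\<close>

lemma fresh_le_inflow: "D \<in> X \<Longrightarrow> (\<Sum>n<m. fresh n D) \<le> inflow M y D"
proof (induction m arbitrary: D)
  case 0
  then show ?case using inflow_nonneg[OF flow_X] by simp
next
  case (Suc m)
  let ?p = "\<lambda>e. measure (measure_spmf (Pdist M (fst e) (snd e))) D"
  have "(\<Sum>n<Suc m. fresh n D) = fresh 0 D + (\<Sum>n<m. fresh (Suc n) D)"
    by (rule sum.lessThan_Suc_shift)
  also have "\<dots> \<le> of_bool (init M \<in> D) + (\<Sum>n<m. \<Sum>e\<in>exits M. exit_prob n e * ?p e)"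
    by (intro add_mono sum_mono fresh_0 fresh_Suc Suc.prems)
  also have "(\<Sum>n<m. \<Sum>e\<in>exits M. exit_prob n e * ?p e) = (\<Sum>e\<in>exits M. (\<Sum>n<m. exit_prob n e) * ?p e)"
    by (subst sum.swap) (simp add: sum_distrib_right)
  also have "\<dots> \<le> (\<Sum>e\<in>exits M. y e * ?p e)"
  proof (intro sum_mono mult_right_mono)
    fix e assume e: "e \<in> exits M"
    let ?D = "cls M (fst e)"
    show "(\<Sum>n<m. exit_prob n e) \<le> y e"
    proof (cases "?D \<in> X")
      case True
      have en: "Orig (snd e) \<in> enabled Q (Cls ?D)"
        using e in_cls[OF exits_states[OF e]] by (auto simp: enabled_Q_Cls[OF X_D_MEC[OF True]])
      have "(\<Sum>n<m. exit_prob n e) \<le> (\<Sum>n<m. prb (\<lambda>\<omega>. \<omega> n \<in> executed ?D (Orig (snd e))))"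
        by (intro sum_mono exit_prob_le e True)
      also have "\<dots> \<le> (\<Sum>n<m. \<Sum>c\<in>picked ?D (Orig (snd e)). occ n c)"
        by (rule executed_le_picked[OF True])
      also have "\<dots> \<le> (\<Sum>n<m. fresh n ?D * pmf (flow_choice y z ?D) (Orig (snd e)))"
        by (intro sum_mono sum_picked_le True)
      also have "\<dots> = (\<Sum>n<m. fresh n ?D) * pmf (flow_choice y z ?D) (Orig (snd e))"
        by (simp add: sum_distrib_right)
      also have "\<dots> \<le> inflow M y ?D * pmf (flow_choice y z ?D) (Orig (snd e))"
        by (intro mult_right_mono Suc.IH True) simp
      also have "\<dots> = weight y z ?D (Orig (snd e))"
        by (rule flow_choice(2)[OF flow_X True X_D_MEC[OF True] exit_live[OF e] en])
      also have "\<dots> = y e"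
        by (rule weight_Orig[OF e in_cls[OF exits_states[OF e]]])
      finally show ?thesis .
    next
      case False
      then show ?thesis using exit_prob_partial[OF e False] flow_nonneg(1)[OF flow_X] by simp
    qed
  qed simp
  also have "\<dots> \<le> (\<Sum>c\<in>En M. y c * ?p c)"
    using exits_En flow_nonneg(1)[OF flow_X] by (intro sum_mono2 fin_En) auto
  finally show ?case by (simp add: inflow_def)
qed

text \<open>The expected number of draws of \<open>Tau I\<close> is at most the inflow times its
  probability in \<open>flow_choice\<close>, and this product is \<open>z D I\<close>.\<close>

lemma prob_settle_le:
  assumes D: "D \<in> X" "(D, I) \<in> I_star M k P"
  shows "prb (\<lambda>\<omega>. \<exists>n. \<omega> n \<in> Some ` picked D (Tau I)) \<le> z D I"
proof (rule proj.run'.prob_Ex_outcome_le[OF finite_picked[OF D(1)]])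
  fix m
  have en: "Tau I \<in> enabled Q (Cls D)"
    using D by (auto simp: enabled_Q_Cls[OF X_D_MEC[OF D(1)]])
  have "(\<Sum>n<m. \<Sum>c\<in>picked D (Tau I). occ n c) \<le> (\<Sum>n<m. fresh n D * pmf (flow_choice y z D) (Tau I))"
    by (intro sum_mono sum_picked_le D)
  also have "\<dots> = (\<Sum>n<m. fresh n D) * pmf (flow_choice y z D) (Tau I)"
    by (simp add: sum_distrib_right)
  also have "\<dots> \<le> inflow M y D * pmf (flow_choice y z D) (Tau I)"
    by (intro mult_right_mono fresh_le_inflow D) simp
  also have "\<dots> = weight y z D (Tau I)"
    by (rule flow_choice(2)[OF flow_X D(1) X_D_MEC[OF D(1)] I_star_live[OF D(2)] en])
  finally show "(\<Sum>n<m. \<Sum>c\<in>picked D (Tau I). occ n c) \<le> z D I" by simp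
qed

section \<open>Recurrence in the product\<close>

lemma AE_finitely_many_exits:
  "AE \<omega> in proj.run'.\<mu>. \<not> (\<exists>\<^sub>\<infinity>n. \<omega> n \<in> Some ` {c \<in> En N'. pair_of c \<in> exits M})"
proof -
  obtain f :: "'s \<Rightarrow> real" where f: "\<And>s. s \<in> states M \<Longrightarrow> 0 \<le> f s"
    "\<And>s a. (s, a) \<in> En M \<Longrightarrow>
      (\<Sum>t\<in>states M. spmf (Pdist M s a) t * f t) + of_bool ((s, a) \<in> exits M) \<le> f s"
    by (rule ranking_function) blast
  let ?Y = "{c. pair_of c \<in> exits M}"
  have "(\<Sum>n<m. \<Sum>c\<in>En N' \<inter> ?Y. occ n c) \<le> f (fst (init N'))" for m
  proof (rule proj.run'.ranking_bound)
    show "0 \<le> f (fst q)" if "q \<in> states N'" for q using f(1) that S by (auto simp: states_N')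
    fix q b assume qb: "(q, b) \<in> En N'"
    obtain s m a g where q: "q = (s, m)" "b = (a, g)" by (metis surj_pair)
    have sa: "(s, a) \<in> En M" "s \<in> S" "g \<in> acts Q" using qb by (auto simp: q En_N')
    let ?Mem = "insert None (Some ` acts Q)"
    have mem: "memo s a g \<in> ?Mem" using sa by (auto simp: memo_def)
    have finM: "finite ?Mem" using finite_acts_Q by simp
    have "(\<Sum>q'\<in>states N'. spmf (Pdist N' q b) q' * f (fst q')) =
        (\<Sum>t\<in>S. \<Sum>m'\<in>?Mem. spmf (Pdist N' q b) (t, m') * f t)"
      by (simp add: states_N' sum.cartesian_product split_beta)
    also have "\<dots> = (\<Sum>t\<in>S. \<Sum>m'\<in>?Mem. if m' = memo s a g then spmf (Pdist M s a) t * f t else 0)"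
      using qb by (intro sum.cong refl) (auto simp: q spmf_N')
    also have "\<dots> = (\<Sum>t\<in>S. spmf (Pdist M s a) t * f t)"
      by (simp only: sum.delta[OF finM] mem if_True)
    also have "\<dots> \<le> (\<Sum>t\<in>states M. spmf (Pdist M s a) t * f t)"
      using S f(1) by (intro sum_mono2 fin_states) auto
    finally show "(\<Sum>q'\<in>states N'. spmf (Pdist N' q b) q' * f (fst q')) + of_bool ((q, b) \<in> ?Y) \<le> f (fst q)"
      using f(2)[OF sa(1)] by (simp add: q pair_of_def)
  qed
  then have "AE \<omega> in proj.run'.\<mu>. \<not> (\<exists>\<^sub>\<infinity>n. \<omega> n \<in> Some ` (En N' \<inter> ?Y))"
    using proj.run'.finite_En by (intro proj.run'.AE_finitely_often_outcome[of _ "f (fst (init N'))"]) auto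
  then show ?thesis by (simp add: Int_def)
qed

text \<open>Recurrence or loss is known for runs of the subsystem; it pulls back because the
  projected run has exactly their law.\<close>

lemma AE_successors_visited:
  "AE \<omega> in proj.run'.\<mu>. \<forall>s a t. (\<exists>\<^sub>\<infinity>n. proj.proj (\<omega> n) = Some (s, a)) \<longrightarrow> t \<in> set_spmf (Pdist M s a) \<longrightarrow>
     (\<exists>\<^sub>\<infinity>n. proj.proj (\<omega> n) = None \<or> map_option fst (proj.proj (\<omega> n)) = Some t)"
proof -
  have "AE \<omega> in distr proj.run'.\<mu> (PiM UNIV (\<lambda>_. count_space (outcomes N))) (\<lambda>\<omega> n. proj.proj (\<omega> n)).
    \<forall>s a t. (s, a) \<in> proj.run.inf_pairs \<omega> \<longrightarrow> t \<in> set_spmf (Pdist M s a) \<longrightarrow>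
     (\<exists>\<^sub>\<infinity>n. \<omega> n = None \<or> map_option fst (\<omega> n) = Some t)"
    using sub.AE_successors unfolding proj.path_measure_proj proj.image_def .
  from AE_distrD[OF proj.measurable_proj this] show ?thesis
    by (simp only: proj.run.inf_pairs_def mem_Collect_eq)
qed

text \<open>Without dependence on the history, a possible continuation has the same positive
  probability after each occurrence of the pair, so conditional Borel-Cantelli applies. The empty
  history stands for any history.\<close>

lemma AE_continued:
  "AE \<omega> in proj.run'.\<mu>. \<forall>s m a g t b g'. ((s, m), (a, g)) \<in> proj.run'.inf_pairs \<omega> \<longrightarrow>
     ((t, memo s a g), (b, g')) \<in> En N' \<longrightarrow> t \<in> set_spmf (Pdist M s a) \<longrightarrow>
     (b, g') \<in> set_pmf (goal_sched [] (t, memo s a g)) \<longrightarrow>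
     ((t, memo s a g), (b, g')) \<in> proj.run'.inf_pairs \<omega>"
proof -
  let ?ok = "\<lambda>c e. fst (fst e) \<in> set_spmf (Pdist M (fst (fst c)) (fst (snd c))) \<and>
    snd (fst e) = memo (fst (fst c)) (fst (snd c)) (snd (snd c)) \<and> snd e \<in> set_pmf (goal_sched [] (fst e))"
  have "AE \<omega> in proj.run'.\<mu>. \<forall>c\<in>En N'. \<forall>e\<in>En N'. ?ok c e \<longrightarrow>
     c \<in> proj.run'.inf_pairs \<omega> \<longrightarrow> e \<in> proj.run'.inf_pairs \<omega>"
  proof (intro AE_finite_allI proj.run'.finite_En)
    fix c e assume ce: "c \<in> En N'" "e \<in> En N'"
    obtain s m a g where c: "c = ((s, m), (a, g))" by (metis surj_pair)
    obtain t m' b g' where e: "e = ((t, m'), (b, g'))" by (metis surj_pair)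
    show "AE \<omega> in proj.run'.\<mu>. ?ok c e \<longrightarrow> c \<in> proj.run'.inf_pairs \<omega> \<longrightarrow> e \<in> proj.run'.inf_pairs \<omega>"
    proof (cases "?ok c e")
      case True
      let ?p = "spmf (Pdist M s a) t * pmf (goal_sched [] (t, m')) (b, g')"
      have "AE \<omega> in proj.run'.\<mu>. (\<exists>\<^sub>\<infinity>n. \<omega> n = Some c) \<longrightarrow> (\<exists>\<^sub>\<infinity>n. \<omega> n \<in> {Some e})"
      proof (rule proj.run'.AE_infinitely_often_step)
        show "0 < ?p" using True by (auto simp: c e in_set_spmf pmf_positive)
        fix n and \<omega> :: "nat \<Rightarrow> (('s \<times> 'a qact option) \<times> ('a \<times> 'a qact)) option" assume "\<omega> n = Some c"
        then have n: "\<omega> n = Some ((s, m), (a, g))" by (simp add: c)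
        have en: "enabled N' (t, m') \<noteq> {}" using ce(2) by (auto simp: e enabled_def)
        have "t \<in> S" using ce(2) by (simp add: e En_N')
        then have "spmf (Pdist N' (s, m) (a, g)) (t, m') = spmf (Pdist M s a) t"
          using True ce(1) by (simp add: c e spmf_N')
        then have "spmf (next_step N' goal_sched (Suc n) \<omega>) e = ?p"
          unfolding e using proj.run'.spmf_next_step_Suc[of \<omega> n, OF n, of "(t, m')" "(b, g')"] en
          by (simp add: goal_sched_def del: upt_Suc)
        then show "?p \<le> measure_pmf.prob (next_step N' goal_sched (Suc n) \<omega>) {Some e}"
          by (simp add: measure_pmf_single)
      qed
      then show ?thesis unfolding proj.run'.inf_pairs_def by eventually_elim simp
    qed auto
  qed
  then show ?thesis
    using proj.run'.AE_En
  proof eventually_elim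
    case (elim \<omega>)
    show ?case
    proof (intro allI impI)
      fix s m a g t b g'
      assume *: "((s, m), (a, g)) \<in> proj.run'.inf_pairs \<omega>" "((t, memo s a g), (b, g')) \<in> En N'"
        "t \<in> set_spmf (Pdist M s a)" "(b, g') \<in> set_pmf (goal_sched [] (t, memo s a g))"
      then obtain n where "\<omega> n = Some ((s, m), (a, g))"
        unfolding proj.run'.inf_pairs_def by (auto dest: frequently_ex)
      then have "((s, m), (a, g)) \<in> En N'" using elim(2)[rule_format, of n] by auto
      then show "((t, memo s a g), (b, g')) \<in> proj.run'.inf_pairs \<omega>"
        using elim(1)[rule_format, of "((s, m), (a, g))" "((t, memo s a g), (b, g'))"] * by simp
    qed
  qed
qed

text \<open>From some time on only pairs that recur forever are seen, so there are no exits, and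
  class and goal stay constant. The walk recurs on a set of states closed under its own steps;
  strong connectivity then rules out a cut class and an exit as goal, and makes the run fill the
  target of a goal \<open>Tau I\<close>.\<close>

lemma settles:
  assumes ok: "valid \<omega>" and some: "\<forall>n. \<omega> n \<noteq> None"
    and exits: "\<not> (\<exists>\<^sub>\<infinity>n. \<omega> n \<in> Some ` {c \<in> En N'. pair_of c \<in> exits M})"
    and visited: "\<And>s a t. (\<exists>\<^sub>\<infinity>n. proj.proj (\<omega> n) = Some (s, a)) \<Longrightarrow> t \<in> set_spmf (Pdist M s a) \<Longrightarrow>
      (\<exists>\<^sub>\<infinity>n. proj.proj (\<omega> n) = None \<or> map_option fst (proj.proj (\<omega> n)) = Some t)"
    and continued: "\<And>s m a g t b g'. ((s, m), (a, g)) \<in> proj.run'.inf_pairs \<omega> \<Longrightarrow>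
      ((t, memo s a g), (b, g')) \<in> En N' \<Longrightarrow> t \<in> set_spmf (Pdist M s a) \<Longrightarrow>
      (b, g') \<in> set_pmf (goal_sched [] (t, memo s a g)) \<Longrightarrow>
      ((t, memo s a g), (b, g')) \<in> proj.run'.inf_pairs \<omega>"
  shows "\<exists>D I. D \<in> X \<and> (D, I) \<in> I_star M k P \<and> (\<exists>n. \<omega> n \<in> Some ` picked D (Tau I)) \<and>
    (\<forall>i\<in>I. (\<lambda>n. fst (fst (the (\<omega> n)))) \<in> rabin_property (P i))"
proof -
  let ?J = "proj.run'.inf_pairs \<omega>"
  have En: "c \<in> En N'" if "\<omega> n = Some c" for n c
    using proj.run'.step_Some_En[OF ok[rule_format], of n "fst c" "snd c"] that by simp
  have J_En: "c \<in> En N'" if "c \<in> ?J" for c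
  proof -
    have "\<exists>\<^sub>\<infinity>n. \<omega> n = Some c" using that by (simp add: proj.run'.inf_pairs_def)
    then obtain n where "\<omega> n = Some c" by (rule frequently_ex[THEN exE])
    then show ?thesis by (rule En)
  qed
  have J_exit: "(s, a) \<notin> exits M" if "((s, m), (a, g)) \<in> ?J" for s m a g
  proof
    assume "(s, a) \<in> exits M"
    then have c: "((s, m), (a, g)) \<in> {c \<in> En N'. pair_of c \<in> exits M}"
      using J_En[OF that] by (simp add: pair_of_def)
    have "\<exists>\<^sub>\<infinity>n. \<omega> n = Some ((s, m), (a, g))" using that by (simp add: proj.run'.inf_pairs_def)
    then have "\<exists>\<^sub>\<infinity>n. \<omega> n \<in> Some ` {c \<in> En N'. pair_of c \<in> exits M}"
      by (rule frequently_elim1) (use c in simp)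
    then show False using exits by blast
  qed
  have "\<forall>\<^sub>\<infinity>n. \<omega> n \<in> Some ` ?J"
  proof (rule proj.run'.eventually_inf_pairs[OF _ some])
    show "\<forall>n. \<omega> n \<in> insert None (Some ` En N')"
    proof
      fix n show "\<omega> n \<in> insert None (Some ` En N')" using En[of n] by (cases "\<omega> n") auto
    qed
  qed
  then obtain n0 where n0: "\<And>n. n \<ge> n0 \<Longrightarrow> \<omega> n \<in> Some ` ?J" by (auto simp: MOST_nat_le)
  obtain s0 m0 a0 g where w0: "\<omega> n0 = Some ((s0, m0), (a0, g))" "((s0, m0), (a0, g)) \<in> ?J"
    using n0[of n0] by auto
  define D where "D = cls M s0"
  have s0: "(s0, a0) \<in> En M" "s0 \<in> S" "s0 \<in> states M" using valid_En[OF ok w0(1)] by blast+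
  have D: "D \<in> D_MEC M" "s0 \<in> D" unfolding D_def using cls_in in_cls s0(3) by blast+
  have after: "\<exists>s m a. \<omega> (n0 + j) = Some ((s, m), (a, g)) \<and> cls M s = D \<and> (s, a) \<notin> exits M" for j
  proof (induction j)
    case 0
    show ?case using w0 J_exit by (simp add: D_def)
  next
    case (Suc j)
    then obtain s m a where p: "\<omega> (n0 + j) = Some ((s, m), (a, g))" "cls M s = D" "(s, a) \<notin> exits M" by blast
    obtain t m' b g' where t: "\<omega> (Suc (n0 + j)) = Some ((t, m'), (b, g'))"
      using some[rule_format, of "Suc (n0 + j)"] by (metis not_None_eq surj_pair)
    have tJ: "((t, m'), (b, g')) \<in> ?J" using n0[of "Suc (n0 + j)"] t by auto
    obtain s' m'' a' g'' where q: "\<omega> (n0 + j) = Some ((s', m''), (a', g''))"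
      "t \<in> set_spmf (Pdist M s' a')" "m' = memo s' a' g''"
      by (rule valid_Suc[OF ok t])
    then have eq: "s' = s" "a' = a" "g'' = g" using p(1) by auto
    have "m' = Some g" using q(3) p(3) by (simp add: memo_def eq)
    then have "g' = g" using valid_walk(2)[OF ok t] by simp
    moreover have "cls M t = D"
      using stay_in_class[OF valid_En(1)[OF ok p(1)] p(3)] q(2) p(2) eq by simp
    ultimately show ?case using t J_exit[OF tJ] by auto
  qed
  \<comment> \<open>States of \<open>D\<close> at which every choice of the walk recurs forever;
    \<open>R\<close> is closed under steps of the walk.\<close>
  define R where "R = {t \<in> D. t \<in> S \<and> enabled M t \<noteq> {} \<and> (\<forall>b\<in>walk t g. ((t, Some g), (b, g)) \<in> ?J)}"
  have succ_J: "u \<in> R" if c: "((t, m), (b, g)) \<in> ?J" and t: "cls M t = D" and u: "u \<in> set_spmf (Pdist M t b)" for t m b u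
  proof -
    have tb: "((t, m), (b, g)) \<in> En N'" by (rule J_En[OF c])
    have ne: "(t, b) \<notin> exits M" by (rule J_exit[OF c])
    have tM: "(t, b) \<in> En M" "g \<in> acts Q" using tb by (auto simp: En_N')
    have "\<exists>\<^sub>\<infinity>n. \<omega> n = Some ((t, m), (b, g))" using c by (simp add: proj.run'.inf_pairs_def)
    then have "\<exists>\<^sub>\<infinity>n. proj.proj (\<omega> n) = Some (t, b)"
      by (rule frequently_elim1) (use tb in \<open>simp add: proj.proj_def\<close>)
    \<comment> \<open>The run is never lost, so the successor \<open>u\<close> is really visited and
      lies in \<open>S\<close>. This is what refutes a cut class below.\<close>
    then have "\<exists>\<^sub>\<infinity>n. proj.proj (\<omega> n) = None \<or> map_option fst (proj.proj (\<omega> n)) = Some u"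
      using u by (rule visited)
    then obtain n where n: "proj.proj (\<omega> n) = None \<or> map_option fst (proj.proj (\<omega> n)) = Some u"
      by (rule frequently_ex[THEN exE])
    obtain u' m' b' g' where w: "\<omega> n = Some ((u', m'), (b', g'))"
      using some[rule_format, of n] by (metis not_None_eq surj_pair)
    then have "u' = u" using n En[OF w] by (simp add: proj.proj_def)
    then have uS: "u \<in> S" "u \<in> states M" "enabled M u \<noteq> {}" using valid_En[OF ok w] by blast+
    have "cls M u = D" using stay_in_class[OF tM(1) ne u] t by simp
    then have uD: "u \<in> D" using in_cls[OF uS(2)] by simp
    have "((u, Some g), (b', g)) \<in> ?J" if b': "b' \<in> walk u g" for b'
    proof -
      have memo: "memo t b g = Some g" using ne by (simp add: memo_def)
      have "(u, b') \<in> En M" using b' walk_enabled by (auto simp: enabled_def)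
      then have "((u, memo t b g), (b', g)) \<in> En N'" using uS tM by (simp add: En_N' memo)
      moreover have "(b', g) \<in> set_pmf (goal_sched [] (u, memo t b g))"
        using b' set_goal_sched[OF uS(3)] by (simp add: memo)
      ultimately have "((u, memo t b g), (b', g)) \<in> ?J" using continued[OF c _ u] by blast
      then show ?thesis by (simp add: memo)
    qed
    then show ?thesis using uD uS by (simp add: R_def)
  qed
  have R_D: "t \<in> D" "cls M t = D" "t \<in> S" "t \<in> states M" if "t \<in> R" for t
    using that cls_eq[OF D(1)] S by (auto simp: R_def)
  have succ_R: "u \<in> R" if "t \<in> R" "b \<in> walk t g" "u \<in> set_spmf (Pdist M t b)" for t b u
  proof -
    have "((t, Some g), (b, g)) \<in> ?J" using that by (simp add: R_def)
    then show ?thesis using R_D(2)[OF that(1)] that(3) by (rule succ_J)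
  qed
  obtain t0 where t0: "t0 \<in> R"
    using succ_J[OF w0(2)] supp_nonempty[OF s0(1)] by (auto simp: D_def)
  have closed: "ec_states E \<subseteq> R" if E: "is_ec M E" and t1: "t1 \<in> R" "t1 \<in> ec_states E"
    and sub: "\<And>t b. t \<in> R \<Longrightarrow> (t, b) \<in> E \<Longrightarrow> b \<in> walk t g" for E t1
  proof
    fix u assume "u \<in> ec_states E"
    then have "(t1, u) \<in> (ec_edges M E)\<^sup>*" using ec_connected[OF E] t1 by blast
    then show "u \<in> R"
    proof (induction rule: rtrancl_induct)
      case (step v w)
      then obtain b where "(v, b) \<in> E" "w \<in> set_spmf (Pdist M v b)" by (auto simp: ec_edges_def)
      then show ?case using step.IH sub succ_R by blast
    qed (rule t1(1))
  qed
  have DX: "D \<in> X"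
  proof (rule ccontr)
    assume DX: "D \<notin> X"
    obtain E where E: "is_mec M E" "D = ec_states E"
      using walk_partial[of s0 g] s0 DX unfolding D_def by metis
    \<comment> \<open>In a cut class the walk roams the entire MEC, so \<open>R\<close> would
      contain all of \<open>D\<close> although it lies in \<open>S\<close>.\<close>
    have "ec_states E \<subseteq> R"
    proof (rule closed[OF mec_ec[OF E(1)] t0])
      show "t0 \<in> ec_states E" using R_D(1)[OF t0] E by simp
      fix t b assume t: "t \<in> R" "(t, b) \<in> E"
      obtain E' where E': "is_mec M E'" "cls M t = ec_states E'" "t \<in> ec_states E'" "walk t g = {a. (t, a) \<in> E'}"
        using walk_partial[of t g] R_D[OF t(1)] DX by metis
      have "E' = E" using is_mec_unique[OF E'(1) E(1) E'(3)] R_D(1)[OF t(1)] E(2) by blast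
      then show "b \<in> walk t g" using E'(4) t(2) by simp
    qed
    then have "D \<subseteq> S" using R_D(3) E(2) by blast
    then show False using DX D by (simp add: X_def)
  qed
  have g: "g \<in> enabled Q (Cls D)"
    using valid_goal[OF ok w0(1)] DX by (simp add: D_def)
  then consider (exit) s' a' where "s' \<in> D" "g = Orig a'" "(s', a') \<in> exits M"
    | (tau) I where "g = Tau I" "(D, I) \<in> I_star M k P"
    unfolding enabled_def mem_Collect_eq En_Q_Cls[OF D(1)] by blast
  then show ?thesis
  proof cases
    case exit
    \<comment> \<open>If \<open>R\<close> missed the source of the exit, the walk would roam the
      entire MEC and reach it. Hence the exit itself would recur forever, which is excluded.\<close>
    have "s' \<in> R"
    proof (rule ccontr)
      assume no: "s' \<notin> R"
      from s0(3) show False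
      proof (cases rule: class_mec_or_singleton)
        case (1 E)
        have "ec_states E \<subseteq> R"
        proof (rule closed[OF mec_ec[OF 1(1)] t0])
          show "t0 \<in> ec_states E" using R_D(1)[OF t0] 1 by (simp add: D_def)
          fix t b assume t: "t \<in> R" "(t, b) \<in> E"
          have tE: "t \<in> ec_states E" using t(2) by (force simp: ec_states_def)
          have "(t, a') \<notin> exits M"
            using action_source[of t a' s'] exit(3) exits_En no t(1) by blast
          then have "goal_acts t g = inner_acts t" using R_D(2)[OF t(1)] DX exit(2) by (simp add: goal_acts_def)
          then show "b \<in> walk t g" using inner_acts_mec[OF 1(1) tE] t(2) by (auto simp: walk_def)
        qed
        then show False using no exit(1) 1 by (auto simp: D_def)
      next
        case 2
        then show False using no exit(1) t0 R_D(1)[OF t0] by (simp add: D_def)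
      qed
    qed
    moreover from this have "a' \<in> walk s' g"
      using exit R_D(2) DX by (simp add: walk_def goal_acts_def)
    ultimately have "((s', Some g), (a', g)) \<in> ?J" by (simp add: R_def)
    then show ?thesis using J_exit exit(3) by blast
  next
    case tau
    let ?E' = "target D I"
    note E' = target[OF tau(2)]
    from tau(2) obtain E where E: "is_mec M E" "D = ec_states E" by (rule I_starD)
    have inE': "walk t g = {a. (t, a) \<in> ?E'}" if "cls M t = D" "t \<in> ec_states ?E'" for t
    proof -
      have "goal_acts t g = {a. (t, a) \<in> ?E'}" "goal_acts t g \<noteq> {}"
        using that DX tau by (auto simp: goal_acts_def ec_states_def)
      then show ?thesis by (auto simp: walk_def)
    qed
    have nonempty: "ec_states ?E' \<noteq> {}" using E'(1) by (auto simp: is_ec_def ec_states_def)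
    \<comment> \<open>If \<open>R\<close> avoided the target, the walk would roam the entire MEC,
      and the MEC contains the target.\<close>
    have "R \<inter> ec_states ?E' \<noteq> {}"
    proof
      assume no: "R \<inter> ec_states ?E' = {}"
      have "ec_states E \<subseteq> R"
      proof (rule closed[OF mec_ec[OF E(1)] t0])
        show "t0 \<in> ec_states E" using R_D(1)[OF t0] E by simp
        fix t b assume t: "t \<in> R" "(t, b) \<in> E"
        then have "t \<notin> ec_states ?E'" using no by blast
        then have "goal_acts t g = inner_acts t" using R_D(2)[OF t(1)] DX tau by (simp add: goal_acts_def)
        moreover have "t \<in> ec_states E" using t(2) by (force simp: ec_states_def)
        ultimately show "b \<in> walk t g" using inner_acts_mec[OF E(1)] t(2) by (auto simp: walk_def)
      qed
      then show False using no nonempty E'(2) E(2) by blast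
    qed
    then obtain t1 where t1: "t1 \<in> R" "t1 \<in> ec_states ?E'" by blast
    have E'_R: "ec_states ?E' \<subseteq> R"
    proof (rule closed[OF E'(1) t1])
      fix t b assume t: "t \<in> R" "(t, b) \<in> ?E'"
      then have "t \<in> ec_states ?E'" by (force simp: ec_states_def)
      then show "b \<in> walk t g" using inE'[OF R_D(2)[OF t(1)]] t(2) by simp
    qed
    have often: "\<exists>\<^sub>\<infinity>n. fst (fst (the (\<omega> n))) = t" if tE: "t \<in> ec_states ?E'" for t
    proof -
      have "t \<in> R" using E'_R tE by blast
      moreover obtain b where "(t, b) \<in> ?E'" using tE by (auto simp: ec_states_def)
      moreover from this have "b \<in> walk t g" using inE'[OF R_D(2)] calculation tE by blast
      ultimately have "((t, Some g), (b, g)) \<in> ?J" by (simp add: R_def)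
      then have "\<exists>\<^sub>\<infinity>n. \<omega> n = Some ((t, Some g), (b, g))" by (simp add: proj.run'.inf_pairs_def)
      then show ?thesis by (rule frequently_elim1) simp
    qed
    obtain n1 where n1: "n1 \<ge> n0" "fst (fst (the (\<omega> n1))) = t1"
      using often[OF t1(2)] unfolding INFM_nat_le by blast
    \<comment> \<open>Once in the target, the walk chooses only its pairs, and an end component is
      closed under successors.\<close>
    have inside: "fst (fst (the (\<omega> (n1 + j)))) \<in> ec_states ?E'" for j
    proof (induction j)
      case 0
      then show ?case using n1 t1 by simp
    next
      case (Suc j)
      obtain s m a where p: "\<omega> (n1 + j) = Some ((s, m), (a, g))" "cls M s = D"
        using after[of "n1 + j - n0"] n1(1) by auto
      obtain t m' b g' where t: "\<omega> (Suc (n1 + j)) = Some ((t, m'), (b, g'))"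
        using some[rule_format, of "Suc (n1 + j)"] by (metis not_None_eq surj_pair)
      obtain s' m'' a' g'' where q: "\<omega> (n1 + j) = Some ((s', m''), (a', g''))" "t \<in> set_spmf (Pdist M s' a')"
        by (rule valid_Suc[OF ok t])
      have "s \<in> ec_states ?E'" using Suc p by simp
      then have "(s, a) \<in> ?E'" using inE'[OF p(2)] valid_walk(1)[OF ok p(1)] by simp
      then have "t \<in> ec_states ?E'" using ec_closed[OF E'(1)] q p(1) by auto
      then show ?case using t by simp
    qed
    have prop_i: "(\<lambda>n. fst (fst (the (\<omega> n)))) \<in> rabin_property (P i)" if iI: "i \<in> I" for i
    proof -
      obtain F B where FB: "(F, B) \<in> P i" "ec_states ?E' \<inter> F \<noteq> {}" "ec_states ?E' \<subseteq> B"
        using E'(3)[OF iI] by (auto simp: sat_rabin_def)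
      then obtain t where t: "t \<in> ec_states ?E'" "t \<in> F" by blast
      have "\<exists>\<^sub>\<infinity>n. fst (fst (the (\<omega> n))) \<in> F"
        using often[OF t(1)] by (rule frequently_elim1) (use t in simp)
      moreover have "fst (fst (the (\<omega> n))) \<in> B" if "n \<ge> n1" for n
        using inside[of "n - n1"] that FB(3) by auto
      then have "\<forall>\<^sub>\<infinity>n. fst (fst (the (\<omega> n))) \<in> B" by (auto simp: MOST_nat_le)
      ultimately show ?thesis using FB(1) by (auto simp: rabin_property_def)
    qed
    \<comment> \<open>The step at which the goal was drawn is the one whose probability the flow
      bounds by \<open>z D I\<close>.\<close>
    obtain n' s' a' where og: "\<omega> n' = Some ((s', None), (a', g))" "cls M s' = cls M s0"
      using valid_origin[OF ok w0(1)] by blast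
    have "s' \<in> D" using in_cls[OF valid_En(3)[OF ok og(1)]] og(2) by (simp add: D_def)
    moreover have "a' \<in> acts M" using valid_En(1)[OF ok og(1)] by (simp add: En_def)
    ultimately have "\<omega> n' \<in> Some ` picked D (Tau I)" using og(1) tau(1) by (auto simp: picked_def)
    then show ?thesis using DX tau(2) prop_i by blast
  qed
qed

text \<open>Almost every run that is never lost has drawn some \<open>Tau I\<close> and satisfies
  all properties in \<open>I\<close>; if it violates \<open>P i\<close>, then
  \<open>i \<notin> I\<close>. A union bound over these goals leads to the loss.\<close>

lemma Pr_le_loss:
  assumes i: "i \<in> {1..k}"
  shows "Pr N proj.proj_sched (- rabin_property (P i)) \<le> loss k X z i"
proof -
  let ?Z = "{d \<in> I_star M k P. fst d \<in> X \<and> i \<notin> snd d}"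
  let ?p = "\<lambda>d. prb (\<lambda>\<omega>. \<exists>n. \<omega> n \<in> Some ` picked (fst d) (Tau (snd d)))"
  have finZ: "finite ?Z" using finite_I_star by simp
  have fP: "finite (P i)" by (rule finite_P[OF i])
  have "Pr N proj.proj_sched (- rabin_property (P i)) =
      Pr N' goal_sched {\<pi>. (\<lambda>n. fst (\<pi> n)) \<in> - rabin_property (P i)}"
    by (rule proj.Pr_proj)
      (rule proj.run.sets_not_rabin[OF fP, of "\<lambda>u. fst (the u)"],
       rule proj.run'.sets_not_rabin[OF fP, of "\<lambda>u. fst (fst (the u))"])
  also have "\<dots> \<le> prb (\<lambda>\<omega>. \<exists>d\<in>?Z. \<exists>n. \<omega> n \<in> Some ` picked (fst d) (Tau (snd d)))"
    unfolding Pr_def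
  proof (rule proj.run'.path.finite_measure_mono_AE)
    show "AE \<omega> in proj.run'.\<mu>. \<omega> \<in> {\<omega> \<in> space proj.run'.\<mu>. (\<forall>n. \<omega> n \<noteq> None) \<and>
          (\<lambda>n. fst (the (\<omega> n))) \<in> {\<pi>. (\<lambda>n. fst (\<pi> n)) \<in> - rabin_property (P i)}} \<longrightarrow>
        \<omega> \<in> {\<omega> \<in> space proj.run'.\<mu>. \<exists>d\<in>?Z. \<exists>n. \<omega> n \<in> Some ` picked (fst d) (Tau (snd d))}"
      using proj.run'.AE_next_step AE_finitely_many_exits AE_successors_visited AE_continued
    proof eventually_elim
      case (elim \<omega>)
      show ?case
      proof
        assume \<omega>: "\<omega> \<in> {\<omega> \<in> space proj.run'.\<mu>. (\<forall>n. \<omega> n \<noteq> None) \<and>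
          (\<lambda>n. fst (the (\<omega> n))) \<in> {\<pi>. (\<lambda>n. fst (\<pi> n)) \<in> - rabin_property (P i)}}"
        then have some: "\<forall>n. \<omega> n \<noteq> None" and not: "(\<lambda>n. fst (fst (the (\<omega> n)))) \<notin> rabin_property (P i)"
          by auto
        obtain D I where D: "D \<in> X" "(D, I) \<in> I_star M k P" "\<exists>n. \<omega> n \<in> Some ` picked D (Tau I)"
          "\<forall>i\<in>I. (\<lambda>n. fst (fst (the (\<omega> n)))) \<in> rabin_property (P i)"
          using settles[OF elim(1) some elim(2)] elim(3,4) by blast
        then have "(D, I) \<in> ?Z" using not by auto
        then show "\<omega> \<in> {\<omega> \<in> space proj.run'.\<mu>. \<exists>d\<in>?Z. \<exists>n. \<omega> n \<in> Some ` picked (fst d) (Tau (snd d))}"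
          using \<omega> D(3) by force
      qed
    qed
  qed (use finZ in measurable)
  also have "\<dots> \<le> (\<Sum>d\<in>?Z. ?p d)"
  proof -
    have "{\<omega> \<in> space proj.run'.\<mu>. \<exists>d\<in>?Z. \<exists>n. \<omega> n \<in> Some ` picked (fst d) (Tau (snd d))} =
        (\<Union>d\<in>?Z. {\<omega> \<in> space proj.run'.\<mu>. \<exists>n. \<omega> n \<in> Some ` picked (fst d) (Tau (snd d))})" by blast
    moreover have "measure proj.run'.\<mu> (\<Union>d\<in>?Z. {\<omega> \<in> space proj.run'.\<mu>. \<exists>n. \<omega> n \<in> Some ` picked (fst d) (Tau (snd d))}) \<le>
        (\<Sum>d\<in>?Z. ?p d)"
      by (intro proj.run'.path.finite_measure_subadditive_finite finZ image_subsetI) measurable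
    ultimately show ?thesis by simp
  qed
  also have "\<dots> \<le> (\<Sum>d\<in>?Z. z (fst d) (snd d))"
    by (intro sum_mono prob_settle_le) auto
  also have "\<dots> \<le> (\<Sum>d\<in>X \<times> {I. I \<subseteq> {1..k} \<and> i \<notin> I}. z (fst d) (snd d))"
  proof (rule sum_mono2)
    show "finite (X \<times> {I. I \<subseteq> {1..k} \<and> i \<notin> I})"
      using finite_D_MEC by (intro finite_cartesian_product) (auto simp: X_def intro: finite_subset[of _ "Pow {1..k}"])
    show "?Z \<subseteq> X \<times> {I. I \<subseteq> {1..k} \<and> i \<notin> I}"
    proof
      fix d assume "d \<in> ?Z"
      then show "d \<in> X \<times> {I. I \<subseteq> {1..k} \<and> i \<notin> I}"
        using I_star_subset[of "fst d" "snd d"] by (simp add: mem_Times_iff)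
    qed
  qed (use flow_nonneg(2)[OF flow_X] in auto)
  also have "\<dots> = loss k X z i"
    unfolding loss_def by (simp add: sum.cartesian_product split_beta)
  finally show ?thesis .
qed

end

section \<open>Lifting minimal witnesses\<close>

context rabin_mdp
begin

text \<open>A scheduler of the MDP yields a flow, and the flow a scheduler of the quotient whose
  probabilities are at most as large. The bound that holds there carries over, \<open>cmp\<close>
  being monotone.\<close>

lemma query_lift:
  assumes T: "T \<subseteq> states Q" "init Q \<in> T" and X: "X = {D \<in> D_MEC M. Cls D \<in> T}"
    and cmp: "\<forall>a b c. cmp a c \<longrightarrow> a \<le> b \<longrightarrow> cmp b (c::real)"
    and query: "forall_or_query k cmp lam (\<lambda>i. reach (G_bar k i)) (subsystem Q T)"
  shows "forall_or_query k cmp lam (\<lambda>i. - rabin_property (P i)) (subsystem M (\<Union>X))"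
  unfolding forall_or_query_def
proof (intro allI impI)
  fix \<sigma> assume \<sigma>: "is_scheduler (subsystem M (\<Union>X)) \<sigma>"
  have XD: "X \<subseteq> D_MEC M" by (auto simp: X)
  have sub: "\<Union>X \<subseteq> states M" using XD D_MEC_subset by blast
  have "cls M (init M) \<in> X" using T(2) cls_in[OF init_in] by (simp add: X init_Q)
  then have init: "init M \<in> \<Union>X" using in_cls[OF init_in] by blast
  interpret R: class_run M k P X \<sigma>
    by unfold_locales (rule is_sub_mdp_subsystem[OF is_sub init sub], rule \<sigma>, rule sub, rule XD)
  obtain i where i: "i \<in> {1..k}"
    "cmp (Pr (subsystem Q T) (flow_scheduler R.taken R.settle) (reach (G_bar k i))) (lam i)"
    using query scheduler_of_flow(1)[OF T X R.flow_of_run] unfolding forall_or_query_def by blast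
  have "Pr (subsystem Q T) (flow_scheduler R.taken R.settle) (reach (G_bar k i)) \<le>
      Pr (subsystem M (\<Union>X)) \<sigma> (- rabin_property (P i))"
    using scheduler_of_flow(2)[OF T X R.flow_of_run] R.loss_le_Pr[OF i(1)] by (rule order_trans)
  then show "\<exists>i\<in>{1..k}. cmp (Pr (subsystem M (\<Union>X)) \<sigma> (- rabin_property (P i))) (lam i)"
    using i cmp by blast
qed

text \<open>A flow on the classes inside \<open>S\<close> is realized by a scheduler of the
  subsystem, and the query is applied to that scheduler.\<close>

lemma flow_query:
  assumes S: "S \<subseteq> states M" "init M \<in> S" and X: "X = {D \<in> D_MEC M. D \<subseteq> S}"
    and flow: "is_flow M k P X y z"
    and query: "forall_or_query k cmp lam (\<lambda>i. - rabin_property (P i)) (subsystem M S)"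
    and cmp: "\<forall>a b c. cmp a c \<longrightarrow> a \<le> b \<longrightarrow> cmp b (c::real)"
  shows "\<exists>i\<in>{1..k}. cmp (loss k X z i) (lam i)"
proof -
  interpret R: realization M k P S y z
    by unfold_locales (rule S, rule S, use flow X in simp)
  have XX: "R.X = X" by (simp add: X R.X_def)
  show ?thesis
    using query R.proj.is_scheduler_proj R.Pr_le_loss cmp unfolding forall_or_query_def XX by blast
qed

text \<open>All absorbing states join the subsystem of the quotient: they keep \<open>Tau\<close>
  steps from being lost and, in the application, cost no labels.\<close>

lemma query_project:
  assumes S: "S \<subseteq> states M" "init M \<in> S" and X: "X = {D \<in> D_MEC M. D \<subseteq> S}"
    and init: "cls M (init M) \<in> X"
    and query: "forall_or_query k cmp lam (\<lambda>i. - rabin_property (P i)) (subsystem M S)"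
    and cmp: "\<forall>a b c. cmp a c \<longrightarrow> a \<le> b \<longrightarrow> cmp b (c::real)"
  shows "forall_or_query k cmp lam (\<lambda>i. reach (G_bar k i)) (subsystem Q (Cls ` X \<union> Bot ` Pow {1..k}))"
  unfolding forall_or_query_def
proof (intro allI impI)
  let ?T = "Cls ` X \<union> Bot ` Pow {1..k}"
  fix \<sigma> assume \<sigma>: "is_scheduler (subsystem Q ?T) \<sigma>"
  have T: "?T \<subseteq> states Q" "init Q \<in> ?T" using init by (auto simp: X states_Q init_Q)
  interpret R: quotient_run M k P ?T \<sigma>
    by unfold_locales (rule is_sub_mdp_subsystem[OF is_sub_Q T(2,1)], rule \<sigma>, rule T(1))
  have XX: "R.X = X" unfolding R.X_def by (auto simp: X)
  have bots: "R.bots = Pow {1..k}" unfolding R.bots_def by auto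
  obtain i where "i \<in> {1..k}" "cmp (loss k X R.tau_flow i) (lam i)"
    using flow_query[OF S X R.flow_of_quotient_run[unfolded XX] query cmp] by blast
  then show "\<exists>i\<in>{1..k}. cmp (Pr (subsystem Q ?T) \<sigma> (reach (G_bar k i))) (lam i)"
    using R.loss_le_reach[OF bots, unfolded XX] cmp by blast
qed

text \<open>
  If the class of the initial state is not contained in \<open>S\<close>, no flow reaches the classes
  inside \<open>S\<close>, so the zero flow shows that the query is trivial.
\<close>

lemma trivial_if_init_partial:
  assumes S: "S \<subseteq> states M" "init M \<in> S" and init: "\<not> cls M (init M) \<subseteq> S"
    and query: "forall_or_query k cmp lam (\<lambda>i. - rabin_property (P i)) (subsystem M S)"
    and cmp: "\<forall>a b c. cmp a c \<longrightarrow> a \<le> b \<longrightarrow> cmp b (c::real)"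
  shows "\<exists>i\<in>{1..k}. cmp 0 (lam i)"
proof -
  let ?X = "{D \<in> D_MEC M. D \<subseteq> S}"
  have "init M \<notin> D" if "D \<in> ?X" for D using that init cls_eq by auto
  then have "is_flow M k P ?X (\<lambda>_. 0) (\<lambda>_ _. 0)"
    by (auto simp: is_flow_def inflow_def outflow_def)
  from flow_query[OF S refl this query cmp] show ?thesis by (simp add: loss_def)
qed

end

theorem theorem3:
  fixes M :: "('s, 'a) mdp"
    and k :: nat
    and P :: "nat \<Rightarrow> 's rabin"
    and lam :: "nat \<Rightarrow> real"
    and cmp :: "real \<Rightarrow> real \<Rightarrow> bool"
    and L :: "'l set"
    and \<Lambda> :: "'s \<Rightarrow> 'l set"
    and T :: "'s qstate set"
    and X :: "'s set set"
  assumes mdp: "is_mdp M"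
    and rabin: "\<forall>i\<in>{1..k}. P i \<subseteq> Pow (states M) \<times> Pow (states M)"
    and lam: "\<forall>i\<in>{1..k}. 0 \<le> lam i \<and> lam i \<le> 1"
    and cmp: "cmp = (\<ge>) \<or> cmp = (>)"
    and labeling: "finite L" "\<forall>s\<in>states M. \<Lambda> s \<subseteq> L"
    and nontrivial: "(\<exists>i\<in>{1..k}. cmp 0 (lam i)) \<longrightarrow>
          labels \<Lambda> (class_of (D_MEC M) (init M)) = \<Lambda> (init M)"
    and min: "minimal_witnessing (mec_quotient M k P)
          (forall_or_query k cmp lam (\<lambda>i. reach (G_bar k i))) (lift_labeling \<Lambda>) T"
    and X: "X = {D \<in> D_MEC M. Cls D \<in> T}"
  shows "minimal_witnessing M
          (forall_or_query k cmp lam (\<lambda>i. - rabin_property (P i))) \<Lambda> (\<Union>X)"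
proof -
  interpret rabin_mdp M k P
    by unfold_locales (rule mdp, rule rabin)
  let ?\<Phi> = "forall_or_query k cmp lam (\<lambda>i. - rabin_property (P i))"
  let ?\<Phi>' = "forall_or_query k cmp lam (\<lambda>i. reach (G_bar k i))"
  have mono: "\<forall>a b c. cmp a c \<longrightarrow> a \<le> b \<longrightarrow> cmp b c"
    using cmp by auto
  have wit: "init Q \<in> T" "T \<subseteq> states Q" "?\<Phi>' (subsystem Q T)"
    using min by (auto simp: minimal_witnessing_def witnessing_def)
  have least: "card (labels (lift_labeling \<Lambda>) T) \<le> card (labels (lift_labeling \<Lambda>) T')"
    if "witnessing Q ?\<Phi>' T'" for T'
    using min that by (auto simp: minimal_witnessing_def)
  have XD: "X \<subseteq> D_MEC M" by (auto simp: X)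
  have sub: "\<Union>X \<subseteq> states M" using XD D_MEC_subset by blast
  have initX: "cls M (init M) \<in> X" using wit(1) cls_in[OF init_in] by (simp add: X init_Q)
  have init: "init M \<in> \<Union>X" using initX in_cls[OF init_in] by blast
  \<comment> \<open>Absorbing states carry no label, and a class carries those of its
    states.\<close>
  have labels_T: "labels (lift_labeling \<Lambda>) T = labels \<Lambda> (\<Union>X)"
  proof
    show "labels (lift_labeling \<Lambda>) T \<subseteq> labels \<Lambda> (\<Union>X)"
    proof
      fix l assume "l \<in> labels (lift_labeling \<Lambda>) T"
      then obtain q where q: "q \<in> T" "l \<in> lift_labeling \<Lambda> q" by (auto simp: labels_def)
      then show "l \<in> labels \<Lambda> (\<Union>X)"
        using wit(2) by (cases q) (auto simp: labels_def X states_Q)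
    qed
    show "labels \<Lambda> (\<Union>X) \<subseteq> labels (lift_labeling \<Lambda>) T"
      by (force simp: labels_def X)
  qed
  have fin: "finite (labels \<Lambda> S)" if "S \<subseteq> states M" for S
    by (rule finite_subset[OF _ labeling(1)]) (use that labeling(2) in \<open>auto simp: labels_def\<close>)
  have "witnessing M ?\<Phi> (\<Union>X)"
    unfolding witnessing_def using init sub query_lift[OF wit(2,1) X mono wit(3)] by simp
  moreover have "card (labels \<Lambda> (\<Union>X)) \<le> card (labels \<Lambda> S)" if "witnessing M ?\<Phi> S" for S
  proof -
    have S: "S \<subseteq> states M" "init M \<in> S" and query: "?\<Phi> (subsystem M S)"
      using that by (auto simp: witnessing_def)
    show ?thesis
    proof (cases "\<exists>i\<in>{1..k}. cmp 0 (lam i)")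
      case True
      \<comment> \<open>A trivial query holds in every subsystem, so minimality bounds the labels of
        \<open>T\<close> by those of the initial class. By \<open>nontrivial\<close> these are the
        labels of the initial state, which every witness contains.\<close>
      have "witnessing Q ?\<Phi>' {init Q}"
        using trivial_query[of k cmp lam] True cmp cls_in[OF init_in]
        by (auto simp: witnessing_def init_Q states_Q)
      then have "card (labels \<Lambda> (\<Union>X)) \<le> card (labels (lift_labeling \<Lambda>) {init Q})"
        using least labels_T by metis
      also have "labels (lift_labeling \<Lambda>) {init Q} = \<Lambda> (init M)"
        using nontrivial True by (simp add: labels_def init_Q)
      also have "card (\<Lambda> (init M)) \<le> card (labels \<Lambda> S)"
        using S(2) by (intro card_mono fin S(1)) (auto simp: labels_def)
      finally show ?thesis .
    next
      case False
      let ?X = "{D \<in> D_MEC M. D \<subseteq> S}"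
      \<comment> \<open>Classes cut by \<open>S\<close> are dropped, so each label of this subsystem
        occurs in \<open>S\<close>.\<close>
      let ?T = "Cls ` ?X \<union> Bot ` Pow {1..k}"
      have "cls M (init M) \<subseteq> S"
        using False trivial_if_init_partial[OF S _ query mono] by blast
      then have init': "cls M (init M) \<in> ?X" using cls_in[OF init_in] by simp
      have "witnessing Q ?\<Phi>' ?T"
        using query_project[OF S refl init' query mono] init' by (auto simp: witnessing_def init_Q states_Q)
      then have "card (labels \<Lambda> (\<Union>X)) \<le> card (labels (lift_labeling \<Lambda>) ?T)"
        using least labels_T by metis
      also have "\<dots> \<le> card (labels \<Lambda> S)"
        by (intro card_mono fin S(1)) (auto simp: labels_def)
      finally show ?thesis .
    qed
  qed
  ultimately show ?thesis by (simp add: minimal_witnessing_def)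
qed

end
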